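(* Let $\Phi:\mathbb{C}\to\mathbb{C}$ be a non-constant entire function of exponential type with $\Phi(0)=1$. (a) If $\Phi$ is of subexponential growth, then $\Phi(D)$ has a hypercyclic algebra. (b) Suppose $\Phi$ is not of subexponential growth. 1. If $\Phi$ has no zeros, then $\Phi(D)$ has no hypercyclic algebra. 2. If $\Phi$ is of the form $\Phi(z)=e^{az}p(z)$ for some non-constant polynomial $p(z)=1+a_1z+a_2z^2+\dots+a_rz^r$ and some non-zero scalar $a\in\mathbb{C}$, with $a_1a^{-1}\in\mathbb{C}\setminus\mathbb{R}$ or with $2a_2\neq a_1^2$, then $\Phi(D)$ supports a hypercyclic algebra. 3. Suppose $\Phi$ has infinitely many zeros, and let $$\Phi(z)=e^{az}\prod_{n=1}^\infty E_p\left(\frac{z}{z_n}\right)$$ denote its Hadamard factorization. If $\sum_{n=1}^\infty z_n^{-2}\neq 0$, then the following hold: (i) If $\sum_{n=1}^\infty |z_n|^{-1}$ converges, then $\Phi(D)$ has a hypercyclic algebra. (ii) If $\sum_{n=1}^\infty |z_n|^{-1}$ diverges and $a\neq 0$, then $\Phi(D)$ has a hypercyclic algebra.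
   Context: $H(\mathbb{C})$ is the algebra (under pointwise multiplication) of entire functions on $\mathbb{C}$ with the compact-open topology, and $D:f\mapsto f'$ is complex differentiation. For a non-constant entire function $\Phi$ let $M(r)=\sup_{|z|\le r}|\Phi(z)|$; its order is $\rho=\limsup_{r\to\infty}\frac{\log\log M(r)}{\log r}$, and if $\rho<\infty$ its type is $\tau=\limsup_{r\to\infty}r^{-\rho}\log M(r)$ (a constant function has order $0$). $\Phi$ is of growth $(\rho_0,\tau_0)$ if its order is less than $\rho_0$, or its order equals $\rho_0$ and its type does not exceed $\tau_0$. $\Phi$ is of exponential type if it is of growth $(1,\tau)$ for some $\tau<\infty$, and of subexponential growth if it is of growth $(1,0)$. For $\Phi(z)=\sum_{n\ge0}a_nz^n$ of exponential type, $\Phi(D):H(\mathbb{C})\to H(\mathbb{C})$ is the continuous linear operator $f\mapsto\sum_{n\ge 0}a_nD^nf$. A vector $f$ is hypercyclic for an operator $T$ if its orbit $\{T^nf:n\ge 0\}$ is dense. A hypercyclic algebra for $T$ is a (nonzero) subalgebra all of whose non-zero elements are hypercyclic vectors for $T$; "$T$ has/supports a hypercyclic algebra" means that one exists. In (b)2, $a_2$ is the coefficient of $z^2$ in $p$ (so $a_2=0$ if $r=1$). In (b)3, $(z_n)$ is the sequence of zeros of $\Phi$ listed with multiplicity, with $0<|z_1|\le|z_2|\le\dots$; $E_0(z)=1-z$ and $E_1(z)=(1-z)e^{z}$; the genus $p$ is $0$ if $\sum_n|z_n|^{-1}<\infty$ and $1$ if $\sum_n|z_n|^{-1}=\infty$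 (for $\Phi$ of exponential type $p\in\{0,1\}$, $\sum_n |z_n|^{-2}<\infty$, and the Hadamard factorization has the displayed form since $\Phi(0)=1$). *)

theory Defs
  imports "HOL-Complex_Analysis.Complex_Analysis"
begin

definition entire_fun_top :: "(complex \<Rightarrow> complex) topology" where
  "entire_fun_top =
     subtopology (topology_generated_by {{f. f ` K \<subseteq> U} |K U. compact K \<and> open U})
       {f. f holomorphic_on UNIV}"

lemma topspace_entire_fun_top [simp]: "topspace entire_fun_top = {f. f holomorphic_on UNIV}"
proof -
  have "UNIV \<in> {{f::complex \<Rightarrow> complex. f ` K \<subseteq> U} |K U. compact K \<and> open U}"
    by (auto intro!: exI[of _ "{}"])
  then have "\<Union>{{f::complex \<Rightarrow> complex. f ` K \<subseteq> U} |K U. compact K \<and> open U} = UNIV"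
    by blast
  then show ?thesis
    by (simp add: entire_fun_top_def topology_generated_by_topspace)
qed

definition hypercyclic_vector ::
    "((complex \<Rightarrow> complex) \<Rightarrow> (complex \<Rightarrow> complex)) \<Rightarrow> (complex \<Rightarrow> complex) \<Rightarrow> bool" where
  "hypercyclic_vector T f \<longleftrightarrow>
     f holomorphic_on UNIV \<and>
     entire_fun_top closure_of (range (\<lambda>n. (T ^^ n) f)) = topspace entire_fun_top"

text \<open>Subalgebras need not contain the constant function 1.\<close>

definition entire_subalgebra :: "(complex \<Rightarrow> complex) set \<Rightarrow> bool" where
  "entire_subalgebra A \<longleftrightarrow>
     A \<subseteq> {f. f holomorphic_on UNIV} \<and>
     (\<lambda>_. 0) \<in> A \<and>
     (\<forall>f\<in>A. \<forall>g\<in>A. (\<lambda>z. f z + g z) \<in> A) \<and>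
     (\<forall>c. \<forall>f\<in>A. (\<lambda>z. c * f z) \<in> A) \<and>
     (\<forall>f\<in>A. \<forall>g\<in>A. (\<lambda>z. f z * g z) \<in> A)"

definition has_hypercyclic_algebra ::
    "((complex \<Rightarrow> complex) \<Rightarrow> (complex \<Rightarrow> complex)) \<Rightarrow> bool" where
  "has_hypercyclic_algebra T \<longleftrightarrow>
     (\<exists>A. entire_subalgebra A \<and> A \<noteq> {\<lambda>_. 0} \<and>
          (\<forall>f\<in>A. f \<noteq> (\<lambda>_. 0) \<longrightarrow> hypercyclic_vector T f))"

text \<open>The operator \<open>\<Phi>(D)\<close>. For \<open>\<Phi>\<close> of exponential type and \<open>f\<close> entire, the series
  \<open>\<Sum>n. a\<^sub>n D\<^sup>n f\<close> converges locally uniformly, so its sum in the space of entire functions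
  is its pointwise sum.\<close>

definition diff_operator ::
    "(complex \<Rightarrow> complex) \<Rightarrow> (complex \<Rightarrow> complex) \<Rightarrow> (complex \<Rightarrow> complex)" where
  "diff_operator \<Phi> f = (\<lambda>z. \<Sum>n. fps_nth (fps_expansion \<Phi> 0) n * (deriv ^^ n) f z)"

definition max_modulus :: "(complex \<Rightarrow> complex) \<Rightarrow> real \<Rightarrow> real" where
  "max_modulus \<Phi> r = (SUP z\<in>cball 0 r. norm (\<Phi> z))"

definition growth_order :: "(complex \<Rightarrow> complex) \<Rightarrow> ereal" where
  "growth_order \<Phi> =
     (if \<Phi> constant_on UNIV then 0
      else Limsup at_top (\<lambda>r::real. ereal (ln (ln (max_modulus \<Phi> r)) / ln r)))"

text \<open>Only meaningful for non-constant \<open>\<Phi>\<close> of finite order.\<close>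

definition growth_type :: "(complex \<Rightarrow> complex) \<Rightarrow> ereal" where
  "growth_type \<Phi> =
     Limsup at_top
       (\<lambda>r::real. ereal (r powr (- real_of_ereal (growth_order \<Phi>)) * ln (max_modulus \<Phi> r)))"

definition of_growth :: "(complex \<Rightarrow> complex) \<Rightarrow> real \<Rightarrow> real \<Rightarrow> bool" where
  "of_growth \<Phi> \<rho> \<tau> \<longleftrightarrow>
     growth_order \<Phi> < ereal \<rho> \<or>
     growth_order \<Phi> = ereal \<rho> \<and> growth_type \<Phi> \<le> ereal \<tau>"

definition exponential_type :: "(complex \<Rightarrow> complex) \<Rightarrow> bool" where
  "exponential_type \<Phi> \<longleftrightarrow> (\<exists>\<tau>. of_growth \<Phi> 1 \<tau>)"

definition subexponential_growth :: "(complex \<Rightarrow> complex) \<Rightarrow> bool" where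
  "subexponential_growth \<Phi> \<longleftrightarrow> of_growth \<Phi> 1 0"

text \<open>An enumeration, starting at index 0, of the infinitely many zeros of \<open>\<Phi>\<close> in order of
  increasing modulus, each zero repeated according to its multiplicity.\<close>

definition zero_sequence :: "(complex \<Rightarrow> complex) \<Rightarrow> (nat \<Rightarrow> complex) \<Rightarrow> bool" where
  "zero_sequence \<Phi> zs \<longleftrightarrow>
     (\<forall>n. 0 < norm (zs n)) \<and>
     mono (\<lambda>n. norm (zs n)) \<and>
     range zs = {w. \<Phi> w = 0} \<and>
     (\<forall>w. \<Phi> w = 0 \<longrightarrow> int (card {n. zs n = w}) = zorder \<Phi> w)"

definition zero_genus :: "(nat \<Rightarrow> complex) \<Rightarrow> nat" where
  "zero_genus zs = (if summable (\<lambda>n. inverse (norm (zs n))) then 0 else 1)"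

text \<open>The library's \<open>weierstrass_factor\<close> at 0 and 1 gives \<open>E\<^sub>0\<close> and \<open>E\<^sub>1\<close>.\<close>

definition hadamard_factorization ::
    "(complex \<Rightarrow> complex) \<Rightarrow> complex \<Rightarrow> (nat \<Rightarrow> complex) \<Rightarrow> bool" where
  "hadamard_factorization \<Phi> a zs \<longleftrightarrow>
     (\<forall>w. convergent_prod (\<lambda>n. weierstrass_factor (zero_genus zs) (w / zs n)) \<and>
          \<Phi> w = exp (a * w) * (\<Prod>n. weierstrass_factor (zero_genus zs) (w / zs n)))"

end

theory Submission
  imports Defs "HOL-Real_Asymp.Real_Asymp" "HOL-Computational_Algebra.Fundamental_Theorem_Algebra"
begin

text \<open>
  Everything except the zero-free case follows from one statement
  (\<open>nonexponential_symbol_has_hypercyclic_algebra\<close>): if \<open>\<Phi>\<close> is entire of exponential type,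
  \<open>\<Phi> 0 = 1\<close>, and \<open>\<Phi>\<close> is not of the form \<open>exp (c * z)\<close>, then \<open>T = \<Phi>(D)\<close> has a hypercyclic
  algebra. It applies to symbols of subexponential growth because \<open>exp (c * z)\<close> with \<open>c \<noteq> 0\<close> has
  order 1 and type \<open>norm c\<close>, and to the symbols \<open>exp (a * z) * p z\<close> with \<open>p\<close> non-constant and to
  those with infinitely many zeros because an exponential never vanishes. A zero-free \<open>\<Phi>\<close> of exponential type is
  \<open>exp (a * z)\<close>, so that \<open>T\<close> is the translation by \<open>a\<close>; the orbit of a square then consists of
  squares, and no square is close to the function \<open>z\<close> on the unit circle.

  The algebra consists of all \<open>P \<circ> f\<close> with \<open>P\<close> a polynomial without constant term and \<open>f\<close> a single
  entire function. It suffices that for every \<open>m > 0\<close> and every target \<open>g\<close> some iterate \<open>T ^^ N\<close>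
  brings \<open>f ^ m\<close> close to \<open>g\<close> and all lower powers \<open>f ^ n\<close>, \<open>0 < n < m\<close>, close to 0: taking for
  \<open>m\<close> the degree of \<open>P\<close>, only the leading term of \<open>P \<circ> f\<close> survives. By a Baire category argument
  such an \<open>f\<close> exists if for each single \<open>m\<close> and \<open>g\<close> the property can be achieved by functions
  \<open>u\<close> arbitrarily close to any prescribed entire function; this is \<open>power_targeting\<close>.

  There \<open>u\<close> is a sum of exponentials, and \<open>exp (\<lambda> * z)\<close> is an eigenvector of \<open>T\<close> with eigenvalue
  \<open>\<Phi> \<lambda>\<close>. One part of \<open>u\<close> approximates the prescribed function and has its frequencies on a short
  ray \<open>t w\<close> on which \<open>norm \<Phi> < 1\<close>. If \<open>g\<close> is approximated by the sum of the
  \<open>\<beta>\<^sub>j exp (\<mu>\<^sub>j z)\<close> with \<open>norm (\<Phi> \<mu>\<^sub>j) > 1\<close>, the other part of \<open>u\<close> is the sum of the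
  \<open>(\<beta>\<^sub>j / \<Phi> \<mu>\<^sub>j ^ N)\<close> to the power \<open>1 / m\<close> times \<open>exp (\<mu>\<^sub>j z / m)\<close>, which is small for large \<open>N\<close>.
  In \<open>T ^^ N\<close> applied to \<open>u ^ m\<close> the pure \<open>m\<close>-th powers reproduce \<open>g\<close>. All other products in
  \<open>u ^ n\<close>, \<open>n \<le> m\<close>, must tend to 0, and this amounts to finitely many inequalities for
  \<open>h = ln (norm \<Phi>)\<close>: at a frequency that is a sum of \<open>j\<close> of the \<open>\<mu>\<^sub>k / m\<close> and of points of the ray,
  \<open>h\<close> must be smaller than the corresponding sum of the \<open>h \<mu>\<^sub>k / m\<close>.

  Such frequencies exist arbitrarily close to 0 (\<open>convex_configuration\<close>). Near 0 write
  \<open>\<Phi> = exp H\<close> with \<open>H z = c z + d z ^ k + \<dots>\<close>, where \<open>k \<ge> 2\<close> and \<open>d \<noteq> 0\<close> because \<open>\<Phi>\<close> is not an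
  exponential. The \<open>k\<close> directions in which \<open>d z ^ k\<close> is positive add up to 0, so
  \<open>c z\<close> has nonnegative real part in one of them. At a small point \<open>\<mu>\<close> in that direction \<open>h \<mu> > 0\<close>
  and \<open>h (t \<mu>) < t h \<mu>\<close> for \<open>t = j / m\<close> with \<open>0 < j < m\<close>, since the linear terms cancel and
  \<open>t ^ k < t\<close>; this handles the products with fewer than \<open>m\<close> factors \<open>exp (\<mu>\<^sub>k z / m)\<close>, by
  continuity for all \<open>\<mu>\<^sub>k\<close> near \<open>\<mu>\<close>. Moreover \<open>H''\<close> does not vanish at \<open>\<mu>\<close>, so the harmonic
  function \<open>h\<close> is strictly convex along a segment from \<open>\<mu>\<close> in a suitable direction; placing the
  \<open>\<mu>\<^sub>k\<close> on this segment handles the products with \<open>m\<close> factors that are not all equal.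
\<close>

section \<open>The compact-open topology on entire functions\<close>

abbreviation entire :: "(complex \<Rightarrow> complex) \<Rightarrow> bool" where
  "entire f \<equiv> f holomorphic_on UNIV"

lemma entire_continuous_on: "entire f \<Longrightarrow> continuous_on S f"
  using holomorphic_on_imp_continuous_on holomorphic_on_subset by blast

lemma entire_norm_bounded:
  assumes "entire f"
  obtains M where "M > 0" "\<And>z. z \<in> cball 0 R \<Longrightarrow> norm (f z) \<le> M"
proof -
  have "compact (f ` cball 0 R)"
    by (intro compact_continuous_image entire_continuous_on assms) auto
  then have "bounded (f ` cball 0 R)" by (rule compact_imp_bounded)
  then obtain M where "M > 0" "\<forall>x\<in>f ` cball 0 R. norm x \<le> M"
    unfolding bounded_pos by blast
  then show thesis using that by blast
qed

text \<open>A compact set lies in some disc, and the compact image of it under \<open>g\<close> has a uniform neighbourhood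
inside any open set that contains it. So sup-norm balls over discs are small enough to fit into the
open sets of the compact-open topology; the induction follows the generation of that topology.\<close>

lemma entire_fun_top_basic_nhd:
  assumes "openin entire_fun_top W" "g \<in> W"
  shows "\<exists>R. \<exists>\<epsilon>>0. \<forall>h. entire h \<longrightarrow> (\<forall>z\<in>cball 0 R. norm (h z - g z) < \<epsilon>) \<longrightarrow> h \<in> W"
proof -
  let ?S = "{{f::complex \<Rightarrow> complex. f ` K \<subseteq> U} |K U. compact K \<and> open U}"
  obtain V where V: "generate_topology_on ?S V" and W: "W = V \<inter> {f. entire f}"
    using assms(1) unfolding entire_fun_top_def openin_subtopology
    by (auto simp: openin_topology_generated_by_iff)
  from assms W have g: "entire g" "g \<in> V" by auto
  from V g(2) have "\<exists>R. \<exists>\<epsilon>>0. \<forall>h. (\<forall>z\<in>cball 0 R. norm (h z - g z) < \<epsilon>) \<longrightarrow> h \<in> V"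
  proof (induction rule: generate_topology_on.induct)
    case Empty then show ?case by simp
  next
    case (Int a b)
    then have "g \<in> a" "g \<in> b" by auto
    from Int.IH(1)[OF this(1)] Int.IH(2)[OF this(2)]
    obtain R1 e1 R2 e2 where "e1 > 0" "e2 > 0"
      and 1: "\<And>h. \<forall>z\<in>cball 0 R1. norm (h z - g z) < e1 \<Longrightarrow> h \<in> a"
      and 2: "\<And>h. \<forall>z\<in>cball 0 R2. norm (h z - g z) < e2 \<Longrightarrow> h \<in> b"
      by blast
    show ?case
    proof (rule exI[of _ "max R1 R2"], rule exI[of _ "min e1 e2"], intro conjI allI impI)
      show "min e1 e2 > 0" using \<open>e1 > 0\<close> \<open>e2 > 0\<close> by simp
      fix h assume "\<forall>z\<in>cball 0 (max R1 R2). norm (h z - g z) < min e1 e2"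
      then show "h \<in> a \<inter> b" by (auto intro!: 1 2)
    qed
  next
    case (UN K)
    then obtain k where k: "k \<in> K" "g \<in> k" by blast
    from UN.IH[OF this] k show ?case by blast
  next
    case (Basis s)
    then obtain K U where s: "s = {f. f ` K \<subseteq> U}" and KU: "compact K" "open U" by auto
    have gK: "compact (g ` K)"
      by (intro compact_continuous_image entire_continuous_on g KU)
    have sub: "g ` K \<subseteq> U" using Basis s by auto
    obtain \<epsilon> where e: "\<epsilon> > 0" "(\<Union>x\<in>g ` K. ball x \<epsilon>) \<subseteq> U"
      using compact_subset_open_imp_ball_epsilon_subset[OF gK KU(2) sub] by auto
    obtain R where R: "\<forall>x\<in>K. norm x \<le> R"
      using compact_imp_bounded[OF KU(1)] bounded_iff by blast
    show ?case
    proof (rule exI[of _ R], rule exI[of _ \<epsilon>], intro conjI allI impI e(1))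
      fix h assume "\<forall>z\<in>cball 0 R. norm (h z - g z) < \<epsilon>"
      then have "h x \<in> ball (g x) \<epsilon>" if "x \<in> K" for x
        using R that by (auto simp: dist_norm norm_minus_commute)
      then show "h \<in> s" using e(2) unfolding s by blast
    qed
  qed
  then show ?thesis unfolding W by simp blast
qed

text \<open>Conversely, sup-norm balls are neighbourhoods: cover the disc by finitely many balls on which \<open>g\<close>
varies by less than \<open>\<epsilon> / 2\<close>, and require on each of them that the function stays within \<open>\<epsilon> / 2\<close> of
the value of \<open>g\<close> at the centre.\<close>

lemma entire_fun_top_open_nhd:
  assumes "entire g" "\<epsilon> > 0"
  obtains W where "openin entire_fun_top W" "g \<in> W"
    "\<And>h z. h \<in> W \<Longrightarrow> z \<in> cball 0 R \<Longrightarrow> norm (h z - g z) < \<epsilon>"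
proof -
  let ?K = "cball 0 R :: complex set"
  let ?S = "{{f::complex \<Rightarrow> complex. f ` K \<subseteq> U} |K U. compact K \<and> open U}"
  have "uniformly_continuous_on ?K g"
    by (intro compact_uniformly_continuous entire_continuous_on assms) auto
  from this[unfolded uniformly_continuous_on_def, rule_format, OF half_gt_zero[OF assms(2)]]
  obtain \<delta> where d: "\<delta> > 0"
    "\<And>x y. x \<in> ?K \<Longrightarrow> y \<in> ?K \<Longrightarrow> dist y x < \<delta> \<Longrightarrow> dist (g y) (g x) < \<epsilon> / 2"
    by blast
  have "compact ?K" by simp
  then obtain F where F: "finite F" "F \<subseteq> ?K" "?K \<subseteq> (\<Union>x\<in>F. ball x (\<delta>/2))"
    by (rule compactE_image[of _ ?K "\<lambda>x. ball x (\<delta>/2)"]) (use d(1) in auto)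
  define B where "B x = {f::complex \<Rightarrow> complex. f ` (?K \<inter> cball x (\<delta>/2)) \<subseteq> ball (g x) (\<epsilon>/2)}" for x
  define W where "W = (\<Inter>(insert UNIV (B ` F))) \<inter> {f. entire f}"
  have gB: "generate_topology_on ?S (B x)" for x
    unfolding B_def
    by (intro generate_topology_on.Basis CollectI exI[of _ "?K \<inter> cball x (\<delta>/2)"]
        exI[of _ "ball (g x) (\<epsilon>/2)"] conjI refl compact_Int_closed) auto
  have gU: "generate_topology_on ?S UNIV"
    by (intro generate_topology_on.Basis) (auto intro!: exI[of _ "{}"])
  have "generate_topology_on ?S (\<Inter>(insert UNIV (B ` F)))"
    by (rule generate_topology_on_Inter) (use F gB gU in auto)
  then have "openin entire_fun_top W"
    unfolding entire_fun_top_def openin_subtopology W_def openin_topology_generated_by_iff by blast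
  moreover have "g \<in> W"
    using d F(2) assms by (auto simp: W_def B_def dist_commute)
  moreover have "norm (h z - g z) < \<epsilon>" if hW: "h \<in> W" and zK: "z \<in> ?K" for h z
  proof -
    obtain x where x: "x \<in> F" "dist x z < \<delta>/2" using F(3) zK by fastforce
    have "h \<in> B x" using hW x(1) unfolding W_def by blast
    then have 1: "dist (g x) (h z) < \<epsilon>/2"
      using zK x(2) unfolding B_def by (auto simp: image_subset_iff)
    have 2: "dist (g z) (g x) < \<epsilon>/2"
      using x d F(2) zK by (intro d(2)) (auto simp: dist_commute)
    have "dist (h z) (g z) \<le> dist (g x) (h z) + dist (g z) (g x)"
      by (metis dist_commute dist_triangle)
    then show ?thesis using 1 2 by (simp add: dist_norm)
  qed
  ultimately show thesis using that by blast
qed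

text \<open>With the two preceding lemmas density of an orbit becomes approximation in sup norm on discs, the
only form in which the topology is used below.\<close>

lemma hypercyclic_vector_iff:
  assumes "\<And>n. entire ((T ^^ n) f)"
  shows "hypercyclic_vector T f \<longleftrightarrow>
    (\<forall>g R \<epsilon>. entire g \<longrightarrow> 0 < \<epsilon> \<longrightarrow> (\<exists>n. \<forall>z\<in>cball 0 R. norm ((T ^^ n) f z - g z) < \<epsilon>))"
proof (intro iffI allI impI)
  fix g R and \<epsilon> :: real
  assume hc: "hypercyclic_vector T f" and g: "entire g" "0 < \<epsilon>"
  obtain W where W: "openin entire_fun_top W" "g \<in> W"
    "\<And>h z. h \<in> W \<Longrightarrow> z \<in> cball 0 R \<Longrightarrow> norm (h z - g z) < \<epsilon>"
    using entire_fun_top_open_nhd[OF g, of R] by blast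
  have "g \<in> entire_fun_top closure_of range (\<lambda>n. (T ^^ n) f)"
    using hc g unfolding hypercyclic_vector_def by simp
  then obtain n where "(T ^^ n) f \<in> W"
    using W unfolding in_closure_of by blast
  then show "\<exists>n. \<forall>z\<in>cball 0 R. norm ((T ^^ n) f z - g z) < \<epsilon>" using W by blast
next
  assume *: "\<forall>g R \<epsilon>. entire g \<longrightarrow> 0 < \<epsilon> \<longrightarrow> (\<exists>n. \<forall>z\<in>cball 0 R. norm ((T ^^ n) f z - g z) < \<epsilon>)"
  have "g \<in> entire_fun_top closure_of range (\<lambda>n. (T ^^ n) f)" if g: "entire g" for g
    unfolding in_closure_of
  proof (intro conjI allI impI)
    show "g \<in> topspace entire_fun_top" using g by simp
    fix W assume "g \<in> W \<and> openin entire_fun_top W"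
    then have "\<exists>R. \<exists>\<epsilon>>0. \<forall>h. entire h \<longrightarrow> (\<forall>z\<in>cball 0 R. norm (h z - g z) < \<epsilon>) \<longrightarrow> h \<in> W"
      by (intro entire_fun_top_basic_nhd) simp_all
    then obtain R \<epsilon> where W: "\<epsilon> > 0"
      "\<And>h. entire h \<Longrightarrow> \<forall>z\<in>cball 0 R. norm (h z - g z) < \<epsilon> \<Longrightarrow> h \<in> W"
      by auto
    from * g W(1) obtain n where "\<forall>z\<in>cball 0 R. norm ((T ^^ n) f z - g z) < \<epsilon>" by blast
    then have "(T ^^ n) f \<in> W" by (intro W(2) assms)
    then show "\<exists>y. y \<in> range (\<lambda>n. (T ^^ n) f) \<and> y \<in> W" by blast
  qed
  moreover have "entire f" using assms[of 0] by simp
  ultimately show "hypercyclic_vector T f"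
    unfolding hypercyclic_vector_def
    using closure_of_subset_topspace[of entire_fun_top] by (intro conjI equalityI) auto
qed

section \<open>A Baire category argument for entire functions\<close>

text \<open>Nested balls: each step moves the centre inside half of the current ball and then shrinks the ball so
far that it lies in the next set. Radii of the discs grow to infinity and tolerances to 0, so the
centres converge locally uniformly, and the limit lies in every ball. The hypothesis combines
density of the sets with the existence of interior points near any given function.\<close>

lemma entire_baire:
  fixes S :: "nat \<Rightarrow> (complex \<Rightarrow> complex) set"
  assumes dense: "\<And>k f R \<epsilon>. entire f \<Longrightarrow> \<epsilon> > 0 \<Longrightarrow> \<exists>u R' \<delta>. entire u \<and>
      (\<forall>z\<in>cball 0 R. norm (u z - f z) \<le> \<epsilon>) \<and> \<delta> > 0 \<and>
      (\<forall>v. entire v \<longrightarrow> (\<forall>z\<in>cball 0 R'. norm (v z - u z) \<le> \<delta>) \<longrightarrow> v \<in> S k)"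
  obtains f where "entire f" "\<And>k. f \<in> S k"
proof -
  \<comment> \<open>A state of the construction is a triple of a centre, the radius of a disc, and a tolerance.\<close>
  define near where "near = (\<lambda>(u::complex \<Rightarrow> complex, R, \<delta>::real).
    {v. entire v \<and> (\<forall>z\<in>cball 0 R. norm (v z - u z) \<le> \<delta>)})"
  define ok where "ok = (\<lambda>(u::complex \<Rightarrow> complex, R::real, \<delta>::real). entire u \<and> \<delta> > 0)"
  define refines where "refines = (\<lambda>k (u::complex \<Rightarrow> complex, R::real, \<delta>::real) (u', R', \<delta>').
    (\<forall>z\<in>cball 0 R. norm (u' z - u z) \<le> \<delta>/2) \<and> R + 1 \<le> R' \<and> \<delta>' \<le> \<delta>/2 \<and> near (u', R', \<delta>') \<subseteq> S k)"
  have "\<exists>X. \<forall>n. ok (X n) \<and> refines n (X n) (X (Suc n))"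
  proof (rule dependent_nat_choice)
    show "\<exists>x. ok x" by (rule exI[of _ "(\<lambda>_. 0, 0, 1)"]) (simp add: ok_def)
  next
    fix x :: "(complex \<Rightarrow> complex) \<times> real \<times> real" and n assume "ok x"
    obtain u R \<delta> where x: "x = (u, R, \<delta>)" by (cases x)
    with \<open>ok x\<close> have u: "entire u" "\<delta>/2 > 0" by (auto simp: ok_def)
    obtain u' R' \<delta>' where u': "entire u'" "\<forall>z\<in>cball 0 R. norm (u' z - u z) \<le> \<delta>/2" "\<delta>' > 0"
      "\<forall>v. entire v \<longrightarrow> (\<forall>z\<in>cball 0 R'. norm (v z - u' z) \<le> \<delta>') \<longrightarrow> v \<in> S n"
      using dense[OF u, of R n] by blast
    have "near (u', max R' (R+1), min \<delta>' (\<delta>/2)) \<subseteq> S n"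
      using u'(4) by (auto simp: near_def)
    then show "\<exists>y. ok y \<and> refines n x y"
      using u u' by (intro exI[of _ "(u', max R' (R+1), min \<delta>' (\<delta>/2))"]) (auto simp: ok_def refines_def x)
  qed
  then obtain X where X: "\<And>n. ok (X n)" "\<And>n. refines n (X n) (X (Suc n))" by blast
  define u where "u n = fst (X n)" for n
  define R where "R n = fst (snd (X n))" for n
  define \<delta> where "\<delta> n = snd (snd (X n))" for n
  have Xn: "X n = (u n, R n, \<delta> n)" for n by (simp add: u_def R_def \<delta>_def)
  have u: "entire (u n)" and \<delta>: "\<delta> n > 0" for n
    using X(1)[of n] by (auto simp: Xn ok_def)
  have u_step: "z \<in> cball 0 (R n) \<Longrightarrow> norm (u (Suc n) z - u n z) \<le> \<delta> n / 2"
    and R1: "R n + 1 \<le> R (Suc n)" and \<delta>1: "\<delta> (Suc n) \<le> \<delta> n / 2"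
    and near: "near (u (Suc n), R (Suc n), \<delta> (Suc n)) \<subseteq> S n" for n z
    using X(2)[of n] by (auto simp: Xn refines_def)
  have R_mono: "R k \<le> R n" if "k \<le> n" for k n
    using R1 by (intro lift_Suc_mono_le[OF _ that]) (metis add_increasing2 order_trans zero_le_one order_refl)
  have R_ge: "R 0 + real n \<le> R n" for n
  proof (induction n)
    case (Suc n) then show ?case using R1[of n] by simp
  qed simp
  have \<delta>_le: "\<delta> n \<le> \<delta> 0 * (1/2)^n" for n
  proof (induction n)
    case (Suc n) then show ?case using \<delta>1[of n] by simp
  qed simp
  \<comment> \<open>The steps telescope because each one uses at most half of the tolerance and halves it.\<close>
  have tele: "norm (u n z - u k z) \<le> \<delta> k - \<delta> n" if "k \<le> n" "z \<in> cball 0 (R k)" for k n z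
    using that(1)
  proof (induction n rule: dec_induct)
    case (step n)
    have "norm (u (Suc n) z - u n z) \<le> \<delta> n / 2"
      using R_mono[OF step(1)] that(2) by (intro u_step) auto
    moreover have "norm (u (Suc n) z - u k z) \<le> norm (u (Suc n) z - u n z) + norm (u n z - u k z)"
      by norm
    ultimately show ?case using step(3) \<delta>1[of n] by simp
  qed simp
  have ex_k: "\<exists>k. r \<le> R k \<and> \<delta> k < e" if "e > 0" for r e
  proof -
    have "(\<lambda>n. \<delta> 0 * (1/2)^n) \<longlonglongrightarrow> 0" by real_asymp
    then have "\<forall>\<^sub>F n in sequentially. \<delta> 0 * (1/2)^n < e" using that by (rule order_tendstoD)
    moreover have "\<forall>\<^sub>F n in sequentially. r \<le> R 0 + real n" by real_asymp
    ultimately have "\<forall>\<^sub>F n in sequentially. r \<le> R n \<and> \<delta> n < e"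
      by eventually_elim (use \<delta>_le R_ge order_trans le_less_trans in blast)
    then show ?thesis using eventually_happens by force
  qed
  have "convergent (\<lambda>n. u n z)" for z
    unfolding Cauchy_convergent_iff[symmetric]
  proof (rule metric_CauchyI)
    fix e :: real assume "e > 0"
    then obtain k where k: "norm z \<le> R k" "\<delta> k < e/2" using ex_k[of "e/2"] by auto
    have "dist (u n z) (u k z) < e/2" if "n \<ge> k" for n
      using tele[OF that, of z] k \<delta>[of n] by (simp add: dist_norm)
    then show "\<exists>M. \<forall>m\<ge>M. \<forall>n\<ge>M. dist (u m z) (u n z) < e"
      by (meson dist_triangle_half_l)
  qed
  then have lim: "(\<lambda>n. u n z) \<longlonglongrightarrow> lim (\<lambda>n. u n z)" for z
    by (simp add: convergent_LIMSEQ_iff)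
  define f where "f z = lim (\<lambda>n. u n z)" for z
  have f_near: "norm (f z - u k z) \<le> \<delta> k" if "z \<in> cball 0 (R k)" for k z
  proof (rule LIMSEQ_le_const2)
    show "(\<lambda>n. norm (u n z - u k z)) \<longlonglongrightarrow> norm (f z - u k z)"
      unfolding f_def by (intro tendsto_intros lim)
    show "\<exists>N. \<forall>n\<ge>N. norm (u n z - u k z) \<le> \<delta> k"
      using tele[OF _ that] \<delta> by (intro exI[of _ k]) (smt (verit))
  qed
  have "entire f"
  proof (rule holomorphic_uniform_sequence[where f = u])
    fix x :: complex
    have "uniform_limit (cball x 1) u f sequentially"
      unfolding uniform_limit_sequentially_iff
    proof (intro allI impI)
      fix e :: real assume "e > 0"
      then obtain k where k: "norm x + 1 \<le> R k" "\<delta> k < e/2" using ex_k[of "e/2"] by auto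
      have "dist (u n y) (f y) < e" if "n \<ge> k" "y \<in> cball x 1" for n y
      proof -
        have "y \<in> cball 0 (R k)"
          using that(2) k(1) norm_triangle_ineq2[of y x] by (simp add: dist_norm norm_minus_commute)
        then have "norm (f y - u k y) \<le> \<delta> k" "norm (u n y - u k y) \<le> \<delta> k - \<delta> n"
          by (auto intro!: f_near tele that)
        moreover have "dist (u n y) (f y) \<le> norm (u n y - u k y) + norm (f y - u k y)"
          by (simp add: dist_norm) norm
        ultimately show ?thesis using k(2) \<delta>[of n] by linarith
      qed
      then show "\<exists>N. \<forall>n\<ge>N. \<forall>y\<in>cball x 1. dist (u n y) (f y) < e" by blast
    qed
    then show "\<exists>d>0. cball x d \<subseteq> UNIV \<and> uniform_limit (cball x d) u f sequentially"
      by (intro exI[of _ 1] conjI zero_less_one subset_UNIV)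
  qed (auto intro: u)
  moreover have "f \<in> S k" for k
    using near[of k] f_near \<open>entire f\<close> by (auto simp: near_def)
  ultimately show thesis using that by blast
qed

section \<open>Dense families of entire functions\<close>

lemma entire_polynomial_approx:
  assumes f: "entire f" and "\<epsilon> > 0"
  obtains p :: "complex poly" where "\<And>z. z \<in> cball 0 R \<Longrightarrow> norm (f z - poly p z) \<le> \<epsilon>"
proof -
  define r where "r = max 1 R"
  have r: "r > 0" "R \<le> r" by (auto simp: r_def)
  define c where "c n = (deriv ^^ n) f 0 / fact n" for n
  obtain M where M: "M > 0" "\<And>z. z \<in> cball 0 (2*r) \<Longrightarrow> norm (f z) \<le> M"
    using entire_norm_bounded[OF f, of "2*r"] by blast
  have c: "norm (c n) \<le> M / (2*r) ^ n" for n
  proof -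
    have "norm ((deriv ^^ n) f 0) \<le> fact n * M / (2*r) ^ n"
      by (rule Cauchy_inequality)
         (use r M(2) in \<open>auto intro: holomorphic_on_subset[OF f] entire_continuous_on[OF f]\<close>)
    then show ?thesis by (simp add: c_def norm_divide field_simps)
  qed
  have "norm (c n * z ^ n) \<le> M * (1/2) ^ n" if "z \<in> cball 0 r" for n z
  proof -
    have "norm (c n * z ^ n) \<le> M / (2*r) ^ n * r ^ n"
      unfolding norm_mult norm_power using that M r by (intro mult_mono c power_mono) auto
    also have "\<dots> = M * (1/2) ^ n" using r by (simp add: power_mult_distrib field_simps)
    finally show ?thesis .
  qed
  moreover have "summable (\<lambda>n. M * (1/2::real) ^ n)"
    by (rule sums_summable[OF sums_mult[OF geometric_sums]]) simp
  ultimately have "uniform_limit (cball 0 r) (\<lambda>N z. \<Sum>n<N. c n * z ^ n) (\<lambda>z. \<Sum>n. c n * z ^ n) sequentially"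
    by (rule Weierstrass_m_test)
  then obtain N where N: "\<And>z. z \<in> cball 0 r \<Longrightarrow> dist (\<Sum>n<N. c n * z ^ n) (\<Sum>n. c n * z ^ n) < \<epsilon>"
    using \<open>\<epsilon> > 0\<close> unfolding uniform_limit_sequentially_iff by blast
  have sums: "(\<Sum>n. c n * z ^ n) = f z" for z
  proof -
    have "(\<lambda>n. (deriv ^^ n) f 0 / fact n * (z - 0) ^ n) sums f z"
      by (rule holomorphic_power_series[where r = "norm z + 1"])
         (auto intro: holomorphic_on_subset[OF f] add_nonneg_pos)
    then show ?thesis by (simp add: c_def sums_iff)
  qed
  show thesis
  proof (rule that[of "\<Sum>n<N. monom (c n) n"])
    fix z :: complex assume "z \<in> cball 0 R"
    then have "z \<in> cball 0 r" using r by auto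
    from N[OF this] show "norm (f z - poly (\<Sum>n<N. monom (c n) n) z) \<le> \<epsilon>"
      by (simp add: sums poly_sum poly_monom dist_norm norm_minus_commute)
  qed
qed

text \<open>A difference quotient of \<open>exp (v * z)\<close> in the frequency, which converges to \<open>z\<close> uniformly on discs.
It is how monomials are recovered from exponentials.\<close>

lemma exp_difference_quotient:
  fixes z v :: complex
  assumes "0 < h" "h \<le> 1" "norm z \<le> R" "v \<noteq> 0"
  shows "norm ((exp (of_real h * v * z) - 1) / (of_real h * v) - z) \<le> h * (exp (norm v * R) * norm v * R\<^sup>2)"
proof -
  define x where "x = of_real h * v * z"
  have R: "R \<ge> 0" using assms(3) norm_ge_zero order_trans by blast
  have "norm x = h * (norm v * norm z)" using assms(1) by (simp add: x_def norm_mult)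
  also have "\<dots> \<le> 1 * (norm v * R)" using assms R by (intro mult_mono) auto
  finally have nx: "norm x \<le> norm v * R" by simp
  have "norm (exp x - (\<Sum>k\<le>1. x ^ k / fact k)) \<le> exp \<bar>Re x\<bar> * norm x ^ Suc 1 / fact 1"
    by (rule Taylor_exp)
  then have "norm (exp x - 1 - x) \<le> exp \<bar>Re x\<bar> * (norm x)\<^sup>2"
    by (simp add: diff_diff_eq power2_eq_square)
  also have "\<dots> \<le> exp (norm v * R) * (norm x)\<^sup>2"
    using abs_Re_le_cmod[of x] nx by (intro mult_right_mono) auto
  finally have 1: "norm (exp x - 1 - x) \<le> exp (norm v * R) * (norm x)\<^sup>2" .
  have "(exp x - 1) / (of_real h * v) - z = (exp x - 1 - x) / (of_real h * v)"
    using assms by (simp add: x_def diff_divide_distrib)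
  then have "norm ((exp x - 1) / (of_real h * v) - z) = norm (exp x - 1 - x) / (h * norm v)"
    using assms by (simp add: norm_divide norm_mult)
  also have "\<dots> \<le> exp (norm v * R) * (norm x)\<^sup>2 / (h * norm v)"
    using 1 assms by (intro divide_right_mono) auto
  also have "\<dots> = h * (exp (norm v * R) * norm v * (norm z)\<^sup>2)"
    using assms by (simp add: x_def norm_mult power2_eq_square field_simps)
  also have "\<dots> \<le> h * (exp (norm v * R) * norm v * R\<^sup>2)"
    using assms by (intro mult_left_mono power_mono) auto
  finally show ?thesis by (simp add: x_def)
qed

text \<open>Approximate \<open>g z * exp (- \<mu> * z)\<close> by a polynomial \<open>p z\<close>, and replace \<open>z\<close> by the difference quotient
\<open>(exp (h * v * z) - 1) / (h * v)\<close> with \<open>h\<close> small. The result is a polynomial in \<open>exp (h * v * z)\<close>, and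
after multiplication by \<open>exp (\<mu> * z)\<close> it is a sum of exponentials with equally spaced frequencies on
an arbitrarily short segment that starts at \<open>\<mu>\<close>.\<close>

lemma exp_sums_dense:
  fixes \<mu> v :: complex and g :: "complex \<Rightarrow> complex"
  assumes g: "entire g" and "v \<noteq> 0" "\<delta> > 0" "\<epsilon> > 0"
  obtains d :: nat and h :: real and b :: "nat \<Rightarrow> complex"
  where "h > 0" "real d * h < \<delta>"
    "\<And>z. z \<in> cball 0 R \<Longrightarrow>
       norm ((\<Sum>l\<le>d. b l * exp ((\<mu> + of_real (real l * h) * v) * z)) - g z) \<le> \<epsilon>"
proof -
  define r where "r = max 1 R"
  have r: "r > 0" "R \<le> r" by (auto simp: r_def)
  define E where "E = exp (norm \<mu> * r)"
  have E: "E > 0" "\<And>z. z \<in> cball 0 r \<Longrightarrow> norm (exp (\<mu> * z)) \<le> E"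
  proof -
    fix z :: complex assume "z \<in> cball 0 r"
    then have "Re (\<mu> * z) \<le> norm \<mu> * r"
      using complex_Re_le_cmod[of "\<mu> * z"] mult_left_mono[of "norm z" r "norm \<mu>"] by (simp add: norm_mult)
    then show "norm (exp (\<mu> * z)) \<le> E" by (simp add: E_def)
  qed (simp add: E_def)
  define \<epsilon>' where "\<epsilon>' = \<epsilon> / (2 * E)"
  have e': "\<epsilon>' > 0" "E * (2 * \<epsilon>') = \<epsilon>" using E \<open>\<epsilon> > 0\<close> by (auto simp: \<epsilon>'_def)
  have "entire (\<lambda>z. g z * exp (- \<mu> * z))"
    by (intro holomorphic_on_mult g holomorphic_intros)
  then obtain p where p: "\<And>z. z \<in> cball 0 r \<Longrightarrow> norm (g z * exp (- \<mu> * z) - poly p z) \<le> \<epsilon>'"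
    using entire_polynomial_approx[OF _ e'(1), of _ r] by blast
  have "uniformly_continuous_on (cball 0 (r + 1)) (poly p)"
    by (intro compact_uniformly_continuous continuous_on_poly continuous_on_id) auto
  then obtain \<eta> where eta: "\<eta> > 0"
    "\<And>x y. x \<in> cball 0 (r+1) \<Longrightarrow> y \<in> cball 0 (r+1) \<Longrightarrow> dist y x < \<eta> \<Longrightarrow> dist (poly p y) (poly p x) < \<epsilon>'"
    using e'(1) unfolding uniformly_continuous_on_def by blast
  define K where "K = exp (norm v * r) * norm v * r\<^sup>2"
  have K: "K > 0" using r \<open>v \<noteq> 0\<close> by (simp add: K_def)
  define d where "d = degree p"
  \<comment> \<open>The three bounds serve the quotient estimate, the uniform continuity of \<open>p\<close> on the slightly larger
    disc, and the length of the segment of frequencies.\<close>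
  define h where "h = min 1 (min (min 1 \<eta> / (2 * K)) (\<delta> / (2 * (real d + 1))))"
  have h: "h > 0" "h \<le> 1" using K eta \<open>\<delta> > 0\<close> by (auto simp: h_def)
  have "h \<le> min 1 \<eta> / (2 * K)" by (simp add: h_def)
  then have hK: "h * K \<le> min 1 \<eta> / 2" using K by (simp add: field_simps)
  have "h \<le> \<delta> / (2 * (real d + 1))" by (simp add: h_def)
  then have "2 * (real d + 1) * h \<le> \<delta>" by (simp add: field_simps)
  then have hd: "real d * h < \<delta>" 
  proof -
    have "2 * (real d * h) + 2 * h \<le> \<delta>"
      using \<open>2 * (real d + 1) * h \<le> \<delta>\<close> by (simp add: distrib_left distrib_right)
    moreover have "0 \<le> real d * h" using h by simp
    ultimately show ?thesis using h by linarith
  qed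
  define hv where "hv = of_real h * v"
  have hv: "hv \<noteq> 0" using h \<open>v \<noteq> 0\<close> by (simp add: hv_def)
  define q where "q = pcompose p [: -1/hv, 1/hv :]"
  have dq: "degree q = d" using hv by (simp add: q_def degree_pcompose d_def)
  have pq: "poly q x = poly p ((x - 1) / hv)" for x
    by (simp add: q_def poly_pcompose diff_divide_distrib)
  show thesis
  proof (rule that[of h d "coeff q"])
    fix z :: complex assume "z \<in> cball 0 R"
    then have z: "z \<in> cball 0 r" using r by auto
    define w where "w = (exp (hv * z) - 1) / hv"
    have "norm (w - z) \<le> h * K"
      unfolding w_def hv_def K_def using z h \<open>v \<noteq> 0\<close> by (intro exp_difference_quotient) auto
    then have wz: "norm (w - z) \<le> 1/2" "norm (w - z) < \<eta>"
      using hK eta(1) by (auto simp: min_def split: if_splits)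
    then have "norm w \<le> r + 1"
      using z norm_triangle_ineq2[of w z] by simp
    then have "dist (poly p w) (poly p z) < \<epsilon>'"
      using z wz by (intro eta(2)) (auto simp: dist_norm)
    then have "norm (poly p w - poly p z) < \<epsilon>'" by (simp add: dist_norm)
    moreover have "norm (poly p w - g z * exp (- \<mu> * z))
        \<le> norm (poly p w - poly p z) + norm (g z * exp (- \<mu> * z) - poly p z)" by norm
    ultimately have 2: "norm (poly p w - g z * exp (- \<mu> * z)) \<le> 2 * \<epsilon>'" using p[OF z] by linarith
    have "(\<Sum>l\<le>d. coeff q l * exp ((\<mu> + of_real (real l * h) * v) * z))
        = exp (\<mu> * z) * (\<Sum>l\<le>d. coeff q l * exp (hv * z) ^ l)"
      unfolding sum_distrib_left
    proof (rule sum.cong[OF refl])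
      fix l
      have "exp ((\<mu> + of_real (real l * h) * v) * z) = exp (\<mu> * z) * exp (of_nat l * (hv * z))"
        by (simp add: exp_add[symmetric] hv_def algebra_simps)
      then show "coeff q l * exp ((\<mu> + of_real (real l * h) * v) * z)
          = exp (\<mu> * z) * (coeff q l * exp (hv * z) ^ l)"
        by (simp add: exp_of_nat_mult)
    qed
    also have "\<dots> = exp (\<mu> * z) * poly p w"
      using pq[of "exp (hv * z)"] by (simp add: poly_altdef dq w_def)
    finally have "(\<Sum>l\<le>d. coeff q l * exp ((\<mu> + of_real (real l * h) * v) * z)) - g z
        = exp (\<mu> * z) * (poly p w - g z * exp (- \<mu> * z))"
      by (simp add: algebra_simps exp_minus)
    then have "norm ((\<Sum>l\<le>d. coeff q l * exp ((\<mu> + of_real (real l * h) * v) * z)) - g z)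
        \<le> E * (2 * \<epsilon>')"
      unfolding norm_mult using 2 E(2)[OF z] E(1) by (simp only: norm_mult) (intro mult_mono, auto)
    then show "norm ((\<Sum>l\<le>d. coeff q l * exp ((\<mu> + of_real (real l * h) * v) * z)) - g z) \<le> \<epsilon>"
      using e' by simp
  qed (use h hd in auto)
qed

text \<open>Polynomials with coefficients from a countable dense set of complex numbers.\<close>

lemma countable_dense_entire:
  obtains G :: "nat \<Rightarrow> complex \<Rightarrow> complex" where "\<And>j. entire (G j)"
    "\<And>f R \<epsilon>. entire f \<Longrightarrow> \<epsilon> > 0 \<Longrightarrow> \<exists>j. \<forall>z\<in>cball 0 R. norm (G j z - f z) \<le> \<epsilon>"
proof -
  obtain D :: "complex set" where D: "countable D" "\<And>X. open X \<Longrightarrow> X \<noteq> {} \<Longrightarrow> \<exists>d\<in>D. d \<in> X"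
    using countable_dense_exists[where 'a = complex] by blast
  define poly_of where "poly_of xs = (\<lambda>z. \<Sum>i<length xs. xs ! i * z ^ i)" for xs :: "complex list"
  define Q where "Q = poly_of ` lists D"
  have Q: "countable Q" "Q \<noteq> {}" using D(1) by (auto simp: Q_def)
  show thesis
  proof (rule that[of "from_nat_into Q"])
    fix j
    have "from_nat_into Q j \<in> Q" by (rule from_nat_into[OF Q(2)])
    then obtain xs where xs: "from_nat_into Q j = poly_of xs" by (auto simp: Q_def)
    show "entire (from_nat_into Q j)"
      unfolding xs poly_of_def
      by (intro holomorphic_on_sum holomorphic_on_mult holomorphic_on_const holomorphic_on_power holomorphic_on_ident)
  next
    fix f R and \<epsilon> :: real assume f: "entire f" and \<epsilon>: "\<epsilon> > 0"
    obtain p where p: "\<And>z. z \<in> cball 0 R \<Longrightarrow> norm (f z - poly p z) \<le> \<epsilon>/2"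
      using entire_polynomial_approx[OF f, of "\<epsilon>/2" R] \<epsilon> by auto
    define r where "r = max 1 R"
    define n where "n = Suc (degree p)"
    define \<eta> where "\<eta> = \<epsilon> / (2 * n * r ^ n)"
    have r: "r \<ge> 1" "R \<le> r" by (auto simp: r_def)
    have \<eta>: "\<eta> > 0" using \<epsilon> r by (simp add: \<eta>_def n_def)
    have "\<exists>d\<in>D. norm (coeff p i - d) < \<eta>" for i
      using D(2)[of "ball (coeff p i) \<eta>"] \<eta> by (auto simp: dist_norm)
    then obtain d where d: "\<And>i. d i \<in> D" "\<And>i. norm (coeff p i - d i) < \<eta>" by metis
    have "map d [0..<n] \<in> lists D" using d(1) by auto
    then have "poly_of (map d [0..<n]) \<in> Q" by (auto simp: Q_def)
    then obtain j where j: "from_nat_into Q j = poly_of (map d [0..<n])"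
      using from_nat_into_surj[OF Q(1)] by blast
    have "norm (from_nat_into Q j z - f z) \<le> \<epsilon>" if z: "z \<in> cball 0 R" for z
    proof -
      have "poly_of (map d [0..<n]) z = (\<Sum>i<n. d i * z ^ i)"
        unfolding poly_of_def by (rule sum.cong) auto
      moreover have "poly p z = (\<Sum>i<n. coeff p i * z ^ i)"
        by (simp only: poly_altdef n_def lessThan_Suc_atMost)
      ultimately have "poly_of (map d [0..<n]) z - poly p z = (\<Sum>i<n. (d i - coeff p i) * z ^ i)"
        by (simp only: sum_subtractf left_diff_distrib)
      also have "norm \<dots> \<le> (\<Sum>i<n. \<eta> * r ^ n)"
      proof (rule sum_norm_le)
        fix i assume i: "i \<in> {..<n}"
        have "norm z ^ i \<le> r ^ i" using z r by (intro power_mono) auto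
        also have "r ^ i \<le> r ^ n" using i r by (intro power_increasing) auto
        finally have zi: "norm z ^ i \<le> r ^ n" .
        have di: "norm (d i - coeff p i) \<le> \<eta>" using d(2)[of i] by (simp add: norm_minus_commute)
        show "norm ((d i - coeff p i) * z ^ i) \<le> \<eta> * r ^ n"
          unfolding norm_mult norm_power using zi di \<eta> by (intro mult_mono) auto
      qed
      also have "\<dots> = \<epsilon>/2"
      proof -
        have "r \<noteq> 0" "n > 0" using r by (auto simp: n_def)
        then show ?thesis by (simp add: \<eta>_def)
      qed
      finally have 1: "norm (poly_of (map d [0..<n]) z - poly p z) \<le> \<epsilon>/2" .
      have "norm (from_nat_into Q j z - f z) \<le> norm (poly_of (map d [0..<n]) z - poly p z) + norm (f z - poly p z)"
        unfolding j by norm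
      then show ?thesis using 1 p[OF z] by linarith
    qed
    then show "\<exists>j. \<forall>z\<in>cball 0 R. norm (from_nat_into Q j z - f z) \<le> \<epsilon>" by blast
  qed
qed

section \<open>The operator as a limit of differential polynomials\<close>

lemma higher_deriv_exp_mult: "(deriv ^^ n) (\<lambda>z. exp (w * z)) = (\<lambda>z. w ^ n * exp (w * z))" for w :: complex
proof (induction n)
  case (Suc n)
  have "deriv (\<lambda>z. w ^ n * exp (w * z)) z = w ^ Suc n * exp (w * z)" for z
    by (rule DERIV_imp_deriv) (auto intro!: derivative_eq_intros)
  then show ?case by (simp add: Suc.IH fun_eq_iff)
qed auto

text \<open>The growth of \<open>\<Phi>\<close> enters through its Taylor coefficients only. With this bound the series for
\<open>\<Phi>(D) f\<close> converges like a geometric series, and \<open>\<Phi>(D)\<close> is continuous with a loss of \<open>2 * A\<close> in the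
radius of the disc.\<close>

locale exp_type_symbol =
  fixes \<Phi> :: "complex \<Rightarrow> complex" and C A :: real
  assumes entire_symbol: "entire \<Phi>"
    and A_pos: "A > 0" and C_nonneg: "C \<ge> 0"
    and coeff_bound: "\<And>n. norm (fps_nth (fps_expansion \<Phi> 0) n) \<le> C * A ^ n / fact n"
begin

abbreviation T where "T \<equiv> diff_operator \<Phi>"
abbreviation a where "a \<equiv> fps_nth (fps_expansion \<Phi> 0)"

text \<open>Cauchy's inequality on a circle of radius \<open>2 * A\<close>: the factorials cancel and the powers of \<open>A\<close> leave
\<open>(1/2) ^ n\<close>.\<close>

lemma term_bound:
  assumes f: "entire f" and M: "\<And>w. w \<in> cball 0 (r + 2*A) \<Longrightarrow> norm (f w) \<le> M"
    and z: "z \<in> cball 0 r"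
  shows "norm (a n * (deriv ^^ n) f z) \<le> C * M * (1/2) ^ n"
proof -
  have "z \<in> cball 0 (r + 2*A)" using z A_pos by auto
  from order_trans[OF norm_ge_zero M[OF this]] have "M \<ge> 0" .
  have "norm ((deriv ^^ n) f z) \<le> fact n * M / (2*A) ^ n"
  proof (rule Cauchy_inequality)
    fix x assume "norm (z - x) = 2*A"
    then have "norm x \<le> r + 2*A" using z norm_triangle_ineq2[of x z] by (simp add: norm_minus_commute)
    then show "norm (f x) \<le> M" using M by simp
  qed (use A_pos in \<open>auto intro: holomorphic_on_subset[OF f] entire_continuous_on[OF f]\<close>)
  then have "norm (a n * (deriv ^^ n) f z) \<le> (C * A ^ n / fact n) * (fact n * M / (2*A) ^ n)"
    unfolding norm_mult using coeff_bound C_nonneg A_pos by (intro mult_mono) auto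
  also have "\<dots> = C * M * (1/2) ^ n"
    using A_pos by (simp add: power_mult_distrib field_simps)
  finally show ?thesis .
qed

lemma geometric_majorant: "(\<lambda>n. c * (1/2) ^ n) sums (2 * c)" for c :: real
  using sums_mult[OF geometric_sums[of "1/2::real"], of c] by (simp add: mult.commute)

lemma summable_terms:
  assumes "entire f" shows "summable (\<lambda>n. a n * (deriv ^^ n) f z)"
proof -
  obtain M where "\<And>w. w \<in> cball 0 (norm z + 2*A) \<Longrightarrow> norm (f w) \<le> M"
    using entire_norm_bounded[OF assms, of "norm z + 2*A"] by blast
  then have "norm (a n * (deriv ^^ n) f z) \<le> C * M * (1/2) ^ n" for n
    by (intro term_bound[OF assms, of "norm z"]) auto
  then show ?thesis
    by (intro summable_comparison_test'[OF sums_summable[OF geometric_majorant]])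
qed

lemma T_bound:
  assumes "entire f" "\<And>w. w \<in> cball 0 (r + 2*A) \<Longrightarrow> norm (f w) \<le> M" "z \<in> cball 0 r"
  shows "norm (T f z) \<le> 2 * C * M"
proof -
  have "norm (T f z) \<le> (\<Sum>n. C * M * (1/2) ^ n)"
    unfolding diff_operator_def
    by (rule norm_suminf_le[OF term_bound[OF assms] sums_summable[OF geometric_majorant]])
  then show ?thesis by (simp add: sums_unique[OF geometric_majorant, symmetric])
qed

lemma T_entire:
  assumes f: "entire f" shows "entire (T f)"
proof (rule holomorphic_uniform_sequence[where f = "\<lambda>n z. \<Sum>k<n. a k * (deriv ^^ k) f z", OF open_UNIV])
  fix x :: complex
  obtain M where M: "\<And>w. w \<in> cball 0 ((norm x + 1) + 2*A) \<Longrightarrow> norm (f w) \<le> M"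
    using entire_norm_bounded[OF assms, of "(norm x + 1) + 2*A"] by blast
  have sub: "y \<in> cball 0 (norm x + 1)" if "y \<in> cball x 1" for y
    using that norm_triangle_ineq2[of y x] by (simp add: dist_norm norm_minus_commute)
  have "uniform_limit (cball x 1) (\<lambda>n z. \<Sum>k<n. a k * (deriv ^^ k) f z) (T f) sequentially"
    unfolding diff_operator_def
  proof (rule Weierstrass_m_test)
    show "norm (a n * (deriv ^^ n) f y) \<le> C * M * (1/2)^n" if "y \<in> cball x 1" for n y
      by (rule term_bound[OF f M sub[OF that]])
    show "summable (\<lambda>n. C * M * (1/2::real) ^ n)"
      by (rule sums_summable[OF geometric_majorant])
  qed
  then show "\<exists>d>0. cball x d \<subseteq> UNIV \<and> uniform_limit (cball x d) (\<lambda>n z. \<Sum>k<n. a k * (deriv ^^ k) f z) (T f) sequentially"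
    by (intro exI[of _ 1] conjI zero_less_one subset_UNIV)
qed (intro holomorphic_on_sum holomorphic_on_mult holomorphic_on_const holomorphic_higher_deriv f open_UNIV)

lemma T_sums: "entire f \<Longrightarrow> (\<lambda>n. a n * (deriv ^^ n) f z) sums T f z"
  unfolding diff_operator_def by (rule summable_sums[OF summable_terms])

lemma T_add:
  assumes "entire f" "entire g" shows "T (\<lambda>z. f z + g z) = (\<lambda>z. T f z + T g z)"
proof
  fix z
  have d: "(deriv ^^ n) (\<lambda>z. f z + g z) z = (deriv ^^ n) f z + (deriv ^^ n) g z" for n
    by (rule higher_deriv_add[OF assms]) auto
  have "(\<lambda>n. a n * (deriv ^^ n) (\<lambda>z. f z + g z) z) sums (T f z + T g z)"
    unfolding d distrib_left by (intro sums_add T_sums assms)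
  then show "T (\<lambda>z. f z + g z) z = T f z + T g z"
    unfolding diff_operator_def[of _ "\<lambda>z. f z + g z"] by (rule sums_unique[symmetric])
qed

lemma T_cmult:
  assumes "entire f" shows "T (\<lambda>z. c * f z) = (\<lambda>z. c * T f z)"
proof
  fix z
  have d: "(deriv ^^ n) (\<lambda>z. c * f z) z = c * (deriv ^^ n) f z" for n
    by (rule higher_deriv_cmult[OF assms]) auto
  have "(\<lambda>n. a n * (deriv ^^ n) (\<lambda>z. c * f z) z) sums (c * T f z)"
    unfolding d mult.left_commute[of _ c] by (intro sums_mult T_sums assms)
  then show "T (\<lambda>z. c * f z) z = c * T f z"
    unfolding diff_operator_def[of _ "\<lambda>z. c * f z"] by (rule sums_unique[symmetric])
qed

lemma symbol_sums: "(\<lambda>n. a n * w ^ n) sums \<Phi> w"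
proof -
  have "(\<lambda>n. (deriv ^^ n) \<Phi> 0 / fact n * (w - 0) ^ n) sums \<Phi> w"
    by (rule holomorphic_power_series[where r = "norm w + 1"])
       (auto intro: holomorphic_on_subset[OF entire_symbol] add_nonneg_pos)
  then show ?thesis by (simp add: fps_expansion_def)
qed

lemma T_exp: "T (\<lambda>z. exp (w * z)) = (\<lambda>z. \<Phi> w * exp (w * z))"
proof
  fix z
  have "(\<lambda>n. a n * w ^ n * exp (w * z)) sums (\<Phi> w * exp (w * z))"
    by (intro sums_mult2 symbol_sums)
  then show "T (\<lambda>z. exp (w * z)) z = \<Phi> w * exp (w * z)"
    unfolding diff_operator_def higher_deriv_exp_mult mult.assoc by (metis sums_unique)
qed

lemma Tn_entire: "entire f \<Longrightarrow> entire ((T ^^ N) f)"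
  by (induction N) (auto intro: T_entire)

lemma Tn_add: "entire f \<Longrightarrow> entire g \<Longrightarrow> (T ^^ N) (\<lambda>z. f z + g z) = (\<lambda>z. (T ^^ N) f z + (T ^^ N) g z)"
  by (induction N) (auto simp: T_add Tn_entire)

lemma Tn_cmult: "entire f \<Longrightarrow> (T ^^ N) (\<lambda>z. c * f z) = (\<lambda>z. c * (T ^^ N) f z)"
  by (induction N) (auto simp: T_cmult Tn_entire)

lemma Tn_zero: "(T ^^ N) (\<lambda>z. 0) = (\<lambda>z. 0)"
  using Tn_cmult[of "\<lambda>_. 0" N 0] by simp

lemma Tn_lincomb:
  assumes "finite I" "\<And>i. i \<in> I \<Longrightarrow> entire (f i)"
  shows "(T ^^ N) (\<lambda>z. \<Sum>i\<in>I. c i * f i z) = (\<lambda>z. \<Sum>i\<in>I. c i * (T ^^ N) (f i) z)"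
  using assms
proof (induction I rule: finite_induct)
  case (insert i I)
  have "(T ^^ N) (\<lambda>z. c i * f i z + (\<Sum>i\<in>I. c i * f i z))
      = (\<lambda>z. (T ^^ N) (\<lambda>z. c i * f i z) z + (T ^^ N) (\<lambda>z. \<Sum>i\<in>I. c i * f i z) z)"
    using insert by (intro Tn_add holomorphic_on_sum holomorphic_on_mult holomorphic_on_const) auto
  then show ?case using insert by (simp add: Tn_cmult)
qed (simp add: Tn_zero)

lemma Tn_exp: "(T ^^ N) (\<lambda>z. exp (w * z)) = (\<lambda>z. \<Phi> w ^ N * exp (w * z))"
proof (induction N)
  case (Suc N)
  have "T (\<lambda>z. \<Phi> w ^ N * exp (w * z)) = (\<lambda>z. \<Phi> w ^ N * T (\<lambda>z. exp (w * z)) z)"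
    by (intro T_cmult holomorphic_intros)
  then show ?case by (simp add: Suc T_exp fun_eq_iff)
qed auto

lemma Tn_bound:
  assumes "entire f" "\<And>w. w \<in> cball 0 (r + 2*A*real N) \<Longrightarrow> norm (f w) \<le> M" "z \<in> cball 0 r"
  shows "norm ((T ^^ N) f z) \<le> (2*C) ^ N * M"
  using assms(2,3)
proof (induction N arbitrary: r z)
  case (Suc N)
  have "norm ((T ^^ N) f w) \<le> (2*C) ^ N * M" if "w \<in> cball 0 (r + 2*A)" for w
    by (rule Suc.IH[OF _ that]) (use Suc.prems(1) in \<open>auto simp: algebra_simps\<close>)
  from T_bound[OF Tn_entire[OF assms(1)] this Suc.prems(2)]
  show ?case by simp
qed simp

lemma Tn_diff: "entire f \<Longrightarrow> entire g \<Longrightarrow> (T ^^ N) (\<lambda>z. f z - g z) = (\<lambda>z. (T ^^ N) f z - (T ^^ N) g z)"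
  using Tn_add[of f "\<lambda>z. (-1) * g z" N] Tn_cmult[of g N "-1"] holomorphic_on_minus[of g UNIV]
  by simp

text \<open>Continuity of \<open>v \<mapsto> (T ^^ N) (v ^ n)\<close>, uniformly for \<open>n \<le> m\<close>. It fattens one good function to a whole
neighbourhood of good functions, as the Baire argument requires.\<close>

lemma Tn_power_continuous:
  assumes u: "entire u" and "\<epsilon> > 0"
  obtains R' \<delta> where "\<delta> > 0"
    "\<And>v z n. entire v \<Longrightarrow> n \<le> m \<Longrightarrow> \<forall>w\<in>cball 0 R'. norm (v w - u w) \<le> \<delta> \<Longrightarrow> z \<in> cball 0 R \<Longrightarrow>
       norm ((T ^^ N) (\<lambda>z. v z ^ n) z - (T ^^ N) (\<lambda>z. u z ^ n) z) \<le> \<epsilon>"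
proof -
  define R' where "R' = R + 2*A*real N"
  obtain M where M: "M > 0" "\<And>z. z \<in> cball 0 R' \<Longrightarrow> norm (u z) \<le> M"
    using entire_norm_bounded[OF u, of R'] by blast
  define K where "K = cball (0::complex) (M + 1)"
  define X where "X = (2*C) ^ N"
  have "X \<ge> 0" using C_nonneg by (simp add: X_def)
  define \<epsilon>' where "\<epsilon>' = \<epsilon> / (X + 1)"
  have e': "\<epsilon>' > 0" "X * \<epsilon>' \<le> \<epsilon>"
    using \<open>\<epsilon> > 0\<close> \<open>X \<ge> 0\<close> by (auto simp: \<epsilon>'_def field_simps)
  have uc: "uniformly_continuous_on K (\<lambda>x. x ^ n)" for n
    unfolding K_def by (intro compact_uniformly_continuous continuous_on_power continuous_on_id) auto
  have "\<exists>\<delta>>0. \<forall>x\<in>K. \<forall>y\<in>K. dist y x < \<delta> \<longrightarrow> dist (y ^ n) (x ^ n) < \<epsilon>'" for n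
    using uc[of n] e'(1) unfolding uniformly_continuous_on_def by blast
  then obtain d where d: "\<And>n. d n > 0"
    "\<And>n x y. x \<in> K \<Longrightarrow> y \<in> K \<Longrightarrow> dist y x < d n \<Longrightarrow> dist (y ^ n) (x ^ n) < \<epsilon>'"
    by metis
  define \<delta> where "\<delta> = min 1 (Min (d ` {..m}) / 2)"
  have d0: "Min (d ` {..m}) > 0" using d(1) by (subst Min_gr_iff) auto
  show thesis
  proof (rule that[of \<delta> R'])
    show "\<delta> > 0" using d0 by (simp add: \<delta>_def)
    fix v and z :: complex and n assume v: "entire v" "n \<le> m" "\<forall>w\<in>cball 0 R'. norm (v w - u w) \<le> \<delta>" "z \<in> cball 0 R"
    have "norm (v w ^ n - u w ^ n) \<le> \<epsilon>'" if w: "w \<in> cball 0 R'" for w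
    proof -
      have 1: "norm (v w - u w) \<le> \<delta>" using v w by blast
      have "Min (d ` {..m}) \<le> d n" using v by (intro Min_le) auto
      moreover have "\<delta> \<le> Min (d ` {..m}) / 2" unfolding \<delta>_def by (rule min.cobounded2)
      ultimately have "\<delta> < d n" using d0 by linarith
      moreover have "norm (v w) \<le> M + 1"
        using M(2)[OF w] 1 norm_triangle_ineq2[of "v w" "u w"] by (simp add: \<delta>_def)
      ultimately show ?thesis
        using d(2)[of "u w" "v w" n] M(2)[OF w] 1 by (simp add: K_def dist_norm)
    qed
    then have "norm ((T ^^ N) (\<lambda>z. v z ^ n - u z ^ n) z) \<le> (2*C) ^ N * \<epsilon>'"
      unfolding R'_def by (intro Tn_bound[OF _ _ v(4)] holomorphic_on_diff holomorphic_on_power v(1) u) auto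
    then show "norm ((T ^^ N) (\<lambda>z. v z ^ n) z - (T ^^ N) (\<lambda>z. u z ^ n) z) \<le> \<epsilon>"
      using e'(2)[unfolded X_def] Tn_diff[OF holomorphic_on_power[OF v(1)] holomorphic_on_power[OF u]] by simp
  qed
qed

end

section \<open>Local geometry of the logarithm of the symbol\<close>

text \<open>The roots of \<open>d * \<omega> ^ k = norm d\<close> differ by \<open>k\<close>-th roots of unity, whose sum is 0 for \<open>k \<ge> 2\<close>. Hence
the numbers \<open>Re (c * \<omega>)\<close> add up to 0 and cannot all be negative.\<close>

lemma complex_root_in_half_plane:
  fixes d c :: complex
  assumes "d \<noteq> 0" "k \<ge> 2"
  obtains \<omega> where "d * \<omega> ^ k = of_real (norm d)" "Re (c * \<omega>) \<ge> 0"
proof -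
  define \<omega>0 where "\<omega>0 = exp (Ln (of_real (norm d) / d) / of_nat k)"
  have "\<omega>0 ^ k = of_real (norm d) / d"
    using assms by (simp add: \<omega>0_def exp_of_nat_mult[symmetric])
  then have w0: "d * \<omega>0 ^ k = of_real (norm d)" using assms by simp
  let ?Z = "{z::complex. z ^ k = 1}"
  have Z: "finite ?Z" "?Z \<noteq> {}"
    using assms(2) finite_roots_unity[of k] by (auto intro: exI[of _ 1])
  have "(\<Sum>z\<in>?Z. Re (c * (\<omega>0 * z))) = Re (c * \<omega>0 * \<Sum>?Z)"
    by (simp add: sum_distrib_left mult.assoc)
  also have "\<Sum>?Z = 0" using assms(2) by (intro sum_roots_unity) simp
  finally have sum0: "(\<Sum>z\<in>?Z. Re (c * (\<omega>0 * z))) = 0" by simp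
  have "\<exists>z\<in>?Z. Re (c * (\<omega>0 * z)) \<ge> 0"
  proof (rule ccontr)
    assume "\<not> ?thesis"
    then have "(\<Sum>z\<in>?Z. Re (c * (\<omega>0 * z))) < (\<Sum>z\<in>?Z. 0)"
      using Z by (intro sum_strict_mono) auto
    then show False using sum0 by simp
  qed
  then obtain z where z: "z ^ k = 1" "Re (c * (\<omega>0 * z)) \<ge> 0" by blast
  then show thesis using w0 by (intro that[of "\<omega>0 * z"]) (auto simp: power_mult_distrib)
qed

lemma holomorphic_isCont: "f holomorphic_on S \<Longrightarrow> open S \<Longrightarrow> z \<in> S \<Longrightarrow> isCont f z"
  using continuous_on_eq_continuous_at holomorphic_on_imp_continuous_on by blast

lemma Re_of_real_mult: "Re (of_real x * z) = x * Re z"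
  by simp

lemma tendsto_along_ray:
  fixes G :: "complex \<Rightarrow> complex" and t :: real
  assumes "G holomorphic_on ball 0 r" "r > 0"
  shows "((\<lambda>s. G (of_real (t * s) * \<omega>)) \<longlongrightarrow> G 0) (at_right 0)"
    and "\<forall>\<^sub>F s in at_right 0. of_real (t * s) * \<omega> \<in> ball 0 r"
proof -
  have lim: "((\<lambda>s. of_real (t * s) * \<omega>) \<longlongrightarrow> of_real (t * 0) * \<omega>) (at_right 0)"
    by (intro tendsto_intros)
  have "isCont G 0"
    using assms by (intro holomorphic_isCont[OF assms(1)]) auto
  then show "((\<lambda>s. G (of_real (t * s) * \<omega>)) \<longlongrightarrow> G 0) (at_right 0)"
    by (rule isCont_tendsto_compose) (use lim in simp)
  show "\<forall>\<^sub>F s in at_right 0. of_real (t * s) * \<omega> \<in> ball 0 r"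
    using lim assms(2) by (intro topological_tendstoD[OF lim]) auto
qed

lemma zero_factorization:
  assumes "F holomorphic_on ball 0 r" "r > 0" "F 0 = 0" "\<not> F constant_on ball 0 r"
  shows "\<exists>k>0. \<exists>\<rho>>0. \<exists>G. ball (0::complex) \<rho> \<subseteq> ball 0 r \<and> G holomorphic_on ball 0 \<rho> \<and>
    (\<forall>z\<in>ball 0 \<rho>. F z = z ^ k * G z) \<and> (\<forall>z\<in>ball 0 \<rho>. G z \<noteq> (0::complex))"
proof -
  have zero: "0 \<in> ball 0 r" using assms(2) by simp
  show ?thesis
  proof (rule holomorphic_factor_zero_nonconstant[OF assms(1) open_ball connected_ball zero assms(3,4)])
    fix G :: "complex \<Rightarrow> complex" and \<rho> :: real and k :: nat
    assume G: "0 < k" "0 < \<rho>" "ball (0::complex) \<rho> \<subseteq> ball 0 r" "G holomorphic_on ball 0 \<rho>"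
      and eq: "\<And>w. w \<in> ball 0 \<rho> \<Longrightarrow> F w = (w - 0) ^ k * G w"
      and nz: "\<And>w. w \<in> ball 0 \<rho> \<Longrightarrow> G w \<noteq> 0"
    have "\<forall>z\<in>ball 0 \<rho>. F z = z ^ k * G z" "\<forall>z\<in>ball 0 \<rho>. G z \<noteq> 0" using eq nz by simp_all
    with G show ?thesis by (intro exI[of _ k] exI[of _ \<rho>] exI[of _ G] conjI)
  qed
qed

text \<open>Near 0 the function behaves like its lowest order term \<open>z ^ k * G 0\<close>, and some \<open>w\<close> makes
\<open>w ^ k * G 0\<close> a negative number.\<close>

lemma descending_ray:
  assumes H: "H holomorphic_on ball 0 r" "r > 0" "H 0 = 0" "\<not> H constant_on ball 0 r"
  obtains w :: complex where "w \<noteq> 0" "\<forall>\<^sub>F t in at_right 0. Re (H (of_real t * w)) < 0"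
proof -
  obtain G \<rho> k where G: "0 < k" "0 < \<rho>" "ball (0::complex) \<rho> \<subseteq> ball 0 r" "G holomorphic_on ball 0 \<rho>"
     "\<And>z. z \<in> ball 0 \<rho> \<Longrightarrow> H z = z ^ k * G z" "\<And>z. z \<in> ball 0 \<rho> \<Longrightarrow> G z \<noteq> 0"
    using zero_factorization[OF H] by blast
  have d: "G 0 \<noteq> 0" using G by simp
  define w where "w = exp (Ln (- of_real (norm (G 0)) / G 0) / of_nat k)"
  have "w ^ k = - of_real (norm (G 0)) / G 0"
    using G(1) d by (simp add: w_def exp_of_nat_mult[symmetric])
  then have wk: "w ^ k * G 0 = - of_real (norm (G 0))" using d by simp
  have "((\<lambda>t. Re (w ^ k * G (of_real (1 * t) * w))) \<longlongrightarrow> Re (w ^ k * G 0)) (at_right 0)"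
    by (intro tendsto_intros tendsto_along_ray[OF G(4,2)])
  moreover have "Re (w ^ k * G 0) < 0" using d wk by simp
  ultimately have "\<forall>\<^sub>F t in at_right 0. Re (w ^ k * G (of_real (1 * t) * w)) < 0"
    by (rule order_tendstoD)
  moreover have "\<forall>\<^sub>F t in at_right 0. of_real (1 * t) * w \<in> ball 0 \<rho>"
    by (rule tendsto_along_ray[OF G(4,2)])
  moreover have "\<forall>\<^sub>F t in at_right (0::real). 0 < t" by (simp add: eventually_at_right_less)
  ultimately have "\<forall>\<^sub>F t in at_right 0. Re (H (of_real t * w)) < 0"
  proof eventually_elim
    case (elim t)
    have "H (of_real t * w) = of_real (t ^ k) * (w ^ k * G (of_real (1 * t) * w))"
      using G(5)[OF elim(2)] by (simp add: power_mult_distrib)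
    then have "Re (H (of_real t * w)) = t ^ k * Re (w ^ k * G (of_real (1 * t) * w))"
      by (simp only: Re_of_real_mult)
    then show ?case using elim by (simp only: mult_pos_neg zero_less_power)
  qed
  then show thesis using that[of w] by (simp add: w_def)
qed

text \<open>Subtract the linear part \<open>c * z\<close>; what remains is \<open>z ^ k * G z\<close> with \<open>k \<ge> 2\<close> and \<open>G 0 \<noteq> 0\<close>. Along a
direction \<open>\<omega>\<close> with \<open>G 0 * \<omega> ^ k > 0\<close> the difference between \<open>t * Re (H \<mu>)\<close> and \<open>Re (H (t * \<mu>))\<close>
is to leading order \<open>(t - t ^ k) * norm (G 0) * s ^ k\<close> at \<open>\<mu> = s * \<omega>\<close>, because the linear part
cancels. Requiring also \<open>Re (c * \<omega>) \<ge> 0\<close> gives \<open>Re (H \<mu>) > 0\<close>, and the zeros of the second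
derivative are isolated.\<close>

lemma superlinear_point:
  assumes H: "H holomorphic_on ball 0 r" "r > 0" "H 0 = 0"
    and nonlinear: "\<And>c. \<exists>z\<in>ball 0 r. H z \<noteq> c * z"
    and S: "finite S" "S \<subseteq> {0<..<1}"
  obtains \<mu> where "\<mu> \<in> ball 0 r" "Re (H \<mu>) > 0" "deriv (deriv H) \<mu> \<noteq> 0"
    "\<And>t. t \<in> S \<Longrightarrow> Re (H (of_real t * \<mu>)) < t * Re (H \<mu>)"
proof -
  have zero: "0 \<in> ball 0 r" using H(2) by simp
  define c where "c = deriv H 0"
  define F where "F z = H z - c * z" for z
  have F_hol: "F holomorphic_on ball 0 r" unfolding F_def by (intro holomorphic_intros H)
  have F0: "F 0 = 0" by (simp add: F_def H)
  have Hd: "(H has_field_derivative deriv H z) (at z)" if "z \<in> ball 0 r" for z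
    by (rule holomorphic_derivI[OF H(1) open_ball that])
  have F_nonconst: "\<not> F constant_on ball 0 r"
  proof
    assume "F constant_on ball 0 r"
    then obtain y where y: "\<And>z. z \<in> ball 0 r \<Longrightarrow> F z = y" unfolding constant_on_def by blast
    then have "F z = 0" if "z \<in> ball 0 r" for z using y[OF that] y[OF zero] F0 by simp
    then show False using nonlinear[of c] by (auto simp: F_def)
  qed
  obtain G \<rho> k where G: "0 < k" "0 < \<rho>" "ball (0::complex) \<rho> \<subseteq> ball 0 r" "G holomorphic_on ball 0 \<rho>"
     "\<And>z. z \<in> ball 0 \<rho> \<Longrightarrow> F z = z ^ k * G z" "\<And>z. z \<in> ball 0 \<rho> \<Longrightarrow> G z \<noteq> 0"
    using zero_factorization[OF F_hol H(2) F0 F_nonconst] by blast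
  have d: "G 0 \<noteq> 0" using G by simp
  have "k \<noteq> 1"
  proof
    assume k: "k = 1"
    have "(F has_field_derivative deriv H 0 - c) (at 0)"
      unfolding F_def using H(2) by (auto intro!: derivative_eq_intros Hd)
    then have 1: "(F has_field_derivative 0) (at 0)" by (simp add: c_def)
    have "((\<lambda>z. z * G z) has_field_derivative G 0) (at 0)"
      using DERIV_mult'[OF DERIV_ident holomorphic_derivI[OF G(4) open_ball], of 0] G(2) by simp
    then have "(F has_field_derivative G 0) (at 0)"
      by (rule has_field_derivative_transform_within_open[OF _ open_ball, of _ _ _ 0 \<rho>])
         (use G k in auto)
    with 1 d show False using DERIV_unique by blast
  qed
  with G(1) have k: "k \<ge> 2" by simp
  obtain \<omega> where \<omega>: "G 0 * \<omega> ^ k = of_real (norm (G 0))" "Re (c * \<omega>) \<ge> 0"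
    using complex_root_in_half_plane[OF d k] by blast
  have "\<omega> \<noteq> 0" using \<omega>(1) d k by (auto simp: power_0_left)
  \<comment> \<open>\<open>s ^ k * \<gamma> s\<close> is the nonlinear part of \<open>Re H\<close> along the ray.\<close>
  define \<gamma> where "\<gamma> s = Re (\<omega> ^ k * G (of_real s * \<omega>))" for s
  have \<gamma>_lim: "((\<lambda>s. \<gamma> (t * s)) \<longlongrightarrow> norm (G 0)) (at_right 0)" for t
  proof -
    have "((\<lambda>s. \<gamma> (t * s)) \<longlongrightarrow> Re (\<omega> ^ k * G 0)) (at_right 0)"
      unfolding \<gamma>_def by (intro tendsto_intros tendsto_along_ray[OF G(4,2)])
    then show ?thesis using \<omega>(1) by (simp add: mult.commute)
  qed
  have H_ray: "Re (H (of_real s * \<omega>)) = s * Re (c * \<omega>) + s ^ k * \<gamma> s"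
    if "of_real s * \<omega> \<in> ball 0 \<rho>" for s
  proof -
    have "H (of_real s * \<omega>) = of_real s * (c * \<omega>) + of_real (s ^ k) * (\<omega> ^ k * G (of_real s * \<omega>))"
      using G(5)[OF that] by (simp add: F_def power_mult_distrib algebra_simps)
    then show ?thesis by (simp only: \<gamma>_def plus_complex.sel Re_of_real_mult)
  qed
  note pos = eventually_at_right_less[of "0::real"]
  have in\<rho>: "\<forall>\<^sub>F s in at_right 0. of_real (t * s) * \<omega> \<in> ball 0 \<rho>" for t :: real
    by (rule tendsto_along_ray[OF G(4,2)])
  have "\<forall>\<^sub>F s in at_right 0. \<gamma> (1 * s) > 0"
    using order_tendstoD(1)[OF \<gamma>_lim, of 0 1] d by simp
  with in\<rho>[of 1] pos have ev1: "\<forall>\<^sub>F s in at_right 0. Re (H (of_real s * \<omega>)) > 0"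
  proof eventually_elim
    case (elim s)
    then have "s * Re (c * \<omega>) \<ge> 0" "s ^ k * \<gamma> s > 0" using \<omega>(2) by (auto simp del: times_complex.sel)
    moreover have "Re (H (of_real s * \<omega>)) = s * Re (c * \<omega>) + s ^ k * \<gamma> s"
      using H_ray[of s] elim by (simp del: times_complex.sel)
    ultimately show ?case by linarith
  qed
  have ev2: "\<forall>\<^sub>F s in at_right 0. \<forall>t\<in>S. Re (H (of_real t * (of_real s * \<omega>))) < t * Re (H (of_real s * \<omega>))"
  proof (rule eventually_ball_finite[OF S(1)], rule ballI)
    fix t assume "t \<in> S"
    then have t: "0 < t" "t < 1" using S by auto
    have "((\<lambda>s. t * \<gamma> (1 * s) - t ^ k * \<gamma> (t * s)) \<longlongrightarrow> t * norm (G 0) - t ^ k * norm (G 0)) (at_right 0)"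
      by (intro tendsto_intros \<gamma>_lim)
    moreover have "t ^ k < t" using power_strict_decreasing[of 1 k t] k t by simp
    then have "t * norm (G 0) - t ^ k * norm (G 0) > 0" using d by simp
    ultimately have "\<forall>\<^sub>F s in at_right 0. t * \<gamma> (1 * s) - t ^ k * \<gamma> (t * s) > 0"
      by (rule order_tendstoD)
    with in\<rho>[of 1] in\<rho>[of t] pos
    show "\<forall>\<^sub>F s in at_right 0. Re (H (of_real t * (of_real s * \<omega>))) < t * Re (H (of_real s * \<omega>))"
    proof eventually_elim
      case (elim s)
      have 1: "Re (H (of_real s * \<omega>)) = s * Re (c * \<omega>) + s ^ k * \<gamma> s"
        using H_ray[of s] elim by simp
      have 2: "Re (H (of_real t * (of_real s * \<omega>))) = (t * s) * Re (c * \<omega>) + (t * s) ^ k * \<gamma> (t * s)"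
        using H_ray[of "t * s"] elim by (simp add: mult.assoc)
      have "0 < s ^ k * (t * \<gamma> s - t ^ k * \<gamma> (t * s))" using elim by simp
      then show ?case unfolding 1 2 by (simp add: algebra_simps power_mult_distrib)
    qed
  qed
  define H2 where "H2 = deriv (deriv H)"
  have H1: "deriv H holomorphic_on ball 0 r" by (intro holomorphic_deriv H open_ball)
  then have H2: "H2 holomorphic_on ball 0 r" unfolding H2_def by (rule holomorphic_deriv[OF _ open_ball])
  have "\<exists>z\<in>ball 0 r. H2 z \<noteq> 0"
  proof (rule ccontr)
    assume *: "\<not> ?thesis"
    have "deriv H constant_on ball 0 r"
    proof (rule has_field_derivative_0_imp_constant_on[OF _ convex_connected[OF convex_ball] open_ball])
      fix z :: complex assume z: "z \<in> ball 0 r"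
      show "(deriv H has_field_derivative 0) (at z)"
        using holomorphic_derivI[OF H1 open_ball z] * z by (simp add: H2_def)
    qed
    then obtain y where y: "\<And>z. z \<in> ball 0 r \<Longrightarrow> deriv H z = y" unfolding constant_on_def by blast
    then have dH: "deriv H z = c" if "z \<in> ball 0 r" for z using y[OF that] y[OF zero] by (simp add: c_def)
    have "F constant_on ball 0 r"
    proof (rule has_field_derivative_0_imp_constant_on[OF _ convex_connected[OF convex_ball] open_ball])
      fix z :: complex assume z: "z \<in> ball 0 r"
      show "(F has_field_derivative 0) (at z)"
        unfolding F_def using Hd[OF z] dH[OF z] by (auto intro!: derivative_eq_intros)
    qed
    then show False using F_nonconst by simp
  qed
  then obtain \<beta> where \<beta>: "\<beta> \<in> ball 0 r" "H2 \<beta> \<noteq> 0" by blast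
  have "\<exists>\<rho>'>0. \<forall>z\<in>ball 0 \<rho>' - {0}. H2 z \<noteq> 0"
  proof (cases "H2 0 = 0")
    case True
    show ?thesis
    proof (rule isolated_zeros[OF H2 open_ball connected_ball zero True \<beta>])
      fix \<rho>' assume "0 < \<rho>'" "\<And>z. z \<in> ball 0 \<rho>' - {0} \<Longrightarrow> H2 z \<noteq> 0"
      then show ?thesis by (intro exI[of _ \<rho>']) simp
    qed
  next
    case False
    have "isCont H2 0"
      by (rule holomorphic_isCont[OF H2 open_ball zero])
    then obtain e where "e > 0" "\<forall>y. dist 0 y < e \<longrightarrow> H2 y \<noteq> 0"
      using continuous_at_avoid[of 0 H2 0] False by blast
    then show ?thesis by (intro exI[of _ e]) simp
  qed
  then obtain \<rho>' where \<rho>': "\<rho>' > 0" "\<And>z. z \<in> ball 0 \<rho>' - {0} \<Longrightarrow> H2 z \<noteq> 0" by blast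
  have "\<forall>\<^sub>F s in at_right 0. of_real (1 * s) * \<omega> \<in> ball 0 \<rho>'"
    by (rule tendsto_along_ray(2)[OF holomorphic_on_const[of 0] \<rho>'(1)])
  with pos have ev3: "\<forall>\<^sub>F s in at_right 0. H2 (of_real s * \<omega>) \<noteq> 0"
    by eventually_elim (intro \<rho>'(2), use \<open>\<omega> \<noteq> 0\<close> in auto)
  from in\<rho>[of 1] ev1 ev2 ev3 have "\<forall>\<^sub>F s in at_right (0::real). of_real s * \<omega> \<in> ball 0 \<rho> \<and>
      Re (H (of_real s * \<omega>)) > 0 \<and>
      (\<forall>t\<in>S. Re (H (of_real t * (of_real s * \<omega>))) < t * Re (H (of_real s * \<omega>))) \<and> H2 (of_real s * \<omega>) \<noteq> 0"
    by eventually_elim simp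
  then obtain s :: real where "of_real s * \<omega> \<in> ball 0 \<rho>" "Re (H (of_real s * \<omega>)) > 0"
    "\<forall>t\<in>S. Re (H (of_real t * (of_real s * \<omega>))) < t * Re (H (of_real s * \<omega>))" "H2 (of_real s * \<omega>) \<noteq> 0"
    using eventually_happens[of _ "at_right (0::real)"] trivial_limit_at_right_real by blast
  then show thesis using G(3) by (intro that[of "of_real s * \<omega>"]) (auto simp: H2_def)
qed

text \<open>The second derivative of \<open>Re H\<close> along the direction \<open>v\<close> is \<open>Re (v\<^sup>2 * H'')\<close>, which is positive at
\<open>\<mu>\<close> when \<open>v\<close> is a square root of the conjugate of \<open>H''(\<mu>)\<close>, and hence positive near \<open>\<mu>\<close>. Strict
convexity is expressed by tangent lines that lie strictly below the graph.\<close>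

lemma strictly_convex_direction:
  assumes H: "H holomorphic_on ball 0 r" and \<mu>: "\<mu> \<in> ball 0 r" "deriv (deriv H) \<mu> \<noteq> 0"
  obtains v :: complex and \<delta> :: real where "v \<noteq> 0" "\<delta> > 0"
    "\<And>s. s \<in> {0..\<delta>} \<Longrightarrow> \<mu> + of_real s * v \<in> ball 0 r"
    "\<And>s. s \<in> {0..\<delta>} \<Longrightarrow> \<exists>D. \<forall>s'\<in>{0..\<delta>}. s' \<noteq> s \<longrightarrow>
       Re (H (\<mu> + of_real s * v)) + D * (s' - s) < Re (H (\<mu> + of_real s' * v))"
proof -
  define H2 where "H2 = deriv (deriv H)"
  have H1: "deriv H holomorphic_on ball 0 r" by (intro holomorphic_deriv H open_ball)
  then have H2: "H2 holomorphic_on ball 0 r" unfolding H2_def by (rule holomorphic_deriv[OF _ open_ball])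
  \<comment> \<open>Then \<open>v\<^sup>2 * H2 \<mu>\<close> is the square of \<open>norm (H2 \<mu>)\<close>.\<close>
  define v where "v = csqrt (cnj (H2 \<mu>))"
  have v0: "v \<noteq> 0" using \<mu>(2) by (simp add: v_def H2_def)
  have "v\<^sup>2 * H2 \<mu> = of_real ((norm (H2 \<mu>))\<^sup>2)"
    unfolding v_def by (simp add: complex_norm_square[symmetric] mult.commute)
  then have v2: "Re (v\<^sup>2 * H2 \<mu>) > 0" using \<mu>(2) by (simp add: H2_def)
  have "isCont H2 \<mu>"
    by (rule holomorphic_isCont[OF H2 open_ball \<mu>(1)])
  then have "((\<lambda>s. H2 (\<mu> + of_real s * v)) \<longlongrightarrow> H2 \<mu>) (at_right 0)"
    by (rule isCont_tendsto_compose) (auto intro!: tendsto_eq_intros)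
  then have lim: "((\<lambda>s. Re (v\<^sup>2 * H2 (\<mu> + of_real s * v))) \<longlongrightarrow> Re (v\<^sup>2 * H2 \<mu>)) (at_right 0)"
    by (intro tendsto_Re tendsto_mult tendsto_const)
  have "((\<lambda>s. \<mu> + of_real s * v) \<longlongrightarrow> \<mu>) (at_right 0)" by (auto intro!: tendsto_eq_intros)
  from order_tendstoD(1)[OF lim v2] topological_tendstoD[OF this open_ball \<mu>(1)]
  have "\<forall>\<^sub>F s in at_right 0. Re (v\<^sup>2 * H2 (\<mu> + of_real s * v)) > 0 \<and> \<mu> + of_real s * v \<in> ball 0 r"
    by eventually_elim simp
  then obtain \<delta>' where d': "\<delta>' > 0"
    "\<And>s. 0 < s \<Longrightarrow> s < \<delta>' \<Longrightarrow> Re (v\<^sup>2 * H2 (\<mu> + of_real s * v)) > 0 \<and> \<mu> + of_real s * v \<in> ball 0 r"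
    unfolding eventually_at_right_field by (auto simp: zero_less_iff_neq_zero)
  define \<delta> where "\<delta> = \<delta>' / 2"
  have \<delta>: "\<delta> > 0" using d'(1) by (simp add: \<delta>_def)
  have good: "Re (v\<^sup>2 * H2 (\<mu> + of_real s * v)) > 0" "\<mu> + of_real s * v \<in> ball 0 r"
    if "s \<in> {0..\<delta>}" for s
    using d'(1) d'(2)[of s] that \<mu>(1) v2 by (cases "s = 0"; auto simp: \<delta>_def)+
  define q where "q s = Re (H (\<mu> + of_real s * v))" for s
  define q1 where "q1 s = Re (v * deriv H (\<mu> + of_real s * v))" for s
  have line: "((\<lambda>s. \<mu> + of_real s * v) has_vector_derivative v) (at s)" for s
    by (auto intro!: derivative_eq_intros simp: has_vector_derivative_def scaleR_conv_of_real)
  have dRe: "((\<lambda>s. Re (f (\<mu> + of_real s * v))) has_real_derivative Re (v * f')) (at s)"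
    if "(f has_field_derivative f') (at (\<mu> + of_real s * v))" for f f' s
  proof -
    have "((f \<circ> (\<lambda>s. \<mu> + of_real s * v)) has_vector_derivative (v * f')) (at s)"
      by (rule field_vector_diff_chain_at[OF line that])
    then have "((\<lambda>s. Re ((f \<circ> (\<lambda>s. \<mu> + of_real s * v)) s)) has_vector_derivative Re (v * f')) (at s)"
      by (rule bounded_linear.has_vector_derivative[OF bounded_linear_Re])
    then show ?thesis by (simp add: has_real_derivative_iff_has_vector_derivative o_def)
  qed
  have dq: "(q has_real_derivative q1 s) (at s)" if "s \<in> {0..\<delta>}" for s
    unfolding q_def q1_def by (intro dRe holomorphic_derivI[OF H open_ball] good(2) that)
  have dq1: "(q1 has_real_derivative Re (v\<^sup>2 * H2 (\<mu> + of_real s * v))) (at s)" if "s \<in> {0..\<delta>}" for s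
  proof -
    have "((\<lambda>z. v * deriv H z) has_field_derivative v * H2 (\<mu> + of_real s * v)) (at (\<mu> + of_real s * v))"
      unfolding H2_def by (intro DERIV_cmult holomorphic_derivI[OF H1 open_ball] good(2) that)
    from dRe[OF this] show ?thesis by (simp add: q1_def[abs_def] power2_eq_square mult.assoc)
  qed
  have q1_mono: "q1 s < q1 s'" if "s < s'" "s \<in> {0..\<delta>}" "s' \<in> {0..\<delta>}" for s s'
  proof (rule DERIV_pos_imp_increasing[OF that(1)])
    fix x assume "s \<le> x" "x \<le> s'"
    then have x: "x \<in> {0..\<delta>}" using that by auto
    show "\<exists>y. (q1 has_real_derivative y) (at x) \<and> 0 < y" using dq1[OF x] good(1)[OF x] by blast
  qed
  have tangent: "q s + q1 s * (s' - s) < q s'" if s: "s \<in> {0..\<delta>}" "s' \<in> {0..\<delta>}" "s' \<noteq> s" for s s'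
  proof (cases "s < s'")
    case True
    obtain \<xi> where \<xi>: "s < \<xi>" "\<xi> < s'" "q s' - q s = (s' - s) * q1 \<xi>"
      using MVT2[OF True, of q q1] dq s by auto
    have "(s' - s) * q1 s < (s' - s) * q1 \<xi>" using \<xi> True s by (intro mult_strict_left_mono q1_mono) auto
    then show ?thesis using \<xi>(3) by (simp add: mult.commute)
  next
    case False
    then have lt: "s' < s" using s by simp
    obtain \<xi> where \<xi>: "s' < \<xi>" "\<xi> < s" "q s - q s' = (s - s') * q1 \<xi>"
      using MVT2[OF lt, of q q1] dq s by auto
    have "(s - s') * q1 \<xi> < (s - s') * q1 s" using \<xi> lt s by (intro mult_strict_left_mono q1_mono) auto
    then show ?thesis using \<xi>(3) by (simp add: algebra_simps)
  qed
  show thesis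
  proof (rule that[OF v0 \<delta> good(2)])
    fix s assume "s \<in> {0..\<delta>}"
    then show "\<exists>D. \<forall>s'\<in>{0..\<delta>}. s' \<noteq> s \<longrightarrow>
        Re (H (\<mu> + of_real s * v)) + D * (s' - s) < Re (H (\<mu> + of_real s' * v))"
      using tangent[of s] unfolding q_def by (intro exI[of _ "q1 s"]) simp
  qed
qed

text \<open>Add up the tangent line inequality at the mean; the linear terms cancel, and at least one point
differs from the mean.\<close>

lemma strict_jensen:
  fixes q :: "real \<Rightarrow> real" and s :: "'k \<Rightarrow> real"
  assumes tangent: "\<And>x. x \<in> {a..b} \<Longrightarrow> \<exists>D. \<forall>y\<in>{a..b}. y \<noteq> x \<longrightarrow> q x + D * (y - x) < q y"
    and K: "finite K" "\<And>k. k \<in> K \<Longrightarrow> s k \<in> {a..b}" and neq: "\<exists>k\<in>K. \<exists>l\<in>K. s k \<noteq> s l"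
  shows "q ((\<Sum>k\<in>K. s k) / card K) < (\<Sum>k\<in>K. q (s k)) / card K"
proof -
  define x where "x = (\<Sum>k\<in>K. s k) / card K"
  have c: "card K > 0" using K neq by (auto simp: card_gt_0_iff)
  have "(\<Sum>k\<in>K. s k) \<le> card K * b" "card K * a \<le> (\<Sum>k\<in>K. s k)"
    using sum_bounded_above[of K s b] sum_bounded_below[of K a s] K by auto
  then have "x \<in> {a..b}" using c by (simp add: x_def pos_le_divide_eq pos_divide_le_eq mult.commute)
  then obtain D where D: "\<And>y. y \<in> {a..b} \<Longrightarrow> y \<noteq> x \<Longrightarrow> q x + D * (y - x) < q y"
    using tangent by blast
  have "(\<Sum>k\<in>K. q x + D * (s k - x)) < (\<Sum>k\<in>K. q (s k))"
  proof (rule sum_strict_mono_ex1[OF K(1)])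
    show "\<forall>k\<in>K. q x + D * (s k - x) \<le> q (s k)"
    proof
      fix k assume "k \<in> K"
      then show "q x + D * (s k - x) \<le> q (s k)" using D[OF K(2), of k] by (cases "s k = x") auto
    qed
    obtain k l where "k \<in> K" "l \<in> K" "s k \<noteq> s l" using neq by blast
    then obtain k where "k \<in> K" "s k \<noteq> x" by (cases "s k = x") auto
    then show "\<exists>k\<in>K. q x + D * (s k - x) < q (s k)" using D[OF K(2)] by blast
  qed
  also have "(\<Sum>k\<in>K. q x + D * (s k - x)) = card K * q x + D * ((\<Sum>k\<in>K. s k) - card K * x)"
    by (simp add: sum.distrib sum_distrib_left[symmetric] sum_subtractf)
  also have "(\<Sum>k\<in>K. s k) - card K * x = 0" using c by (simp add: x_def)
  finally have "card K * q x < (\<Sum>k\<in>K. q (s k))" by simp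
  then show ?thesis unfolding x_def[symmetric] using c by (simp add: pos_less_divide_eq mult.commute)
qed

lemma local_logarithm:
  assumes \<Phi>: "entire \<Phi>" "\<Phi> 0 = 1"
  obtains r H where "r > 0" "H holomorphic_on ball 0 r" "H 0 = 0"
    "\<And>z. z \<in> ball 0 r \<Longrightarrow> \<Phi> z = exp (H z)"
proof -
  have "isCont \<Phi> 0" by (rule holomorphic_isCont[OF \<Phi>(1)]) auto
  then have "\<exists>r>0. \<forall>y. dist 0 y < r \<longrightarrow> \<Phi> y \<noteq> 0"
    by (rule continuous_at_avoid) (simp add: \<Phi>(2))
  then obtain r where r: "r > 0" "\<And>y. dist 0 y < r \<Longrightarrow> \<Phi> y \<noteq> 0" by blast
  have hol: "\<Phi> holomorphic_on ball 0 r" by (rule holomorphic_on_subset[OF \<Phi>(1)]) simp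
  have "contractible (ball (0::complex) r)" by (rule convex_imp_contractible[OF convex_ball])
  then show thesis
  proof (rule contractible_imp_holomorphic_log[OF hol])
    show "\<Phi> z \<noteq> 0" if "z \<in> ball 0 r" for z using r(2) that by simp
    fix g assume g: "g holomorphic_on ball 0 r" and exp_g: "\<And>z. z \<in> ball 0 r \<Longrightarrow> \<Phi> z = exp (g z)"
    have "exp (g 0) = 1" using exp_g[of 0] r(1) \<Phi>(2) by simp
    then have "\<Phi> z = exp (g z - g 0)" if "z \<in> ball 0 r" for z
      using exp_g[OF that] by (simp add: exp_diff)
    then show thesis
      by (intro that[of r "\<lambda>z. g z - g 0"] holomorphic_on_diff g holomorphic_on_const r(1)) simp_all
  qed
qed

text \<open>Here \<open>K\<close> indexes the factors with frequencies \<open>(\<mu> + s k * v) / m\<close> in a product of exponentials, and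
\<open>t * w\<close> is the total frequency of the remaining factors. The claim covers all products of at most
\<open>m\<close> factors except the empty one and the \<open>m\<close>-th powers of one exponential of the segment. Without factors from the
segment it is \<open>descending_ray\<close>; with \<open>m\<close> of them it is \<open>strict_jensen\<close>; with \<open>0 < j < m\<close> of them the
frequency is close to \<open>(j / m) * \<mu>\<close>, where \<open>superlinear_point\<close> leaves a positive gap.\<close>

lemma convex_configuration:
  assumes \<Phi>: "entire \<Phi>" "\<Phi> 0 = 1" and nonexp: "\<And>c. \<exists>z. \<Phi> z \<noteq> exp (c * z)" and m: "m > (0::nat)"
  obtains \<mu> v w :: complex and \<delta> :: real where "v \<noteq> 0" "w \<noteq> 0" "\<delta> > 0"
    "\<And>s. s \<in> {0..\<delta>} \<Longrightarrow> norm (\<Phi> (\<mu> + of_real s * v)) > 1"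
    "\<And>(K::nat set) s t. finite K \<Longrightarrow> card K \<le> m \<Longrightarrow> (\<And>k. k \<in> K \<Longrightarrow> s k \<in> {0..\<delta>}) \<Longrightarrow> t \<in> {0..\<delta>} \<Longrightarrow>
       (K = {} \<Longrightarrow> t > 0) \<Longrightarrow> (card K = m \<Longrightarrow> t = 0 \<and> (\<exists>k\<in>K. \<exists>l\<in>K. s k \<noteq> s l)) \<Longrightarrow>
       norm (\<Phi> ((\<Sum>k\<in>K. \<mu> + of_real (s k) * v) / of_nat m + of_real t * w))
         < exp ((\<Sum>k\<in>K. ln (norm (\<Phi> (\<mu> + of_real (s k) * v)))) / m)"
proof -
  obtain r H where r: "r > 0" and H: "H holomorphic_on ball 0 r" "H 0 = 0"
    and \<Phi>H: "\<And>z. z \<in> ball 0 r \<Longrightarrow> \<Phi> z = exp (H z)"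
    using local_logarithm[OF \<Phi>] by blast
  have norm\<Phi>: "norm (\<Phi> z) = exp (Re (H z))" if "z \<in> ball 0 r" for z
    using \<Phi>H[OF that] by simp
  have nonlinear: "\<exists>z\<in>ball 0 r. H z \<noteq> c * z" for c
  proof (rule ccontr)
    assume "\<not> ?thesis"
    then have "\<Phi> z = exp (c * z)" if "z \<in> ball 0 r" for z using \<Phi>H[OF that] that by auto
    moreover have "(\<lambda>z. exp (c * z)) holomorphic_on UNIV" by (intro holomorphic_intros)
    ultimately have "\<Phi> z = exp (c * z)" for z
      using r by (intro analytic_continuation_open[of "ball 0 r" UNIV \<Phi> "\<lambda>z. exp (c * z)" z] \<Phi>(1)) auto
    then show False using nonexp[of c] by blast
  qed
  have "\<not> H constant_on ball 0 r"
  proof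
    assume "H constant_on ball 0 r"
    then obtain y where "\<And>z. z \<in> ball 0 r \<Longrightarrow> H z = y" unfolding constant_on_def by blast
    then have "\<And>z. z \<in> ball 0 r \<Longrightarrow> H z = 0 * z" using H(2) r by (metis centre_in_ball mult_zero_left)
    then show False using nonlinear[of 0] by blast
  qed
  then obtain w where w: "w \<noteq> 0" "\<forall>\<^sub>F t in at_right 0. Re (H (of_real t * w)) < 0"
    using descending_ray[OF H(1) r H(2)] by blast
  have "\<forall>\<^sub>F t in at_right 0. of_real (1 * t) * w \<in> ball 0 r" by (rule tendsto_along_ray[OF H(1) r])
  with w(2) have "\<forall>\<^sub>F t in at_right 0. norm (\<Phi> (of_real t * w)) < 1"
    by eventually_elim (simp add: norm\<Phi>)
  then obtain \<delta>w where \<delta>w: "\<delta>w > 0" "\<And>t. 0 < t \<Longrightarrow> t < \<delta>w \<Longrightarrow> norm (\<Phi> (of_real t * w)) < 1"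
    unfolding eventually_at_right_field by auto
  define S where "S = (\<lambda>j. real j / real m) ` {1..<m}"
  have "finite S" "S \<subseteq> {0<..<1}" unfolding S_def using m by (auto simp: field_simps)
  then obtain \<mu> where \<mu>: "\<mu> \<in> ball 0 r" "Re (H \<mu>) > 0" "deriv (deriv H) \<mu> \<noteq> 0"
    "\<And>t. t \<in> S \<Longrightarrow> Re (H (of_real t * \<mu>)) < t * Re (H \<mu>)"
    using superlinear_point[OF H(1) r H(2) nonlinear] by blast
  obtain v \<delta>v where v: "v \<noteq> 0" "\<delta>v > 0"
    "\<And>s. s \<in> {0..\<delta>v} \<Longrightarrow> \<mu> + of_real s * v \<in> ball 0 r"
    "\<And>s. s \<in> {0..\<delta>v} \<Longrightarrow> \<exists>D. \<forall>s'\<in>{0..\<delta>v}. s' \<noteq> s \<longrightarrow>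
       Re (H (\<mu> + of_real s * v)) + D * (s' - s) < Re (H (\<mu> + of_real s' * v))"
    using strictly_convex_direction[OF H(1) \<mu>(1,3)] by blast
  \<comment> \<open>Continuity of the logarithm at the finitely many points that matter.\<close>
  have near: "\<exists>e>0. \<forall>x. norm (x - y) < e \<longrightarrow> x \<in> ball 0 r \<and> \<bar>Re (H x) - Re (H y)\<bar> < \<eta>"
    if y: "y \<in> ball 0 r" and "\<eta> > 0" for y \<eta>
  proof -
    have "(H \<longlongrightarrow> H y) (nhds y)"
      using holomorphic_isCont[OF H(1) open_ball y] by (simp add: isCont_def tendsto_at_iff_tendsto_nhds)
    then have "((\<lambda>x. Re (H x)) \<longlongrightarrow> Re (H y)) (nhds y)" by (rule tendsto_Re)
    then have "\<forall>\<^sub>F x in nhds y. dist (Re (H x)) (Re (H y)) < \<eta>" using \<open>\<eta> > 0\<close> by (rule tendstoD)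
    moreover have "\<forall>\<^sub>F x in nhds y. x \<in> ball 0 r" using y by (intro eventually_nhds_in_open) auto
    ultimately have "\<forall>\<^sub>F x in nhds y. x \<in> ball 0 r \<and> \<bar>Re (H x) - Re (H y)\<bar> < \<eta>"
      by eventually_elim (simp add: dist_real_def)
    then show ?thesis unfolding eventually_nhds_metric by (simp add: dist_norm)
  qed
  define t where "t j = real j / real m" for j
  \<comment> \<open>Half of the gap pays for moving the evaluation point away from \<open>t j * \<mu>\<close>, the other half for moving
    the points of the segment away from \<open>\<mu>\<close>.\<close>
  define gap where "gap j = t j * Re (H \<mu>) - Re (H (of_real (t j) * \<mu>))" for j
  have gap: "gap j > 0" if "j \<in> {1..<m}" for j
    using \<mu>(4)[of "t j"] that by (auto simp: gap_def S_def t_def)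
  have tmu: "of_real (t j) * \<mu> \<in> ball 0 r" if "j \<le> m" for j
  proof -
    have "t j * norm \<mu> \<le> 1 * norm \<mu>" using that m by (intro mult_right_mono) (auto simp: t_def)
    moreover have "norm (of_real (t j) * \<mu>) = t j * norm \<mu>" by (simp add: norm_mult t_def norm_divide)
    ultimately show ?thesis using \<mu>(1) by simp
  qed
  have "\<exists>e>0. (\<forall>x. norm (x - \<mu>) < e \<longrightarrow> Re (H x) > Re (H \<mu>) - gap j / 2) \<and>
      (\<forall>x. norm (x - of_real (t j) * \<mu>) < e \<longrightarrow> x \<in> ball 0 r \<and> Re (H x) < Re (H (of_real (t j) * \<mu>)) + gap j / 2)"
    if j: "j \<in> {1..<m}" for j
  proof -
    have "gap j / 2 > 0" using gap[OF j] by simp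
    from near[OF \<mu>(1) this] near[OF tmu this, of j] j
    obtain e1 e2 where "e1 > 0" "e2 > 0"
      and e1: "\<And>x. norm (x - \<mu>) < e1 \<Longrightarrow> \<bar>Re (H x) - Re (H \<mu>)\<bar> < gap j / 2"
      and e2: "\<And>x. norm (x - of_real (t j) * \<mu>) < e2 \<Longrightarrow>
         x \<in> ball 0 r \<and> \<bar>Re (H x) - Re (H (of_real (t j) * \<mu>))\<bar> < gap j / 2"
      by fastforce
    show ?thesis
    proof (intro exI[of _ "min e1 e2"] conjI allI impI)
      show "min e1 e2 > 0" using \<open>e1 > 0\<close> \<open>e2 > 0\<close> by simp
      fix x assume "norm (x - \<mu>) < min e1 e2"
      then have "\<bar>Re (H x) - Re (H \<mu>)\<bar> < gap j / 2" by (intro e1) simp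
      then show "Re (H x) > Re (H \<mu>) - gap j / 2" by linarith
    next
      fix x assume *: "norm (x - of_real (t j) * \<mu>) < min e1 e2"
      then have "x \<in> ball 0 r \<and> \<bar>Re (H x) - Re (H (of_real (t j) * \<mu>))\<bar> < gap j / 2" by (intro e2) simp
      then show "x \<in> ball 0 r" "Re (H x) < Re (H (of_real (t j) * \<mu>)) + gap j / 2" by linarith+
    qed
  qed
  then obtain e where e: "\<And>j. j \<in> {1..<m} \<Longrightarrow> e j > 0"
    and e_lo: "\<And>j x. j \<in> {1..<m} \<Longrightarrow> norm (x - \<mu>) < e j \<Longrightarrow> Re (H x) > Re (H \<mu>) - gap j / 2"
    and e_hi: "\<And>j x. j \<in> {1..<m} \<Longrightarrow> norm (x - of_real (t j) * \<mu>) < e j \<Longrightarrow>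
       x \<in> ball 0 r \<and> Re (H x) < Re (H (of_real (t j) * \<mu>)) + gap j / 2"
    by metis
  obtain e0 where e0: "e0 > 0" "\<And>x. norm (x - \<mu>) < e0 \<Longrightarrow> \<bar>Re (H x) - Re (H \<mu>)\<bar> < Re (H \<mu>)"
    using near[OF \<mu>(1,2)] by blast
  define \<epsilon> where "\<epsilon> = Min (insert e0 (e ` {1..<m}))"
  have \<epsilon>: "\<epsilon> > 0" "\<epsilon> \<le> e0" "\<And>j. j \<in> {1..<m} \<Longrightarrow> \<epsilon> \<le> e j"
  proof -
    show "\<epsilon> > 0" unfolding \<epsilon>_def using e e0(1) by (subst Min_gr_iff) auto
    show "\<epsilon> \<le> e0" unfolding \<epsilon>_def by (intro Min_le) auto
    show "\<epsilon> \<le> e j" if "j \<in> {1..<m}" for j unfolding \<epsilon>_def using that by (intro Min_le) auto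
  qed
  define \<delta> where "\<delta> = min (min (\<delta>w / 2) \<delta>v) (\<epsilon> / (2 * (norm v + norm w)))"
  have vw: "norm v + norm w > 0" using v(1) by (simp add: add_pos_nonneg)
  have \<delta>: "\<delta> > 0" "\<delta> < \<delta>w" "\<delta> \<le> \<delta>v" 
  proof -
    show "\<delta> > 0" unfolding \<delta>_def using \<delta>w(1) v(2) \<epsilon>(1) vw by simp
    have "\<delta> \<le> \<delta>w / 2" unfolding \<delta>_def by (rule order_trans[OF min.cobounded1 min.cobounded1])
    then show "\<delta> < \<delta>w" using \<delta>w(1) by simp
    show "\<delta> \<le> \<delta>v" unfolding \<delta>_def by (rule order_trans[OF min.cobounded1 min.cobounded2])
  qed
  have "\<delta> \<le> \<epsilon> / (2 * (norm v + norm w))" by (simp add: \<delta>_def)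
  then have "\<delta> * (norm v + norm w) \<le> \<epsilon> / 2" using vw by (simp add: field_simps)
  then have small: "\<delta> * (norm v + norm w) < \<epsilon>" using \<epsilon>(1) by simp
  have smallv: "norm (\<mu> + of_real s * v - \<mu>) < \<epsilon>" if "s \<in> {0..\<delta>}" for s
  proof -
    have "\<bar>s\<bar> * norm v \<le> \<delta> * (norm v + norm w)" using that by (intro mult_mono) auto
    then show ?thesis using small by (simp add: norm_mult)
  qed
  have inball: "\<mu> + of_real s * v \<in> ball 0 r" if "s \<in> {0..\<delta>}" for s
    using v(3)[of s] that \<delta> by auto
  have ln\<Phi>: "ln (norm (\<Phi> (\<mu> + of_real s * v))) = Re (H (\<mu> + of_real s * v))" if "s \<in> {0..\<delta>}" for s
    using norm\<Phi>[OF inball[OF that]] by simp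
  show thesis
  proof (rule that[OF v(1) w(1) \<delta>(1)])
    fix s assume s: "s \<in> {0..\<delta>}"
    have "Re (H (\<mu> + of_real s * v)) > 0" using e0(2)[of "\<mu> + of_real s * v"] smallv[OF s] \<epsilon>(2) by simp
    then show "norm (\<Phi> (\<mu> + of_real s * v)) > 1" using norm\<Phi>[OF inball[OF s]] by simp
  next
    fix K :: "nat set" and s \<tau>
    assume K: "finite K" "card K \<le> m" and s: "\<And>k. k \<in> K \<Longrightarrow> s k \<in> {0..\<delta>}" and \<tau>: "\<tau> \<in> {0..\<delta>}"
      and K0: "K = {} \<Longrightarrow> \<tau> > 0" and Km: "card K = m \<Longrightarrow> \<tau> = 0 \<and> (\<exists>k\<in>K. \<exists>l\<in>K. s k \<noteq> s l)"
    define x where "x = (\<Sum>k\<in>K. \<mu> + of_real (s k) * v) / of_nat m + of_real \<tau> * w"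
    define j where "j = card K"
    define q where "q s = Re (H (\<mu> + of_real s * v))" for s :: real
    have rhs: "(\<Sum>k\<in>K. ln (norm (\<Phi> (\<mu> + of_real (s k) * v)))) = (\<Sum>k\<in>K. q (s k))"
      unfolding q_def by (intro sum.cong refl ln\<Phi> s)
    have sumK: "(\<Sum>k\<in>K. \<mu> + of_real (s k) * v) = of_nat j * \<mu> + of_real (\<Sum>k\<in>K. s k) * v"
      by (simp add: sum.distrib j_def sum_distrib_right)
    have "j = 0 \<or> j = m \<or> j \<in> {1..<m}"
      using K(2) unfolding j_def atLeastLessThan_iff by linarith
    then consider "j = 0" | "j = m" | "j \<in> {1..<m}" by blast
    then have "norm (\<Phi> x) < exp ((\<Sum>k\<in>K. q (s k)) / m)"
    proof cases
      case 1
      then have "K = {}" using K by (simp add: j_def)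
      then show ?thesis using \<delta>w(2)[of \<tau>] K0 \<tau> \<delta> by (simp add: x_def)
    next
      case 2
      then have \<tau>0: "\<tau> = 0" and neq: "\<exists>k\<in>K. \<exists>l\<in>K. s k \<noteq> s l" using Km by (auto simp: j_def)
      define y where "y = (\<Sum>k\<in>K. s k) / card K"
      have xy: "x = \<mu> + of_real y * v"
        unfolding x_def sumK \<tau>0 using m 2 by (simp add: y_def j_def add_divide_distrib)
      have "(\<Sum>k\<in>K. s k) \<le> card K * \<delta>" "0 \<le> (\<Sum>k\<in>K. s k)"
        using sum_bounded_above[of K s \<delta>] s by (auto intro: sum_nonneg)
      then have "y \<in> {0..\<delta>}" using m 2 by (simp add: y_def j_def pos_divide_le_eq mult.commute)
      then have nx: "norm (\<Phi> x) = exp (q y)" unfolding xy q_def by (intro norm\<Phi> inball)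
      have "q y < (\<Sum>k\<in>K. q (s k)) / card K"
        unfolding y_def
      proof (rule strict_jensen[where a = 0 and b = \<delta>v])
        show "\<exists>D. \<forall>y\<in>{0..\<delta>v}. y \<noteq> x \<longrightarrow> q x + D * (y - x) < q y" if "x \<in> {0..\<delta>v}" for x
          unfolding q_def by (rule v(4)[OF that])
        show "s k \<in> {0..\<delta>v}" if "k \<in> K" for k using s[OF that] \<delta> by auto
      qed (use K neq in auto)
      then show ?thesis using nx 2 by (simp add: j_def)
    next
      case 3
      have "norm ((\<Sum>k\<in>K. s k) / m * v + \<tau> * w) \<le> \<delta> * norm v + \<delta> * norm w"
      proof -
        have "0 \<le> (\<Sum>k\<in>K. s k)" using s by (auto intro: sum_nonneg)
        moreover have "(\<Sum>k\<in>K. s k) \<le> card K * \<delta>" using sum_bounded_above[of K s \<delta>] s by auto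
        moreover have "card K * \<delta> \<le> m * \<delta>" using K \<delta> by (intro mult_right_mono) auto
        ultimately have "\<bar>(\<Sum>k\<in>K. s k) / m\<bar> \<le> \<delta>" using m by (simp add: pos_divide_le_eq mult.commute)
        then have "norm (of_real ((\<Sum>k\<in>K. s k) / m) * v) \<le> \<delta> * norm v"
          unfolding norm_mult norm_of_real by (rule mult_right_mono) simp
        moreover have "norm (of_real \<tau> * w) \<le> \<delta> * norm w"
          unfolding norm_mult norm_of_real using \<tau> by (intro mult_right_mono) auto
        ultimately show ?thesis by (intro order_trans[OF norm_triangle_ineq] add_mono) simp_all
      qed
      moreover have "x - of_real (t j) * \<mu> = (\<Sum>k\<in>K. s k) / m * v + \<tau> * w"
        unfolding x_def sumK using m by (simp add: t_def add_divide_distrib)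
      ultimately have "norm (x - of_real (t j) * \<mu>) < e j"
        using small \<epsilon>(3)[OF 3] by (simp add: distrib_left)
      from e_hi[OF 3 this] have x: "x \<in> ball 0 r" "Re (H x) < Re (H (of_real (t j) * \<mu>)) + gap j / 2" by auto
      have "q (s k) \<ge> Re (H \<mu>) - gap j / 2" if "k \<in> K" for k
        using e_lo[OF 3, of "\<mu> + of_real (s k) * v"] smallv[OF s[OF that]] \<epsilon>(3)[OF 3] by (simp add: q_def)
      then have "(\<Sum>k\<in>K. q (s k)) \<ge> j * (Re (H \<mu>) - gap j / 2)"
        using sum_bounded_below[of K "Re (H \<mu>) - gap j / 2" "\<lambda>k. q (s k)"] by (simp add: j_def)
      then have "(\<Sum>k\<in>K. q (s k)) / m \<ge> j * (Re (H \<mu>) - gap j / 2) / m"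
        by (rule divide_right_mono) simp
      also have "j * (Re (H \<mu>) - gap j / 2) / m = t j * Re (H \<mu>) - t j * (gap j / 2)"
        by (simp add: t_def algebra_simps diff_divide_distrib)
      finally have "(\<Sum>k\<in>K. q (s k)) / m \<ge> t j * Re (H \<mu>) - t j * (gap j / 2)" .
      moreover have "t j * (gap j / 2) \<le> 1 * (gap j / 2)"
        using gap[OF 3] 3 by (intro mult_right_mono) (auto simp: t_def)
      ultimately have "(\<Sum>k\<in>K. q (s k)) / m \<ge> t j * Re (H \<mu>) - gap j / 2" by linarith
      then have "Re (H x) < (\<Sum>k\<in>K. q (s k)) / m" using x(2) gap_def[of j] by linarith
      then show ?thesis using norm\<Phi>[OF x(1)] by simp
    qed
    then show "norm (\<Phi> ((\<Sum>k\<in>K. \<mu> + of_real (s k) * v) / of_nat m + of_real \<tau> * w))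
         < exp ((\<Sum>k\<in>K. ln (norm (\<Phi> (\<mu> + of_real (s k) * v)))) / m)"
      by (simp only: x_def rhs)
  qed
qed

section \<open>Targeting a power with exponential sums\<close>

lemma geometric_exp_sum_decays:
  fixes \<theta> \<Lambda> c :: "'p \<Rightarrow> complex"
  assumes P: "finite P" and \<theta>: "\<And>p. p \<in> P \<Longrightarrow> norm (\<theta> p) < 1" and "\<epsilon> > 0"
  shows "\<forall>\<^sub>F N in sequentially. \<forall>z\<in>cball 0 R. norm (\<Sum>p\<in>P. c p * \<theta> p ^ N * exp (\<Lambda> p * z)) \<le> \<epsilon>"
proof -
  have "(\<lambda>N. \<Sum>p\<in>P. norm (c p) * norm (\<theta> p) ^ N * exp (norm (\<Lambda> p) * R)) \<longlonglongrightarrow>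
      (\<Sum>p\<in>P. norm (c p) * 0 * exp (norm (\<Lambda> p) * R))"
    by (intro tendsto_sum tendsto_mult tendsto_const LIMSEQ_realpow_zero) (use \<theta> in auto)
  then have "(\<lambda>N. \<Sum>p\<in>P. norm (c p) * norm (\<theta> p) ^ N * exp (norm (\<Lambda> p) * R)) \<longlonglongrightarrow> 0" by simp
  then have "\<forall>\<^sub>F N in sequentially. (\<Sum>p\<in>P. norm (c p) * norm (\<theta> p) ^ N * exp (norm (\<Lambda> p) * R)) < \<epsilon>"
    using \<open>\<epsilon> > 0\<close> by (rule order_tendstoD)
  then show ?thesis
  proof eventually_elim
    case (elim N)
    show ?case
    proof
      fix z :: complex assume z: "z \<in> cball 0 R"
      have "norm (\<Sum>p\<in>P. c p * \<theta> p ^ N * exp (\<Lambda> p * z)) \<le> (\<Sum>p\<in>P. norm (c p * \<theta> p ^ N * exp (\<Lambda> p * z)))"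
        by (rule norm_sum)
      also have "\<dots> \<le> (\<Sum>p\<in>P. norm (c p) * norm (\<theta> p) ^ N * exp (norm (\<Lambda> p) * R))"
      proof (rule sum_mono)
        fix p
        have "Re (\<Lambda> p * z) \<le> norm (\<Lambda> p) * norm z" using complex_Re_le_cmod[of "\<Lambda> p * z"] by (simp only: norm_mult)
        also have "\<dots> \<le> norm (\<Lambda> p) * R" using z by (intro mult_left_mono) auto
        finally have "norm (exp (\<Lambda> p * z)) \<le> exp (norm (\<Lambda> p) * R)" by (simp only: norm_exp_eq_Re exp_le_cancel_iff)
        then show "norm (c p * \<theta> p ^ N * exp (\<Lambda> p * z)) \<le> norm (c p) * norm (\<theta> p) ^ N * exp (norm (\<Lambda> p) * R)"
          unfolding norm_mult norm_power by (intro mult_left_mono) auto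
      qed
      finally show "norm (\<Sum>p\<in>P. c p * \<theta> p ^ N * exp (\<Lambda> p * z)) \<le> \<epsilon>" using elim by linarith
    qed
  qed
qed

lemma complex_root_exists:
  assumes "m > 0" obtains x :: complex where "x ^ m = y"
proof (cases "y = 0")
  case True
  then show ?thesis using assms by (intro that[of 0]) (simp add: zero_power)
next
  case False
  then show ?thesis using assms by (intro that[of "exp (Ln y / of_nat m)"]) (simp add: exp_of_nat_mult[symmetric])
qed

context exp_type_symbol
begin

text \<open>The power is expanded as a sum over all ways \<open>\<phi>\<close> of choosing one exponential from each of the \<open>n\<close>
factors; each product is again an exponential, hence an eigenvector.\<close>

lemma Tn_exp_sum_power:
  fixes x \<nu> :: "'i \<Rightarrow> complex"
  assumes I: "finite I"
  shows "(T ^^ N) (\<lambda>z. (\<Sum>i\<in>I. x i * exp (\<nu> i * z)) ^ n) =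
    (\<lambda>z. \<Sum>\<phi>\<in>{..<n} \<rightarrow>\<^sub>E I. (\<Prod>k<n. x (\<phi> k)) * \<Phi> (\<Sum>k<n. \<nu> (\<phi> k)) ^ N * exp ((\<Sum>k<n. \<nu> (\<phi> k)) * z))"
proof -
  let ?P = "{..<n} \<rightarrow>\<^sub>E I"
  have fin: "finite ?P" using I by (intro finite_PiE) auto
  have expand: "(\<Sum>i\<in>I. x i * exp (\<nu> i * z)) ^ n =
      (\<Sum>\<phi>\<in>?P. (\<Prod>k<n. x (\<phi> k)) * exp ((\<Sum>k<n. \<nu> (\<phi> k)) * z))" for z
  proof -
    have "(\<Sum>i\<in>I. x i * exp (\<nu> i * z)) ^ n = (\<Prod>k<n. \<Sum>i\<in>I. x i * exp (\<nu> i * z))" by simp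
    also have "\<dots> = (\<Sum>\<phi>\<in>?P. \<Prod>k<n. x (\<phi> k) * exp (\<nu> (\<phi> k) * z))"
      using I by (intro prod_sum_PiE) auto
    also have "\<dots> = (\<Sum>\<phi>\<in>?P. (\<Prod>k<n. x (\<phi> k)) * exp ((\<Sum>k<n. \<nu> (\<phi> k)) * z))"
      by (simp add: prod.distrib sum_distrib_right exp_sum)
    finally show ?thesis .
  qed
  have "entire (\<lambda>z. exp (w * z))" for w :: complex by (intro holomorphic_intros)
  then show ?thesis
    unfolding expand by (subst Tn_lincomb[OF fin]) (auto simp: Tn_exp mult.assoc)
qed

text \<open>With \<open>\<kappa>\<close> and \<open>\<rho>\<close> chosen so that \<open>\<kappa>\<^sub>j ^ m = \<beta>\<^sub>j\<close> and \<open>\<rho>\<^sub>j ^ m = 1 / \<Phi> \<mu>\<^sub>j\<close>, a choice \<open>\<phi>\<close> of \<open>n\<close>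
exponentials contributes to \<open>(T ^^ N) (u ^ n)\<close> a fixed exponential times \<open>\<theta> ^ N\<close>, where \<open>\<theta>\<close> is the
product of the \<open>\<rho>\<close>'s and of \<open>\<Phi>\<close> at the total frequency. If \<open>n = m\<close> and \<open>\<phi>\<close> is constant on the
segment, then \<open>\<theta> = 1\<close> and the contribution is exactly \<open>\<beta>\<^sub>j exp (\<mu>\<^sub>j z)\<close>. In all other cases
\<open>convex_configuration\<close> says that \<open>norm \<theta> < 1\<close>.\<close>

lemma power_targeting:
  assumes \<Phi>0: "\<Phi> 0 = 1" and nonexp: "\<And>c. \<exists>z. \<Phi> z \<noteq> exp (c * z)" and m: "m > 0"
    and f: "entire f" and g: "entire g" and \<epsilon>: "\<epsilon> > 0"
  shows "\<exists>u N. entire u \<and> (\<forall>z\<in>cball 0 R. norm (u z - f z) \<le> \<epsilon>) \<and>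
    (\<forall>z\<in>cball 0 R. norm ((T ^^ N) (\<lambda>z. u z ^ m) z - g z) \<le> \<epsilon>) \<and>
    (\<forall>n\<in>{1..<m}. \<forall>z\<in>cball 0 R. norm ((T ^^ N) (\<lambda>z. u z ^ n) z) \<le> \<epsilon>)"
proof -
  obtain \<mu> v w :: complex and \<delta> :: real where vw: "v \<noteq> 0" "w \<noteq> 0" and \<delta>: "\<delta> > 0"
    and big: "\<And>s. s \<in> {0..\<delta>} \<Longrightarrow> norm (\<Phi> (\<mu> + of_real s * v)) > 1"
    and config: "\<And>(K::nat set) s t. finite K \<Longrightarrow> card K \<le> m \<Longrightarrow> (\<And>k. k \<in> K \<Longrightarrow> s k \<in> {0..\<delta>}) \<Longrightarrow> t \<in> {0..\<delta>} \<Longrightarrow>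
       (K = {} \<Longrightarrow> t > 0) \<Longrightarrow> (card K = m \<Longrightarrow> t = 0 \<and> (\<exists>k\<in>K. \<exists>l\<in>K. s k \<noteq> s l)) \<Longrightarrow>
       norm (\<Phi> ((\<Sum>k\<in>K. \<mu> + of_real (s k) * v) / of_nat m + of_real t * w))
         < exp ((\<Sum>k\<in>K. ln (norm (\<Phi> (\<mu> + of_real (s k) * v)))) / m)"
    by (rule convex_configuration[OF entire_symbol \<Phi>0 nonexp m]) blast
  \<comment> \<open>The parameters on the ray lie in the interval from \<open>\<delta>'\<close> to \<open>2 * \<delta>'\<close>, so that even \<open>m\<close> of them add up
    to a positive number of size at most \<open>\<delta>\<close>.\<close>
  define \<delta>' where "\<delta>' = \<delta> / (2 * real m)"
  have \<delta>': "\<delta>' > 0" using \<delta> m by (simp add: \<delta>'_def)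
  obtain dL hL \<alpha> where hL: "hL > 0" "real dL * hL < \<delta>'"
    and \<alpha>: "\<And>z. z \<in> cball 0 R \<Longrightarrow>
       norm ((\<Sum>l\<le>dL. \<alpha> l * exp ((of_real \<delta>' * w + of_real (real l * hL) * w) * z)) - f z) \<le> \<epsilon>/2"
    by (rule exp_sums_dense[OF f vw(2) \<delta>', of "\<epsilon>/2" R "of_real \<delta>' * w"]) (use \<epsilon> in auto)
  obtain dJ hJ \<beta> where hJ: "hJ > 0" "real dJ * hJ < \<delta>"
    and \<beta>: "\<And>z. z \<in> cball 0 R \<Longrightarrow>
       norm ((\<Sum>j\<le>dJ. \<beta> j * exp ((\<mu> + of_real (real j * hJ) * v) * z)) - g z) \<le> \<epsilon>/2"
    by (rule exp_sums_dense[OF g vw(1) \<delta>, of "\<epsilon>/2" R \<mu>]) (use \<epsilon> in auto)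
  define \<mu>' where "\<mu>' j = \<mu> + of_real (real j * hJ) * v" for j
  have sJ: "real j * hJ \<in> {0..\<delta>}" if "j \<le> dJ" for j
  proof -
    have "real j * hJ \<le> real dJ * hJ" using that hJ by (intro mult_right_mono) auto
    moreover have "0 \<le> real j * hJ" using hJ by simp
    ultimately show ?thesis using hJ(2) unfolding atLeastAtMost_iff by linarith
  qed
  have big': "norm (\<Phi> (\<mu>' j)) > 1" if "j \<le> dJ" for j unfolding \<mu>'_def by (rule big[OF sJ[OF that]])
  define tL where "tL l = \<delta>' + real l * hL" for l
  have tL: "0 < tL l" "tL l \<le> \<delta> / m" if "l \<le> dL" for l
  proof -
    have "real l * hL \<le> real dL * hL" using that hL by (intro mult_right_mono) auto
    then have "tL l \<le> 2 * \<delta>'" using hL(2) unfolding tL_def by linarith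
    then show "tL l \<le> \<delta> / m" by (simp add: \<delta>'_def)
    show "0 < tL l" using \<delta>' hL by (simp add: tL_def add_pos_nonneg)
  qed
  have "\<exists>x. x ^ m = \<beta> j" for j using complex_root_exists[OF m, of "\<beta> j"] by blast
  then obtain \<kappa>J where \<kappa>J: "\<And>j. \<kappa>J j ^ m = \<beta> j" by metis
  have "\<exists>x. x ^ m = inverse (\<Phi> (\<mu>' j))" for j using complex_root_exists[OF m, of "inverse (\<Phi> (\<mu>' j))"] by blast
  then obtain \<rho>J where \<rho>J: "\<And>j. \<rho>J j ^ m = inverse (\<Phi> (\<mu>' j))" by metis
  have norm_\<rho>J: "norm (\<rho>J j) = exp (- ln (norm (\<Phi> (\<mu>' j))) / m)" if "j \<le> dJ" for j
  proof (rule power_eq_imp_eq_base[of _ m])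
    have "norm (\<rho>J j) ^ m = inverse (norm (\<Phi> (\<mu>' j)))"
      by (simp add: norm_power[symmetric] \<rho>J norm_inverse)
    also have "0 < norm (\<Phi> (\<mu>' j))" using big'[OF that] by linarith
    then have "inverse (norm (\<Phi> (\<mu>' j))) = exp (- ln (norm (\<Phi> (\<mu>' j))))" by (simp only: exp_minus exp_ln)
    also have "\<dots> = exp (- ln (norm (\<Phi> (\<mu>' j))) / m) ^ m" using m by (simp add: exp_of_nat_mult[symmetric])
    finally show "norm (\<rho>J j) ^ m = exp (- ln (norm (\<Phi> (\<mu>' j))) / m) ^ m" .
  qed (use m in auto)
  define I where "I = {..dL} <+> {..dJ}"
  have I: "finite I" by (simp add: I_def)
  define \<nu> :: "nat + nat \<Rightarrow> complex" where "\<nu> = case_sum (\<lambda>l. of_real (tL l) * w) (\<lambda>j. \<mu>' j / of_nat m)"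
  define \<kappa> :: "nat + nat \<Rightarrow> complex" where "\<kappa> = case_sum \<alpha> \<kappa>J"
  define \<rho> :: "nat + nat \<Rightarrow> complex" where "\<rho> = case_sum (\<lambda>_. 1) \<rho>J"
  define u where "u N z = (\<Sum>i\<in>I. (\<kappa> i * \<rho> i ^ N) * exp (\<nu> i * z))" for N z
  define \<Lambda> where "\<Lambda> n \<phi> = (\<Sum>k<n. \<nu> (\<phi> k))" for n and \<phi> :: "nat \<Rightarrow> nat + nat"
  define \<theta> where "\<theta> n \<phi> = (\<Prod>k<n. \<rho> (\<phi> k)) * \<Phi> (\<Lambda> n \<phi>)" for n and \<phi> :: "nat \<Rightarrow> nat + nat"
  define c where "c n \<phi> = (\<Prod>k<n. \<kappa> (\<phi> k))" for n and \<phi> :: "nat \<Rightarrow> nat + nat"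
  \<comment> \<open>Left summands index the ray, right summands the segment. The functions \<open>diag j\<close> are the choices that
    produce a pure \<open>m\<close>-th power of one exponential of the segment.\<close>
  define diag :: "nat \<Rightarrow> nat \<Rightarrow> nat + nat" where "diag j = (\<lambda>k\<in>{..<m}. Inr j)" for j
  have Tn_u: "(T ^^ N) (\<lambda>z. u N z ^ n) z = (\<Sum>\<phi>\<in>{..<n} \<rightarrow>\<^sub>E I. c n \<phi> * \<theta> n \<phi> ^ N * exp (\<Lambda> n \<phi> * z))" for N n z
    unfolding u_def Tn_exp_sum_power[OF I] c_def \<theta>_def \<Lambda>_def
    by (intro sum.cong refl) (simp add: prod.distrib prod_power_distrib power_mult_distrib mult_ac)
  have \<theta>_small: "norm (\<theta> n \<phi>) < 1"
    if n: "1 \<le> n" "n \<le> m" and \<phi>: "\<phi> \<in> {..<n} \<rightarrow>\<^sub>E I" and off: "n = m \<Longrightarrow> \<phi> \<notin> diag ` {..dJ}" for n \<phi>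
  proof -
    define K where "K = {k\<in>{..<n}. \<exists>j. \<phi> k = Inr j}"
    define L where "L = {..<n} - K"
    have fin: "finite K" "finite L" by (auto simp: K_def L_def)
    have split: "{..<n} = K \<union> L" "K \<inter> L = {}" by (auto simp: K_def L_def)
    have "card K \<le> card {..<n}" by (rule card_mono) (auto simp: K_def)
    then have cardK: "card K \<le> n" by simp
    have \<phi>I: "\<phi> k \<in> I" if "k < n" for k using \<phi> that by auto
    define jj where "jj k = projr (\<phi> k)" for k
    have K: "\<phi> k = Inr (jj k)" "jj k \<le> dJ" if "k \<in> K" for k
      using that \<phi>I[of k] by (auto simp: K_def jj_def I_def)
    define ll where "ll k = projl (\<phi> k)" for k
    have L: "\<phi> k = Inl (ll k)" "ll k \<le> dL" if "k \<in> L" for k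
      using that \<phi>I[of k] by (auto simp: K_def L_def ll_def I_def)
    define t where "t = (\<Sum>k\<in>L. tL (ll k))"
    have t: "t \<in> {0..\<delta>}"
    proof -
      have "0 \<le> t" unfolding t_def by (intro sum_nonneg less_imp_le tL(1) L(2))
      moreover have "t \<le> card L * (\<delta> / m)" unfolding t_def by (intro sum_bounded_above tL(2) L(2))
      moreover have "card L \<le> card {..<n}" by (rule card_mono) (auto simp: L_def)
      then have "card L * (\<delta> / m) \<le> m * (\<delta> / m)" using n \<delta> by (intro mult_right_mono) auto
      ultimately show ?thesis using m by simp
    qed
    define s where "s k = real (jj k) * hJ" for k
    have \<Lambda>_split: "\<Lambda> n \<phi> = (\<Sum>k\<in>K. \<mu> + of_real (s k) * v) / of_nat m + of_real t * w"
    proof -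
      have "\<Lambda> n \<phi> = (\<Sum>k\<in>K. \<nu> (\<phi> k)) + (\<Sum>k\<in>L. \<nu> (\<phi> k))"
        unfolding \<Lambda>_def split(1) by (rule sum.union_disjoint[OF fin split(2)])
      also have "(\<Sum>k\<in>K. \<nu> (\<phi> k)) = (\<Sum>k\<in>K. (\<mu> + of_real (s k) * v) / of_nat m)"
        by (intro sum.cong refl) (simp add: K(1) \<nu>_def \<mu>'_def s_def)
      also have "(\<Sum>k\<in>L. \<nu> (\<phi> k)) = (\<Sum>k\<in>L. of_real (tL (ll k)) * w)"
        by (intro sum.cong refl) (simp add: L(1) \<nu>_def)
      finally show ?thesis by (simp add: sum_divide_distrib t_def sum_distrib_right)
    qed
    have "norm (\<Prod>k<n. \<rho> (\<phi> k)) = norm (\<Prod>k\<in>K. \<rho> (\<phi> k)) * norm (\<Prod>k\<in>L. \<rho> (\<phi> k))"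
      unfolding split(1) prod.union_disjoint[OF fin split(2)] by (rule norm_mult)
    also have "(\<Prod>k\<in>L. \<rho> (\<phi> k)) = (\<Prod>k\<in>L. 1)" by (intro prod.cong refl) (simp add: L(1) \<rho>_def)
    also have "norm (\<Prod>k\<in>K. \<rho> (\<phi> k)) = (\<Prod>k\<in>K. exp (- ln (norm (\<Phi> (\<mu> + of_real (s k) * v))) / m))"
      unfolding prod_norm[symmetric]
      by (intro prod.cong refl) (simp add: K \<rho>_def norm_\<rho>J s_def \<mu>'_def)
    also have "\<dots> = exp (- ((\<Sum>k\<in>K. ln (norm (\<Phi> (\<mu> + of_real (s k) * v)))) / m))"
      by (simp add: exp_sum[OF fin(1), symmetric] sum_negf sum_divide_distrib)
    finally have norm_prod: "norm (\<Prod>k<n. \<rho> (\<phi> k)) = exp (- ((\<Sum>k\<in>K. ln (norm (\<Phi> (\<mu> + of_real (s k) * v)))) / m))"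
      by simp
    have "norm (\<Phi> (\<Lambda> n \<phi>)) < exp ((\<Sum>k\<in>K. ln (norm (\<Phi> (\<mu> + of_real (s k) * v)))) / m)"
      unfolding \<Lambda>_split
    proof (rule config[OF fin(1) _ _ t])
      show "card K \<le> m" using cardK n by simp
      show "s k \<in> {0..\<delta>}" if "k \<in> K" for k unfolding s_def by (rule sJ[OF K(2)[OF that]])
      show "t > 0" if "K = {}"
      proof -
        have "0 \<in> L" using that n(1) by (simp add: L_def)
        then have "L \<noteq> {}" by blast
        then show ?thesis unfolding t_def by (intro sum_pos fin tL(1) L(2))
      qed
      assume cK: "card K = m"
      then have nm: "n = m" using cardK n by simp
      have "K = {..<n}" using cK nm by (intro card_subset_eq) (auto simp: K_def)
      then have L0: "L = {}" by (simp add: L_def)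
      have inK: "k \<in> K" if "k < m" for k unfolding \<open>K = {..<n}\<close> nm using that by simp
      have "\<exists>k\<in>K. \<exists>l\<in>K. s k \<noteq> s l"
      proof (rule ccontr)
        assume "\<not> ?thesis"
        then have eq: "s k = s l" if "k \<in> K" "l \<in> K" for k l using that by blast
        have "jj k = jj 0" if "k < m" for k
          using eq[OF inK[OF that] inK[OF m]] hJ(1) by (simp add: s_def)
        then have "\<phi> k = diag (jj 0) k" if "k < m" for k
          using K(1)[OF inK[OF that]] that by (metis diag_def lessThan_iff restrict_apply')
        moreover have "\<phi> k = diag (jj 0) k" if "\<not> k < m" for k
          using PiE_arb[OF \<phi>, of k] that nm by (simp add: diag_def)
        ultimately have "\<phi> k = diag (jj 0) k" for k by blast
        then have "\<phi> = diag (jj 0)" by (rule ext)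
        moreover have "jj 0 \<le> dJ" by (rule K(2)[OF inK[OF m]])
        ultimately show False using off[OF nm] by blast
      qed
      then show "t = 0 \<and> (\<exists>k\<in>K. \<exists>l\<in>K. s k \<noteq> s l)" using L0 by (simp add: t_def)
    qed
    then have "norm (\<theta> n \<phi>) < exp (- ((\<Sum>k\<in>K. ln (norm (\<Phi> (\<mu> + of_real (s k) * v)))) / m))
        * exp ((\<Sum>k\<in>K. ln (norm (\<Phi> (\<mu> + of_real (s k) * v)))) / m)"
      unfolding \<theta>_def norm_mult norm_prod by (intro mult_strict_left_mono) auto
    then show ?thesis by (simp add: exp_add[symmetric])
  qed
  have fin: "finite ({..<n} \<rightarrow>\<^sub>E I)" for n :: nat using I by (intro finite_PiE) auto
  have "\<forall>\<^sub>F N in sequentially. \<forall>z\<in>cball 0 R. norm (\<Sum>j\<le>dJ. \<kappa>J j * \<rho>J j ^ N * exp (\<mu>' j / of_nat m * z)) \<le> \<epsilon>/2"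
  proof (rule geometric_exp_sum_decays)
    fix j assume "j \<in> {..dJ}"
    then have "norm (\<rho>J j) = exp (- ln (norm (\<Phi> (\<mu>' j))) / m)" "ln (norm (\<Phi> (\<mu>' j))) > 0"
      using norm_\<rho>J[of j] ln_gt_zero[OF big'[of j]] by simp_all
    then show "norm (\<rho>J j) < 1" using m by (simp only: exp_less_one_iff) (simp add: divide_neg_pos)
  qed (use \<epsilon> in auto)
  moreover have "\<forall>\<^sub>F N in sequentially. \<forall>z\<in>cball 0 R.
      norm (\<Sum>\<phi>\<in>({..<m} \<rightarrow>\<^sub>E I) - diag ` {..dJ}. c m \<phi> * \<theta> m \<phi> ^ N * exp (\<Lambda> m \<phi> * z)) \<le> \<epsilon>/2"
    by (rule geometric_exp_sum_decays) (use \<epsilon> m fin \<theta>_small in auto)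
  moreover have "\<forall>\<^sub>F N in sequentially. \<forall>n\<in>{1..<m}. \<forall>z\<in>cball 0 R.
      norm (\<Sum>\<phi>\<in>{..<n} \<rightarrow>\<^sub>E I. c n \<phi> * \<theta> n \<phi> ^ N * exp (\<Lambda> n \<phi> * z)) \<le> \<epsilon>"
    by (intro eventually_ball_finite ballI geometric_exp_sum_decays) (use \<epsilon> fin \<theta>_small in auto)
  ultimately have "\<forall>\<^sub>F N in sequentially. (\<forall>z\<in>cball 0 R. norm (\<Sum>j\<le>dJ. \<kappa>J j * \<rho>J j ^ N * exp (\<mu>' j / of_nat m * z)) \<le> \<epsilon>/2) \<and>
     (\<forall>z\<in>cball 0 R. norm (\<Sum>\<phi>\<in>({..<m} \<rightarrow>\<^sub>E I) - diag ` {..dJ}. c m \<phi> * \<theta> m \<phi> ^ N * exp (\<Lambda> m \<phi> * z)) \<le> \<epsilon>/2) \<and>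
     (\<forall>n\<in>{1..<m}. \<forall>z\<in>cball 0 R. norm (\<Sum>\<phi>\<in>{..<n} \<rightarrow>\<^sub>E I. c n \<phi> * \<theta> n \<phi> ^ N * exp (\<Lambda> n \<phi> * z)) \<le> \<epsilon>)"
    by (intro eventually_conj)
  from eventually_happens'[OF sequentially_bot this] obtain N where
    N1: "\<And>z. z \<in> cball 0 R \<Longrightarrow> norm (\<Sum>j\<le>dJ. \<kappa>J j * \<rho>J j ^ N * exp (\<mu>' j / of_nat m * z)) \<le> \<epsilon>/2" and
    N2: "\<And>z. z \<in> cball 0 R \<Longrightarrow> norm (\<Sum>\<phi>\<in>({..<m} \<rightarrow>\<^sub>E I) - diag ` {..dJ}. c m \<phi> * \<theta> m \<phi> ^ N * exp (\<Lambda> m \<phi> * z)) \<le> \<epsilon>/2" and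
    N3: "\<And>n z. n \<in> {1..<m} \<Longrightarrow> z \<in> cball 0 R \<Longrightarrow> norm (\<Sum>\<phi>\<in>{..<n} \<rightarrow>\<^sub>E I. c n \<phi> * \<theta> n \<phi> ^ N * exp (\<Lambda> n \<phi> * z)) \<le> \<epsilon>"
    by blast
  show ?thesis
  proof (intro exI[of _ "u N"] exI[of _ N] conjI ballI)
    show "entire (u N)" unfolding u_def
      by (intro holomorphic_on_sum holomorphic_on_mult holomorphic_on_const holomorphic_on_exp
          holomorphic_on_ident holomorphic_on_compose[of _ _ exp, unfolded o_def])
  next
    fix z :: complex assume z: "z \<in> cball 0 R"
    have "u N z = (\<Sum>l\<le>dL. \<alpha> l * exp ((of_real \<delta>' * w + of_real (real l * hL) * w) * z))
        + (\<Sum>j\<le>dJ. \<kappa>J j * \<rho>J j ^ N * exp (\<mu>' j / of_nat m * z))"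
      unfolding u_def I_def by (subst sum.Plus) (auto simp: \<kappa>_def \<rho>_def \<nu>_def tL_def distrib_right)
    then have "norm (u N z - f z) = norm (((\<Sum>l\<le>dL. \<alpha> l * exp ((of_real \<delta>' * w + of_real (real l * hL) * w) * z)) - f z)
        + (\<Sum>j\<le>dJ. \<kappa>J j * \<rho>J j ^ N * exp (\<mu>' j / of_nat m * z)))" by (simp add: algebra_simps)
    also have "\<dots> \<le> \<epsilon>/2 + \<epsilon>/2"
      by (intro order_trans[OF norm_triangle_ineq] add_mono \<alpha> N1 z)
    finally show "norm (u N z - f z) \<le> \<epsilon>" by simp
  next
    fix z :: complex assume z: "z \<in> cball 0 R"
    have sub: "diag ` {..dJ} \<subseteq> {..<m} \<rightarrow>\<^sub>E I" 
    proof (rule image_subsetI)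
      fix j assume "j \<in> {..dJ}"
      then show "diag j \<in> {..<m} \<rightarrow>\<^sub>E I" unfolding diag_def restrict_PiE_iff I_def by auto
    qed
    have "diag j 0 = Inr j" for j using m by (simp add: diag_def)
    then have inj: "inj_on diag {..dJ}" by (metis inj_onI sum.inject(2))
    have diag_term: "c m (diag j) * \<theta> m (diag j) ^ N * exp (\<Lambda> m (diag j) * z) = \<beta> j * exp (\<mu>' j * z)"
      if "j \<le> dJ" for j
    proof -
      have "c m (diag j) = \<beta> j" by (simp add: c_def diag_def \<kappa>_def \<kappa>J)
      moreover have \<Lambda>: "\<Lambda> m (diag j) = \<mu>' j" using m by (simp add: \<Lambda>_def diag_def \<nu>_def)
      moreover have "\<Phi> (\<mu>' j) \<noteq> 0" using big'[OF that] by auto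
      then have "\<theta> m (diag j) = 1" unfolding \<theta>_def \<Lambda> by (simp add: diag_def \<rho>_def \<rho>J)
      ultimately show ?thesis by simp
    qed
    have "(T ^^ N) (\<lambda>z. u N z ^ m) z = (\<Sum>\<phi>\<in>({..<m} \<rightarrow>\<^sub>E I) - diag ` {..dJ}. c m \<phi> * \<theta> m \<phi> ^ N * exp (\<Lambda> m \<phi> * z))
        + (\<Sum>\<phi>\<in>diag ` {..dJ}. c m \<phi> * \<theta> m \<phi> ^ N * exp (\<Lambda> m \<phi> * z))"
      unfolding Tn_u by (rule sum.subset_diff[OF sub fin])
    also have "(\<Sum>\<phi>\<in>diag ` {..dJ}. c m \<phi> * \<theta> m \<phi> ^ N * exp (\<Lambda> m \<phi> * z)) = (\<Sum>j\<le>dJ. \<beta> j * exp (\<mu>' j * z))"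
      by (subst sum.reindex[OF inj]) (auto intro!: sum.cong simp: diag_term)
    finally have "norm ((T ^^ N) (\<lambda>z. u N z ^ m) z - g z) =
       norm ((\<Sum>\<phi>\<in>({..<m} \<rightarrow>\<^sub>E I) - diag ` {..dJ}. c m \<phi> * \<theta> m \<phi> ^ N * exp (\<Lambda> m \<phi> * z)) +
         ((\<Sum>j\<le>dJ. \<beta> j * exp (\<mu>' j * z)) - g z))" by (simp add: add_diff_eq)
    also have "\<dots> \<le> \<epsilon>/2 + \<epsilon>/2"
      by (intro order_trans[OF norm_triangle_ineq] add_mono N2 z \<beta>[folded \<mu>'_def])
    finally show "norm ((T ^^ N) (\<lambda>z. u N z ^ m) z - g z) \<le> \<epsilon>" by simp
  next
    fix n and z :: complex assume "n \<in> {1..<m}" "z \<in> cball 0 R"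
    then show "norm ((T ^^ N) (\<lambda>z. u N z ^ n) z) \<le> \<epsilon>" unfolding Tn_u by (rule N3)
  qed
qed

end

section \<open>Construction of the algebra\<close>

context exp_type_symbol
begin

lemma entire_poly_comp: "entire f \<Longrightarrow> entire (\<lambda>z. poly P (f z))"
  unfolding poly_altdef by (intro holomorphic_on_sum holomorphic_on_mult holomorphic_on_const holomorphic_on_power)

text \<open>A countable family of conditions on \<open>f\<close>, one for each power, each target in a countable dense set, and
each precision, is satisfied simultaneously by \<open>entire_baire\<close>.\<close>

lemma common_power_targeting_vector:
  assumes \<Phi>0: "\<Phi> 0 = 1" and nonexp: "\<And>c. \<exists>z. \<Phi> z \<noteq> exp (c * z)"
  obtains f where "entire f"
    "\<And>m g R \<epsilon>. m > 0 \<Longrightarrow> entire g \<Longrightarrow> \<epsilon> > 0 \<Longrightarrow> \<exists>N. \<forall>z\<in>cball 0 R.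
       norm ((T ^^ N) (\<lambda>z. f z ^ m) z - g z) \<le> \<epsilon> \<and> (\<forall>n\<in>{1..<m}. norm ((T ^^ N) (\<lambda>z. f z ^ n) z) \<le> \<epsilon>)"
proof -
  obtain G :: "nat \<Rightarrow> complex \<Rightarrow> complex" where G: "\<And>j. entire (G j)"
    and G_dense: "\<And>f R \<epsilon>. entire f \<Longrightarrow> \<epsilon> > 0 \<Longrightarrow> \<exists>j. \<forall>z\<in>cball 0 R. norm (G j z - f z) \<le> \<epsilon>"
    using countable_dense_entire by metis
  \<comment> \<open>The successors exclude the power 0 and make the precision well defined.\<close>
  define S where "S = (\<lambda>(m, j, r). {f. \<exists>N. \<forall>z\<in>cball 0 (real r).
      norm ((T ^^ N) (\<lambda>z. f z ^ Suc m) z - G j z) \<le> 1 / Suc r \<and>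
      (\<forall>n\<in>{1..<Suc m}. norm ((T ^^ N) (\<lambda>z. f z ^ n) z) \<le> 1 / Suc r)})"
  have dense: "\<exists>u R' \<delta>. entire u \<and> (\<forall>z\<in>cball 0 R. norm (u z - f z) \<le> \<epsilon>) \<and> \<delta> > 0 \<and>
      (\<forall>v. entire v \<longrightarrow> (\<forall>z\<in>cball 0 R'. norm (v z - u z) \<le> \<delta>) \<longrightarrow> v \<in> S (from_nat k))"
    if f: "entire f" and \<epsilon>: "\<epsilon> > 0" for k f R and \<epsilon> :: real
  proof -
    obtain m j r :: nat where k: "from_nat k = (m, j, r)" by (metis prod_cases3)
    define e2 where "e2 = 1 / (2 * real (Suc r))"
    have e2: "e2 > 0" "1 / real (Suc r) = e2 + e2" by (simp_all add: e2_def field_simps)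
    define \<epsilon>' where "\<epsilon>' = min \<epsilon> (e2)"
    have \<epsilon>': "\<epsilon>' > 0" using \<epsilon> e2(1) by (simp add: \<epsilon>'_def)
    have \<epsilon>'_le: "\<epsilon>' \<le> \<epsilon>" "\<epsilon>' \<le> e2" unfolding \<epsilon>'_def by (rule min.cobounded1 min.cobounded2)+
    obtain u N where u: "entire u" "\<And>z. z \<in> cball 0 (max R r) \<Longrightarrow> norm (u z - f z) \<le> \<epsilon>'"
      "\<And>z. z \<in> cball 0 (max R r) \<Longrightarrow> norm ((T ^^ N) (\<lambda>z. u z ^ Suc m) z - G j z) \<le> \<epsilon>'"
      "\<And>n z. n \<in> {1..<Suc m} \<Longrightarrow> z \<in> cball 0 (max R r) \<Longrightarrow> norm ((T ^^ N) (\<lambda>z. u z ^ n) z) \<le> \<epsilon>'"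
      using power_targeting[OF \<Phi>0 nonexp zero_less_Suc[of m] f G[of j] \<epsilon>', of "max R r"] by blast
    obtain R' \<delta> where R'\<delta>: "\<delta> > 0"
      "\<And>v z n. entire v \<Longrightarrow> n \<le> Suc m \<Longrightarrow> \<forall>w\<in>cball 0 R'. norm (v w - u w) \<le> \<delta> \<Longrightarrow> z \<in> cball 0 (real r) \<Longrightarrow>
       norm ((T ^^ N) (\<lambda>z. v z ^ n) z - (T ^^ N) (\<lambda>z. u z ^ n) z) \<le> e2"
      by (rule Tn_power_continuous[OF u(1) e2(1), of "Suc m" "real r" N]) blast
    have "v \<in> S (m, j, r)" if v: "entire v" "\<forall>z\<in>cball 0 R'. norm (v z - u z) \<le> \<delta>" for v
    proof -
      have "norm ((T ^^ N) (\<lambda>z. v z ^ Suc m) z - G j z) \<le> 1 / Suc r" if z: "z \<in> cball 0 (real r)" for z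
      proof -
        have "norm ((T ^^ N) (\<lambda>z. v z ^ Suc m) z - G j z) \<le>
          norm ((T ^^ N) (\<lambda>z. v z ^ Suc m) z - (T ^^ N) (\<lambda>z. u z ^ Suc m) z) + norm ((T ^^ N) (\<lambda>z. u z ^ Suc m) z - G j z)"
          by norm
        moreover have "z \<in> cball 0 (max R r)" using z by auto
        note u(3)[OF this]
        ultimately show ?thesis
          using R'\<delta>(2)[OF v(1) order_refl v(2) z] \<epsilon>'_le(2) e2(2) by linarith
      qed
      moreover have "norm ((T ^^ N) (\<lambda>z. v z ^ n) z) \<le> 1 / Suc r"
        if z: "z \<in> cball 0 (real r)" and n: "n \<in> {1..<Suc m}" for z n
      proof -
        have "norm ((T ^^ N) (\<lambda>z. v z ^ n) z) \<le>
          norm ((T ^^ N) (\<lambda>z. v z ^ n) z - (T ^^ N) (\<lambda>z. u z ^ n) z) + norm ((T ^^ N) (\<lambda>z. u z ^ n) z)"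
          by norm
        moreover have "z \<in> cball 0 (max R r)" using z by auto
        note u(4)[OF n this]
        moreover have "n \<le> Suc m" using n by simp
        note R'\<delta>(2)[OF v(1) this v(2) z]
        ultimately show ?thesis
          using \<epsilon>'_le(2) e2(2) by linarith
      qed
      ultimately show ?thesis unfolding S_def by blast
    qed
    moreover have "norm (u z - f z) \<le> \<epsilon>" if "z \<in> cball 0 R" for z
    proof -
      have "z \<in> cball 0 (max R r)" using that by auto
      from u(2)[OF this] show ?thesis using \<epsilon>'_le(1) by linarith
    qed
    ultimately show ?thesis unfolding k using u(1) R'\<delta>(1) by metis
  qed
  have "\<exists>f. entire f \<and> (\<forall>k::nat. f \<in> S (from_nat k))"
  proof (rule entire_baire[of "\<lambda>k. S (from_nat k)", OF dense])
    fix f assume "entire f" "\<And>k. f \<in> S (from_nat k)"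
    then show ?thesis by (intro exI[of _ f] conjI allI)
  qed
  then obtain f where f: "entire f" and fS: "\<And>k::nat. f \<in> S (from_nat k)" by auto
  show thesis
  proof (rule that[OF f])
    fix m :: nat and g and R \<epsilon> :: real assume m: "m > 0" and g: "entire g" and \<epsilon>: "\<epsilon> > 0"
    obtain j where j: "\<forall>z\<in>cball 0 R. norm (G j z - g z) \<le> \<epsilon>/2" using G_dense[OF g, of "\<epsilon>/2" R] \<epsilon> by auto
    obtain r1 :: nat where r1: "R \<le> real r1" using real_arch_simple by blast
    obtain r2 :: nat where r2: "1 / Suc r2 < \<epsilon>/2" using \<epsilon> nat_approx_posE[of "\<epsilon>/2"] by auto
    define r where "r = max r1 r2"
    have r: "R \<le> real r" "1 / Suc r \<le> \<epsilon>/2"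
    proof -
      show "R \<le> real r" using r1 by (simp add: r_def)
      have "1 / Suc r \<le> 1 / Suc r2" unfolding r_def by (intro divide_left_mono) auto
      then show "1 / Suc r \<le> \<epsilon>/2" using r2 by linarith
    qed
    obtain m' where m': "m = Suc m'" using m gr0_implies_Suc by blast
    have "f \<in> S (m', j, r)" using fS[of "to_nat (m', j, r)"] by simp
    then obtain N where N: "\<And>z. z \<in> cball 0 (real r) \<Longrightarrow>
      norm ((T ^^ N) (\<lambda>z. f z ^ m) z - G j z) \<le> 1 / Suc r \<and>
      (\<forall>n\<in>{1..<m}. norm ((T ^^ N) (\<lambda>z. f z ^ n) z) \<le> 1 / Suc r)"
      unfolding S_def m' by blast
    have "norm ((T ^^ N) (\<lambda>z. f z ^ m) z - g z) \<le> \<epsilon> \<and> (\<forall>n\<in>{1..<m}. norm ((T ^^ N) (\<lambda>z. f z ^ n) z) \<le> \<epsilon>)"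
      if z: "z \<in> cball 0 R" for z
    proof -
      have zr: "z \<in> cball 0 (real r)" using z r(1) by auto
      have "norm ((T ^^ N) (\<lambda>z. f z ^ m) z - g z) \<le>
        norm ((T ^^ N) (\<lambda>z. f z ^ m) z - G j z) + norm (G j z - g z)" by norm
      moreover have "norm (G j z - g z) \<le> \<epsilon>/2" using j z by blast
      ultimately have "norm ((T ^^ N) (\<lambda>z. f z ^ m) z - g z) \<le> \<epsilon>" using N[OF zr] r(2) by linarith
      moreover have "norm ((T ^^ N) (\<lambda>z. f z ^ n) z) \<le> \<epsilon>" if n: "n \<in> {1..<m}" for n
      proof -
        have "norm ((T ^^ N) (\<lambda>z. f z ^ n) z) \<le> 1 / Suc r" using N[OF zr] n by blast
        then show ?thesis using r(2) \<epsilon> by linarith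
      qed
      ultimately show ?thesis by blast
    qed
    then show "\<exists>N. \<forall>z\<in>cball 0 R. norm ((T ^^ N) (\<lambda>z. f z ^ m) z - g z) \<le> \<epsilon> \<and>
        (\<forall>n\<in>{1..<m}. norm ((T ^^ N) (\<lambda>z. f z ^ n) z) \<le> \<epsilon>)" by blast
  qed
qed

text \<open>Use the targeting property for the degree \<open>m\<close> of \<open>P\<close> and the target divided by the leading
coefficient. The terms of degree between 1 and \<open>m - 1\<close> become small.\<close>

lemma polynomial_in_targeting_vector_hypercyclic:
  assumes f: "entire f" and target: "\<And>m g R \<epsilon>. m > 0 \<Longrightarrow> entire g \<Longrightarrow> \<epsilon> > 0 \<Longrightarrow> \<exists>N. \<forall>z\<in>cball 0 R.
       norm ((T ^^ N) (\<lambda>z. f z ^ m) z - g z) \<le> \<epsilon> \<and> (\<forall>n\<in>{1..<m}. norm ((T ^^ N) (\<lambda>z. f z ^ n) z) \<le> \<epsilon>)"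
    and P: "P \<noteq> 0" "coeff P 0 = 0"
  shows "hypercyclic_vector T (\<lambda>z. poly P (f z))"
proof (subst hypercyclic_vector_iff)
  show "entire ((T ^^ n) (\<lambda>z. poly P (f z)))" for n by (intro Tn_entire entire_poly_comp f)
  define m where "m = degree P"
  define c where "c = coeff P m"
  have c: "c \<noteq> 0" using P(1) by (simp add: c_def m_def)
  have m: "m > 0" using P c by (cases "m = 0") (auto simp: c_def)
  define s where "s = (\<Sum>n\<le>m. norm (coeff P n)) + 1"
  have s: "s > 0" unfolding s_def by (intro add_nonneg_pos sum_nonneg) auto
  show "\<forall>g R \<epsilon>. entire g \<longrightarrow> 0 < \<epsilon> \<longrightarrow>
      (\<exists>N. \<forall>z\<in>cball 0 R. norm ((T ^^ N) (\<lambda>z. poly P (f z)) z - g z) < \<epsilon>)"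
  proof (intro allI impI)
    fix g R and \<epsilon> :: real assume g: "entire g" and \<epsilon>: "\<epsilon> > 0"
    define \<eta> where "\<eta> = \<epsilon> / s"
    have \<eta>: "\<eta> > 0" using \<epsilon> s by (simp add: \<eta>_def)
    have gc: "entire (\<lambda>z. inverse c * g z)" by (intro holomorphic_on_mult holomorphic_on_const g)
    obtain N where N: "\<forall>z\<in>cball 0 R. norm ((T ^^ N) (\<lambda>z. f z ^ m) z - inverse c * g z) \<le> \<eta> \<and>
        (\<forall>n\<in>{1..<m}. norm ((T ^^ N) (\<lambda>z. f z ^ n) z) \<le> \<eta>)"
      using target[OF m gc \<eta>, of R] by blast
    have "norm ((T ^^ N) (\<lambda>z. poly P (f z)) z - g z) < \<epsilon>" if z: "z \<in> cball 0 R" for z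
    proof -
      define b where "b n = (T ^^ N) (\<lambda>z. f z ^ n) z" for n
      have b_low: "norm (b n) \<le> \<eta>" if "n \<in> {1..<m}" for n using N z that unfolding b_def by blast
      have b_top: "norm (b m - inverse c * g z) \<le> \<eta>" using N z unfolding b_def by blast
      have "(T ^^ N) (\<lambda>z. poly P (f z)) z = (\<Sum>n\<le>m. coeff P n * b n)"
        unfolding poly_altdef m_def[symmetric] b_def
        by (subst Tn_lincomb) (auto intro: holomorphic_on_power f)
      also have "\<dots> = c * b m + (\<Sum>n<m. coeff P n * b n)"
        by (simp add: lessThan_Suc_atMost[symmetric] c_def)
      finally have "(T ^^ N) (\<lambda>z. poly P (f z)) z - g z
          = c * (b m - inverse c * g z) + (\<Sum>n<m. coeff P n * b n)"
        using c by (simp add: right_diff_distrib)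
      also have "norm \<dots> \<le> norm c * \<eta> + (\<Sum>n<m. norm (coeff P n) * \<eta>)"
      proof (intro order_trans[OF norm_triangle_ineq] add_mono sum_norm_le)
        show "norm (c * (b m - inverse c * g z)) \<le> norm c * \<eta>"
          unfolding norm_mult by (intro mult_left_mono b_top) auto
        fix n assume n: "n \<in> {..<m}"
        show "norm (coeff P n * b n) \<le> norm (coeff P n) * \<eta>"
        proof (cases "n = 0")
          case False
          then show ?thesis unfolding norm_mult using n by (intro mult_left_mono b_low) auto
        qed (simp add: P)
      qed
      also have "\<dots> = (\<Sum>n\<le>m. norm (coeff P n)) * \<eta>"
        by (simp add: lessThan_Suc_atMost[symmetric] c_def sum_distrib_right distrib_right)
      also have "\<dots> < s * \<eta>" using \<eta> by (intro mult_strict_right_mono) (auto simp: s_def)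
      also have "s * \<eta> = \<epsilon>" using s by (simp add: \<eta>_def)
      finally show ?thesis .
    qed
    then show "\<exists>N. \<forall>z\<in>cball 0 R. norm ((T ^^ N) (\<lambda>z. poly P (f z)) z - g z) < \<epsilon>" by blast
  qed
qed

theorem nonexponential_symbol_has_hypercyclic_algebra:
  assumes \<Phi>0: "\<Phi> 0 = 1" and nonexp: "\<And>c. \<exists>z. \<Phi> z \<noteq> exp (c * z)"
  shows "has_hypercyclic_algebra T"
proof -
  obtain f where f: "entire f"
    and target: "\<And>m g R \<epsilon>. m > 0 \<Longrightarrow> entire g \<Longrightarrow> \<epsilon> > 0 \<Longrightarrow> \<exists>N. \<forall>z\<in>cball 0 R.
       norm ((T ^^ N) (\<lambda>z. f z ^ m) z - g z) \<le> \<epsilon> \<and> (\<forall>n\<in>{1..<m}. norm ((T ^^ N) (\<lambda>z. f z ^ n) z) \<le> \<epsilon>)"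
    by (rule common_power_targeting_vector[OF \<Phi>0 nonexp]) blast
  note hyp = polynomial_in_targeting_vector_hypercyclic[OF f target]
  define A where "A = {\<lambda>z. poly P (f z) | P. coeff P 0 = 0}"
  have AI: "(\<lambda>z. poly P (f z)) \<in> A" if "coeff P 0 = 0" for P using that by (auto simp: A_def)
  have sub: "entire_subalgebra A"
    unfolding entire_subalgebra_def
  proof (intro conjI ballI allI)
    show "A \<subseteq> {f. entire f}" using entire_poly_comp[OF f] by (auto simp: A_def)
    show "(\<lambda>_. 0) \<in> A" using AI[of 0] by simp
  next
    fix g h assume "g \<in> A" "h \<in> A"
    then obtain P Q where "g = (\<lambda>z. poly P (f z))" "h = (\<lambda>z. poly Q (f z))" "coeff P 0 = 0" "coeff Q 0 = 0"
      by (auto simp: A_def)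
    then show "(\<lambda>z. g z + h z) \<in> A" "(\<lambda>z. g z * h z) \<in> A"
      using AI[of "P + Q"] AI[of "P * Q"] by (simp_all add: coeff_mult_0)
  next
    fix c g assume "g \<in> A"
    then obtain P where "g = (\<lambda>z. poly P (f z))" "coeff P 0 = 0" by (auto simp: A_def)
    then show "(\<lambda>z. c * g z) \<in> A" using AI[of "smult c P"] by simp
  qed
  have fA: "f \<in> A" using AI[of "[:0, 1:]"] by simp
  have "f \<noteq> (\<lambda>_. 0)"
  proof
    assume f0: "f = (\<lambda>_. 0)"
    obtain N where "\<forall>z\<in>cball 0 (1::real). norm ((T ^^ N) (\<lambda>z. f z ^ 1) z - 1) \<le> 1/2"
      using target[of 1 "\<lambda>_. 1" "1/2" 1] by auto
    then have "norm ((T ^^ N) (\<lambda>z. f z ^ 1) 0 - 1) \<le> 1/2" by (rule bspec) simp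
    then show False by (simp add: f0 Tn_zero)
  qed
  then have "A \<noteq> {\<lambda>_. 0}" using fA by blast
  moreover have "hypercyclic_vector T g" if "g \<in> A" "g \<noteq> (\<lambda>_. 0)" for g
  proof -
    obtain P where "g = (\<lambda>z. poly P (f z))" "coeff P 0 = 0" using \<open>g \<in> A\<close> by (auto simp: A_def)
    then show ?thesis using hyp[of P] that(2) by (cases "P = 0") auto
  qed
  ultimately show ?thesis unfolding has_hypercyclic_algebra_def using sub by blast
qed

end

section \<open>Growth of the symbol\<close>

lemma max_modulus_upper:
  assumes "entire \<Phi>" "norm z \<le> r" shows "norm (\<Phi> z) \<le> max_modulus \<Phi> r"
proof -
  obtain M where "\<And>w. w \<in> cball 0 r \<Longrightarrow> norm (\<Phi> w) \<le> M"
    using entire_norm_bounded[OF assms(1), of r] by blast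
  then have "bdd_above ((\<lambda>z. norm (\<Phi> z)) ` cball 0 r)" by (intro bdd_aboveI2)
  then show ?thesis unfolding max_modulus_def using assms(2) by (intro cSUP_upper) auto
qed

text \<open>If the order is below 1, then \<open>ln M(r) \<le> r ^ \<rho>\<close> eventually for some \<open>\<rho> < 1\<close>, which is below any line
of positive slope; if the order is 1, the type bounds the slope directly. On the remaining disc \<open>\<Phi>\<close> is
bounded.\<close>

lemma of_growth_one_imp_exp_bound:
  assumes \<Phi>: "entire \<Phi>" "\<not> \<Phi> constant_on UNIV" and growth: "of_growth \<Phi> 1 \<tau>" and \<sigma>: "\<tau> < \<sigma>" "0 < \<sigma>"
  obtains C where "C > 0" "\<And>z. norm (\<Phi> z) \<le> C * exp (\<sigma> * norm z)"
proof -
  let ?M = "max_modulus \<Phi>"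
  have ord: "growth_order \<Phi> = Limsup at_top (\<lambda>r::real. ereal (ln (ln (?M r)) / ln r))"
    using \<Phi>(2) by (simp add: growth_order_def)
  have "\<forall>\<^sub>F r in at_top. ln (?M r) \<le> \<sigma> * r"
  proof (cases "growth_order \<Phi> < ereal 1")
    case True
    then obtain \<rho> where \<rho>: "growth_order \<Phi> < ereal \<rho>" "\<rho> < 1"
      using ereal_dense2[OF True] by (auto simp: one_ereal_def)
    from Limsup_lessD[OF \<rho>(1)[unfolded ord]]
    have "\<forall>\<^sub>F r in at_top. ln (ln (?M r)) / ln r < \<rho>" by simp
    moreover have "\<forall>\<^sub>F r::real in at_top. r powr \<rho> \<le> \<sigma> * r" using \<rho>(2) \<sigma>(2) by real_asymp
    ultimately show ?thesis using eventually_gt_at_top[of 1]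
    proof eventually_elim
      case (elim r)
      show ?case
      proof (cases "ln (?M r) > 0")
        case True
        have "ln (ln (?M r)) < \<rho> * ln r" using elim by (simp add: pos_divide_less_eq)
        then have "exp (ln (ln (?M r))) < exp (\<rho> * ln r)" by (rule exp_less_mono)
        then show ?thesis using elim True by (simp add: powr_def)
      next
        case False
        moreover have "\<sigma> * r > 0" using elim \<sigma> by simp
        ultimately show ?thesis by linarith
      qed
    qed
  next
    case False
    then have ord1: "growth_order \<Phi> = ereal 1" and type: "growth_type \<Phi> \<le> ereal \<tau>"
      using growth by (auto simp: of_growth_def)
    have "growth_type \<Phi> < ereal \<sigma>" using type \<sigma>(1) by (meson ereal_less_eq less_ereal.simps(1) order_le_less_trans)
    from Limsup_lessD[OF this[unfolded growth_type_def]]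
    have "\<forall>\<^sub>F r in at_top. r powr (-1) * ln (?M r) < \<sigma>" by (simp add: ord1)
    then show ?thesis using eventually_gt_at_top[of 0]
      by eventually_elim (simp add: powr_minus field_simps)
  qed
  then obtain r0 where r0: "\<And>r. r \<ge> r0 \<Longrightarrow> ln (?M r) \<le> \<sigma> * r" unfolding eventually_at_top_linorder by blast
  obtain M where M: "M > 0" "\<And>z. z \<in> cball 0 r0 \<Longrightarrow> norm (\<Phi> z) \<le> M"
    using entire_norm_bounded[OF \<Phi>(1), of r0] by blast
  show thesis
  proof (rule that[of "M + 1"])
    fix z :: complex
    have e1: "1 \<le> exp (\<sigma> * norm z)" using \<sigma>(2) by simp
    show "norm (\<Phi> z) \<le> (M + 1) * exp (\<sigma> * norm z)"
    proof (cases "norm z \<le> r0")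
      case True
      then have "norm (\<Phi> z) \<le> (M + 1) * 1" using M(2)[of z] by simp
      also have "\<dots> \<le> (M + 1) * exp (\<sigma> * norm z)" using M(1) e1 by (intro mult_left_mono) auto
      finally show ?thesis .
    next
      case False
      have 1: "norm (\<Phi> z) \<le> ?M (norm z)" by (rule max_modulus_upper[OF \<Phi>(1)]) simp
      have "norm (\<Phi> z) \<le> exp (\<sigma> * norm z)"
      proof (cases "?M (norm z) > 0")
        case True
        then have "?M (norm z) = exp (ln (?M (norm z)))" by simp
        also have "\<dots> \<le> exp (\<sigma> * norm z)" using r0[of "norm z"] False by simp
        finally show ?thesis using 1 by simp
      next
        case False
        then have "norm (\<Phi> z) \<le> 0" using 1 by linarith
        then show ?thesis using exp_ge_zero[of "\<sigma> * norm z"] by linarith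
      qed
      also have "\<dots> \<le> (M + 1) * exp (\<sigma> * norm z)" using M(1) by simp
      finally show ?thesis .
    qed
  qed (use M in simp)
qed

text \<open>Cauchy's inequality for the \<open>n\<close>-th coefficient on the circle of radius \<open>n / \<sigma>\<close>, which minimises
\<open>exp (\<sigma> * r) / r ^ n\<close>, together with \<open>fact n \<le> n ^ n\<close>.\<close>

lemma exp_bound_imp_exp_type_symbol:
  assumes \<Phi>: "entire \<Phi>" and \<sigma>: "\<sigma> > 0" and C: "C > 0" and bound: "\<And>z. norm (\<Phi> z) \<le> C * exp (\<sigma> * norm z)"
  shows "exp_type_symbol \<Phi> C (exp 1 * \<sigma>)"
proof unfold_locales
  fix n
  show "norm (fps_nth (fps_expansion \<Phi> 0) n) \<le> C * (exp 1 * \<sigma>) ^ n / fact n"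
  proof (cases "n = 0")
    case True
    then show ?thesis using bound[of 0] by (simp add: fps_expansion_def)
  next
    case False
    define r where "r = real n / \<sigma>"
    have r: "r > 0" using False \<sigma> by (simp add: r_def)
    have "norm ((deriv ^^ n) \<Phi> 0) \<le> fact n * (C * exp (\<sigma> * r)) / r ^ n"
    proof (rule Cauchy_inequality[OF _ _ r])
      show "norm (\<Phi> x) \<le> C * exp (\<sigma> * r)" if "norm (0 - x) = r" for x using bound[of x] that by simp
    qed (auto intro: holomorphic_on_subset[OF \<Phi>] entire_continuous_on[OF \<Phi>])
    then have "norm (fps_nth (fps_expansion \<Phi> 0) n) \<le> (C * exp (\<sigma> * r)) / r ^ n"
      by (simp add: fps_expansion_def norm_divide pos_divide_le_eq mult.commute)
    also have "exp (\<sigma> * r) = exp 1 ^ n" using \<sigma> by (simp add: r_def exp_of_nat_mult[symmetric])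
    also have "C * exp 1 ^ n / r ^ n = C * (exp 1 * \<sigma>) ^ n / real n ^ n"
      using \<sigma> False by (simp add: r_def power_divide power_mult_distrib field_simps)
    also have "\<dots> \<le> C * (exp 1 * \<sigma>) ^ n / fact n"
    proof (rule divide_left_mono)
      show "fact n \<le> real n ^ n" using fact_le_power[of n] by (metis of_nat_fact of_nat_le_iff of_nat_power)
    qed (use C \<sigma> False in auto)
    finally show ?thesis .
  qed
qed (use \<Phi> \<sigma> C in auto)

text \<open>A bound by \<open>exp (\<epsilon> * norm z)\<close> with \<open>\<epsilon> < norm c\<close> fails on the ray on which \<open>c * z\<close> is positive.\<close>

lemma exponential_not_subexponential:
  assumes \<Phi>: "\<And>z. \<Phi> z = exp (c * z)" and nonconst: "\<not> \<Phi> constant_on UNIV"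
  shows "\<not> subexponential_growth \<Phi>"
proof
  assume sub: "subexponential_growth \<Phi>"
  have "\<Phi> = (\<lambda>z. exp (c * z))" using \<Phi> by (simp add: fun_eq_iff)
  then have ent: "entire \<Phi>" by (simp add: holomorphic_intros)
  have c: "c \<noteq> 0" using nonconst \<Phi> by (auto simp: constant_on_def)
  obtain C where C: "C > 0" "\<And>z. norm (\<Phi> z) \<le> C * exp (norm c / 2 * norm z)"
    by (rule of_growth_one_imp_exp_bound[OF ent nonconst sub[unfolded subexponential_growth_def], of "norm c / 2"])
       (use c in auto)
  \<comment> \<open>On the ray where \<open>c * z\<close> is positive the function grows like \<open>exp (norm c * norm z)\<close>.\<close>
  have ray: "exp (norm c / 2 * r) \<le> C" if "r \<ge> 0" for r
  proof -
    define z where "z = of_real r * sgn (cnj c)"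
    have nz: "norm z = r" using that c by (simp add: z_def norm_mult norm_sgn)
    have "c * cnj c = of_real (norm c) * of_real (norm c)"
      by (simp only: complex_norm_square[symmetric] power2_eq_square of_real_mult)
    then have "c * z = of_real (norm c * r)"
      using c by (simp add: z_def sgn_eq field_simps)
    then have "norm (\<Phi> z) = exp (norm c * r)" by (simp only: \<Phi> norm_exp_eq_Re Re_complex_of_real)
    with C(2)[of z] nz have "exp (norm c * r) \<le> C * exp (norm c / 2 * r)" by simp
    moreover have "exp (norm c * r) = exp (norm c / 2 * r) * exp (norm c / 2 * r)"
      by (simp add: exp_add[symmetric])
    ultimately show ?thesis by simp
  qed
  have "exp (norm c / 2 * (2 * C / norm c)) \<le> C" using C(1) c by (intro ray) auto
  then have "exp C \<le> C" using c by simp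
  then show False using exp_ge_add_one_self[of C] by linarith
qed

section \<open>Zero-free symbols and translations\<close>

text \<open>The inequality of Borel and Caratheodory: the Moebius map \<open>w \<mapsto> w / (2 A - w)\<close> sends the half plane
\<open>Re w < A\<close> into the unit disc and fixes 0, so the Schwarz lemma applies to its composition with \<open>g\<close>.\<close>

lemma real_part_bound_imp_bound:
  assumes g: "entire g" "g 0 = 0" and A: "\<And>z. norm z \<le> R \<Longrightarrow> Re (g z) < A" and R: "R > 0" and z: "norm z \<le> R / 2"
  shows "norm (g z) \<le> 2 * A"
proof -
  have A0: "A > 0" using A[of 0] g(2) R by simp
  have scale: "norm (of_real R * \<xi>) \<le> R" if "norm \<xi> < 1" for \<xi> :: complex
    using mult_left_mono[of "norm \<xi>" 1 R] that R by (simp add: norm_mult)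
  have denom: "of_real (2 * A) - g (of_real R * \<xi>) \<noteq> 0" if "norm \<xi> < 1" for \<xi>
  proof
    assume "of_real (2 * A) - g (of_real R * \<xi>) = 0"
    then have "Re (of_real (2 * A) - g (of_real R * \<xi>)) = Re 0" by (rule arg_cong)
    then show False using A[OF scale[OF that]] A0 by simp
  qed
  define f where "f \<xi> = g (of_real R * \<xi>) / (of_real (2 * A) - g (of_real R * \<xi>))" for \<xi>
  have comp: "(\<lambda>\<xi>. g (of_real R * \<xi>)) holomorphic_on ball 0 1"
    using holomorphic_on_compose_gen[of "\<lambda>\<xi>. of_real R * \<xi>" "ball 0 1" g UNIV] g(1)
    by (simp add: o_def holomorphic_on_mult)
  have f_hol: "f holomorphic_on ball 0 1"
    unfolding f_def by (intro holomorphic_on_divide holomorphic_on_diff comp holomorphic_on_const) (use denom in auto)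
  have less: "norm (f \<xi>) < 1" if "norm \<xi> < 1" for \<xi>
  proof -
    define w where "w = g (of_real R * \<xi>)"
    have "Re w < A" using A[OF scale[OF that]] by (simp add: w_def)
    then have "4 * A * Re w < 4 * A * A" using A0 by simp
    then have "(norm w)\<^sup>2 < (norm (of_real (2 * A) - w))\<^sup>2"
      unfolding cmod_power2 by (simp add: power2_eq_square algebra_simps)
    then have "norm w < norm (of_real (2 * A) - w)" by (rule power2_less_imp_less) simp
    then show ?thesis using denom[OF that] by (simp add: f_def w_def norm_divide)
  qed
  define \<xi> where "\<xi> = z / of_real R"
  have \<xi>: "norm \<xi> \<le> 1/2" using z R by (simp add: \<xi>_def norm_divide)
  have "norm (f \<xi>) \<le> norm \<xi>"
    by (rule Schwarz_Lemma(1)[OF f_hol _ less]) (use \<xi> g(2) in \<open>auto simp: f_def\<close>)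
  then have "norm (f \<xi>) \<le> 1/2" using \<xi> by linarith
  moreover have "f \<xi> = g z / (of_real (2 * A) - g z)" using R by (simp add: f_def \<xi>_def)
  moreover have "of_real (2 * A) - g z \<noteq> 0" using denom[of \<xi>] \<xi> R by (simp add: \<xi>_def)
  ultimately have "2 * norm (g z) \<le> norm (of_real (2 * A) - g z)" by (simp add: norm_divide)
  also have "\<dots> \<le> 2 * A + norm (g z)" using norm_triangle_ineq4[of "of_real (2 * A)" "g z"] A0 by simp
  finally show ?thesis by simp
qed

text \<open>A logarithm \<open>g\<close> of \<open>\<Phi>\<close> has real part bounded by a linear function of \<open>norm z\<close>. Hence \<open>g\<close> itself has
linear growth and is a polynomial of degree at most 1 by Liouville's theorem.\<close>

lemma zero_free_exp_type_is_exponential: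
  assumes \<Phi>: "entire \<Phi>" "\<Phi> 0 = 1" "\<And>z. \<Phi> z \<noteq> 0" and \<sigma>: "\<sigma> > 0" and C: "C > 0"
    and bound: "\<And>z. norm (\<Phi> z) \<le> C * exp (\<sigma> * norm z)"
  obtains a where "\<And>z. \<Phi> z = exp (a * z)"
proof (rule contractible_imp_holomorphic_log[OF \<Phi>(1) _ \<Phi>(3)])
  show "contractible (UNIV :: complex set)" by (rule contractible_UNIV)
  fix h assume h: "entire h" and exp_h: "\<And>z. z \<in> UNIV \<Longrightarrow> \<Phi> z = exp (h z)"
  define g where "g z = h z - h 0" for z
  have g: "entire g" unfolding g_def by (intro holomorphic_on_diff h holomorphic_on_const)
  have g0: "g 0 = 0" by (simp add: g_def)
  have exp_g: "\<Phi> z = exp (g z)" for z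
    using exp_h[of z] exp_h[of 0] \<Phi>(2) by (simp add: g_def exp_diff)
  define A where "A R = \<bar>ln C\<bar> + 1 + \<sigma> * R" for R
  have Re_g: "Re (g z) < A R" if "norm z \<le> R" for z R
  proof -
    have "exp (Re (g z)) \<le> exp (ln C + \<sigma> * norm z)"
      using bound[of z] C by (simp add: exp_g exp_add)
    then have "Re (g z) \<le> ln C + \<sigma> * norm z" by simp
    moreover have "\<sigma> * norm z \<le> \<sigma> * R" using that \<sigma> by simp
    ultimately show ?thesis unfolding A_def by linarith
  qed
  define B where "B = 2 * (\<bar>ln C\<bar> + 1) + 4 * \<sigma>"
  have lin: "norm (g z) \<le> B * norm z ^ 1" if "1 \<le> norm z" for z
  proof -
    have "norm (g z) \<le> 2 * A (2 * norm z)"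
      by (rule real_part_bound_imp_bound[OF g g0 Re_g]) (use that in auto)
    also have "\<dots> \<le> B * norm z"
      using that mult_right_mono[of 1 "norm z" "2 * (\<bar>ln C\<bar> + 1)"] by (simp add: A_def B_def algebra_simps)
    finally show ?thesis by simp
  qed
  have "g z = (\<Sum>k\<le>1. (deriv ^^ k) g 0 / fact k * z ^ k)" for z
    by (rule Liouville_polynomial[OF g lin])
  then have "g z = deriv g 0 * z" for z using g0 by simp
  then show thesis using exp_g that by metis
qed

text \<open>For \<open>\<Phi> z = exp (a * z)\<close> the series \<open>\<Phi>(D) f\<close> is the Taylor expansion of \<open>f (z + a)\<close> around \<open>z\<close>.\<close>

lemma diff_operator_exp_is_translation:
  assumes \<Phi>: "\<And>z. \<Phi> z = exp (a * z)" and f: "entire f"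
  shows "diff_operator \<Phi> f = (\<lambda>z. f (z + a))"
proof
  fix z
  have "\<Phi> = (\<lambda>z. exp (a * z))" using \<Phi> by (simp add: fun_eq_iff)
  then have coeff: "fps_nth (fps_expansion \<Phi> 0) n = a ^ n / fact n" for n
    by (simp add: fps_expansion_def higher_deriv_exp_mult)
  have "(\<lambda>n. (deriv ^^ n) f z / fact n * ((z + a) - z) ^ n) sums f (z + a)"
    by (rule holomorphic_power_series[where r = "norm a + 1"])
       (auto intro: holomorphic_on_subset[OF f] simp: dist_norm)
  then show "diff_operator \<Phi> f z = f (z + a)"
    by (simp add: diff_operator_def coeff sums_iff mult.commute)
qed

text \<open>The identity has winding number 1 around 0 on the unit circle, a square has an even one. In elementary
terms: if \<open>g\<^sup>2\<close> is close to \<open>z\<close>, the square of \<open>x = g z * cnj (g (- z))\<close> is close to \<open>-1\<close>, so \<open>Im x\<close>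
has no zero on the circle; but \<open>Im x\<close> is an odd function on a connected set.\<close>

lemma no_square_close_to_identity:
  fixes g :: "complex \<Rightarrow> complex"
  assumes g: "continuous_on UNIV g" and close: "\<And>z. norm z = 1 \<Longrightarrow> norm ((g z)\<^sup>2 - z) < 1/3"
  shows False
proof -
  define p where "p z = Im (g z * cnj (g (- z)))" for z
  have cg: "continuous_on S (\<lambda>z. g (- z))" for S
    by (rule continuous_on_compose2[OF g]) (auto intro: continuous_intros)
  have p_cont: "continuous_on (sphere 0 1) p"
    unfolding p_def by (intro continuous_intros cg continuous_on_subset[OF g]) auto
  have p_odd: "p (- z) = - p z" for z by (simp add: p_def)
  have p_nz: "p z \<noteq> 0" if z: "norm z = 1" for z
  proof
    assume "p z = 0"
    define e1 where "e1 = (g z)\<^sup>2 - z"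
    define e2 where "e2 = (g (- z))\<^sup>2 - (- z)"
    have e: "norm e1 < 1/3" "norm e2 < 1/3" using close[of z] close[of "- z"] z by (auto simp: e1_def e2_def)
    define x where "x = g z * cnj (g (- z))"
    have "x\<^sup>2 = (g z)\<^sup>2 * cnj ((g (- z))\<^sup>2)" by (simp add: x_def power_mult_distrib)
    also have "\<dots> = (z + e1) * cnj (- z + e2)" by (simp add: e1_def e2_def)
    also have "\<dots> = - (z * cnj z) + (z * cnj e2 - e1 * cnj z + e1 * cnj e2)" by (simp add: algebra_simps)
    also have "z * cnj z = 1" using z by (simp add: complex_norm_square[symmetric])
    finally have x2: "x\<^sup>2 = - 1 + (z * cnj e2 - e1 * cnj z + e1 * cnj e2)" .
    have "norm (z * cnj e2 - e1 * cnj z + e1 * cnj e2) \<le> norm (z * cnj e2) + norm (e1 * cnj z) + norm (e1 * cnj e2)"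
      by (intro order_trans[OF norm_triangle_ineq] add_right_mono norm_triangle_ineq4)
    also have "\<dots> = norm e2 + norm e1 + norm e1 * norm e2" using z by (simp add: norm_mult)
    also have "norm e1 * norm e2 \<le> (1/3) * (1/3)" using e by (intro mult_mono) auto
    finally have "norm (z * cnj e2 - e1 * cnj z + e1 * cnj e2) < 1" using e by simp
    then have "Re (z * cnj e2 - e1 * cnj z + e1 * cnj e2) < 1"
      using complex_Re_le_cmod order_le_less_trans by blast
    then have "Re (x\<^sup>2) < 0" unfolding x2 by (simp only: plus_complex.sel uminus_complex.sel one_complex.sel)
    moreover have "Im x = 0" using \<open>p z = 0\<close> by (simp add: p_def x_def)
    then have "Re (x\<^sup>2) \<ge> 0" by (simp add: power2_eq_square)
    ultimately show False by simp
  qed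
  have "connected (p ` sphere 0 1)"
    by (intro connected_continuous_image p_cont connected_sphere) simp
  moreover have "p 1 \<in> p ` sphere 0 1" "- p 1 \<in> p ` sphere 0 1"
    using imageI[of 1 "sphere 0 1" p] imageI[of "-1" "sphere 0 1" p] p_odd[of 1] by auto
  ultimately have "0 \<in> p ` sphere 0 1"
    using connectedD_interval[of "p ` sphere 0 1" "p 1" "- p 1" 0] connectedD_interval[of "p ` sphere 0 1" "- p 1" "p 1" 0]
    by (cases "p 1 \<le> 0") auto
  then show False using p_nz by auto
qed

lemma translation_no_hypercyclic_algebra:
  assumes T: "\<And>f. entire f \<Longrightarrow> T f = (\<lambda>z. f (z + a))"
  shows "\<not> has_hypercyclic_algebra T"
proof
  assume "has_hypercyclic_algebra T"
  then obtain A where A: "entire_subalgebra A" "A \<noteq> {\<lambda>_. 0}"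
    and hc: "\<And>f. f \<in> A \<Longrightarrow> f \<noteq> (\<lambda>_. 0) \<Longrightarrow> hypercyclic_vector T f"
    unfolding has_hypercyclic_algebra_def by blast
  from A have "\<exists>f\<in>A. f \<noteq> (\<lambda>_. 0)" unfolding entire_subalgebra_def by blast
  then obtain f where f: "f \<in> A" "f \<noteq> (\<lambda>_. 0)" by blast
  have ef: "entire f" using A(1) f(1) unfolding entire_subalgebra_def by auto
  have sq: "(\<lambda>z. f z * f z) \<in> A" using A(1) f(1) unfolding entire_subalgebra_def by auto
  have shift: "entire (\<lambda>z. h (z + b))" if "entire h" for h and b :: complex
    using holomorphic_on_compose_gen[of "\<lambda>z. z + b" UNIV h UNIV] that by (simp add: o_def holomorphic_on_add)
  have Tn: "(T ^^ n) h = (\<lambda>z. h (z + of_nat n * a))" if h: "entire h" for n h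
  proof (induction n)
    case (Suc n)
    have "T (\<lambda>z. h (z + of_nat n * a)) = (\<lambda>z. h (z + a + of_nat n * a))" by (rule T[OF shift[OF h]])
    then show ?case by (simp add: Suc algebra_simps)
  qed simp
  have e2: "entire (\<lambda>z. f z * f z)" by (intro holomorphic_on_mult ef)
  have "hypercyclic_vector T (\<lambda>z. f z * f z)" using f(2) by (intro hc sq) (auto simp: fun_eq_iff)
  moreover have "entire ((T ^^ n) (\<lambda>z. f z * f z))" for n unfolding Tn[OF e2] by (rule shift[OF e2])
  ultimately have "\<forall>g R \<epsilon>. entire g \<longrightarrow> 0 < \<epsilon> \<longrightarrow>
      (\<exists>n. \<forall>z\<in>cball 0 R. norm ((T ^^ n) (\<lambda>z. f z * f z) z - g z) < \<epsilon>)"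
    by (simp only: hypercyclic_vector_iff)
  from this[rule_format, OF holomorphic_on_ident, of "1/3" 1]
  obtain n where n: "\<forall>z\<in>cball 0 1. norm ((T ^^ n) (\<lambda>z. f z * f z) z - z) < 1/3" by auto
  show False
  proof (rule no_square_close_to_identity)
    show "continuous_on UNIV (\<lambda>z. f (z + of_nat n * a))" by (rule entire_continuous_on[OF shift[OF ef]])
    show "norm ((f (z + of_nat n * a))\<^sup>2 - z) < 1/3" if "norm z = 1" for z
      using n that unfolding Tn[OF e2] by (simp add: power2_eq_square)
  qed
qed

section \<open>The cases of the theorem\<close>

theorem theorem1p2:
  fixes \<Phi> :: "complex \<Rightarrow> complex"
  assumes "\<Phi> holomorphic_on UNIV"
    and "\<not> \<Phi> constant_on UNIV"
    and "exponential_type \<Phi>"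
    and "\<Phi> 0 = 1"
  shows
    "(subexponential_growth \<Phi> \<longrightarrow> has_hypercyclic_algebra (diff_operator \<Phi>)) \<and>
     (\<not> subexponential_growth \<Phi> \<longrightarrow>
        ((\<forall>z. \<Phi> z \<noteq> 0) \<longrightarrow> \<not> has_hypercyclic_algebra (diff_operator \<Phi>)) \<and>
        (\<forall>(p :: complex poly) (a :: complex).
            degree p > 0 \<and> coeff p 0 = 1 \<and> a \<noteq> 0 \<and>
            (\<forall>z. \<Phi> z = exp (a * z) * poly p z) \<and>
            (coeff p 1 * inverse a \<notin> \<real> \<or> 2 * coeff p 2 \<noteq> (coeff p 1)\<^sup>2) \<longrightarrow>
            has_hypercyclic_algebra (diff_operator \<Phi>)) \<and>
        (\<forall>(zs :: nat \<Rightarrow> complex) (a :: complex).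
            infinite {z. \<Phi> z = 0} \<and> zero_sequence \<Phi> zs \<and> hadamard_factorization \<Phi> a zs \<and>
            (\<Sum>n. inverse ((zs n)\<^sup>2)) \<noteq> 0 \<longrightarrow>
            (summable (\<lambda>n. inverse (norm (zs n))) \<longrightarrow>
               has_hypercyclic_algebra (diff_operator \<Phi>)) \<and>
            (\<not> summable (\<lambda>n. inverse (norm (zs n))) \<and> a \<noteq> 0 \<longrightarrow>
               has_hypercyclic_algebra (diff_operator \<Phi>))))"
proof -
  obtain \<tau> where \<tau>: "of_growth \<Phi> 1 \<tau>" using assms(3) unfolding exponential_type_def by blast
  define \<sigma> where "\<sigma> = \<bar>\<tau>\<bar> + 1"
  have \<sigma>: "\<tau> < \<sigma>" "\<sigma> > 0" by (auto simp: \<sigma>_def)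
  obtain C where C: "C > 0" "\<And>z. norm (\<Phi> z) \<le> C * exp (\<sigma> * norm z)"
    by (rule of_growth_one_imp_exp_bound[OF assms(1,2) \<tau> \<sigma>]) blast
  interpret exp_type_symbol \<Phi> C "exp 1 * \<sigma>"
    by (rule exp_bound_imp_exp_type_symbol[OF assms(1) \<sigma>(2) C])
  have algebra_if: "has_hypercyclic_algebra (diff_operator \<Phi>)" if "\<And>c. \<exists>z. \<Phi> z \<noteq> exp (c * z)"
    by (rule nonexponential_symbol_has_hypercyclic_algebra[OF assms(4) that])
  have zero: "has_hypercyclic_algebra (diff_operator \<Phi>)" if "\<Phi> z0 = 0" for z0
  proof (rule algebra_if)
    show "\<exists>z. \<Phi> z \<noteq> exp (c * z)" for c using that by (intro exI[of _ z0]) simp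
  qed
  show ?thesis
  proof (intro conjI impI allI)
    assume sub: "subexponential_growth \<Phi>"
    show "has_hypercyclic_algebra (diff_operator \<Phi>)"
    proof (rule algebra_if)
      show "\<exists>z. \<Phi> z \<noteq> exp (c * z)" for c
        using exponential_not_subexponential[of \<Phi> c] assms(2) sub by blast
    qed
  next
    assume nz: "\<forall>z. \<Phi> z \<noteq> 0"
    obtain a where a: "\<And>z. \<Phi> z = exp (a * z)"
      by (rule zero_free_exp_type_is_exponential[OF assms(1,4) _ \<sigma>(2) C]) (use nz in auto)
    show "\<not> has_hypercyclic_algebra (diff_operator \<Phi>)"
      by (rule translation_no_hypercyclic_algebra[OF diff_operator_exp_is_translation[OF a]])
  next
    fix p :: "complex poly" and a :: complex
    assume *: "degree p > 0 \<and> coeff p 0 = 1 \<and> a \<noteq> 0 \<and> (\<forall>z. \<Phi> z = exp (a * z) * poly p z) \<and>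
      (coeff p 1 * inverse a \<notin> \<real> \<or> 2 * coeff p 2 \<noteq> (coeff p 1)\<^sup>2)"
    then have "\<not> constant (poly p)" by (simp add: constant_degree)
    then obtain z0 where "poly p z0 = 0" using fundamental_theorem_of_algebra by blast
    then show "has_hypercyclic_algebra (diff_operator \<Phi>)" using * by (intro zero[of z0]) simp
  next
    fix zs :: "nat \<Rightarrow> complex" and a :: complex
    assume *: "infinite {z. \<Phi> z = 0} \<and> zero_sequence \<Phi> zs \<and> hadamard_factorization \<Phi> a zs \<and>
      (\<Sum>n. inverse ((zs n)\<^sup>2)) \<noteq> 0"
    then have "{z. \<Phi> z = 0} \<noteq> {}" by (metis finite.emptyI)
    then obtain z0 where "\<Phi> z0 = 0" by blast
    from zero[OF this] show "has_hypercyclic_algebra (diff_operator \<Phi>)"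
      "has_hypercyclic_algebra (diff_operator \<Phi>)" by this+
  qed
qed

end
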